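(* Let $\alpha\in(0,3)\cup(3,4)$, let $X_{11}$ be symmetric with $\mathbb P(|X_{11}|>x)=x^{-\alpha}L(x)$, $x>0$, $L$ slowly varying at infinity, and let $p=p_n\to\infty$ as $n\to\infty$. (i) If $p_n/n^{\delta}\to\infty$ for some $\delta>\delta^*(\alpha)$, then $$\lim_{n\to\infty}\frac{\mathbb E\big[(\operatorname{tr}(\mathbf R^2)-\mathbb E[\operatorname{tr}(\mathbf R^2)])^4\big]}{\operatorname{Var}(\operatorname{tr}(\mathbf R^2))^2}=3.$$ (ii) If $p_n/n^{\delta}\to0$ for some $\delta<\delta^*(\alpha)$, then $$\lim_{n\to\infty}\frac{\mathbb E\big[(\operatorname{tr}(\mathbf R^2)-\mathbb E[\operatorname{tr}(\mathbf R^2)])^4\big]}{\operatorname{Var}(\operatorname{tr}(\mathbf R^2))^2}=\infty.$$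
   Context: For each $n$, $(X_{ij})_{1\le i\le p,1\le j\le n}$ are iid copies of a non-degenerate real random variable $X_{11}$ which is symmetric and satisfies $\mathbb P(X_{11}=0)=0$; $\mathbb E[X_{11}^2]=1$ whenever this is finite. Put $Y_{ij}=X_{ij}/\sqrt{X_{i1}^2+\cdots+X_{in}^2}$, $\mathbf Y=(Y_{ij})\in\mathbb R^{p\times n}$ and $\mathbf R=\mathbf Y\mathbf Y^{\top}$ (sample correlation matrix). Define $$\delta^*(\alpha)=\begin{cases}1/2,&\alpha\in(0,2),\\ (\alpha-1)/2,&\alpha\in[2,3],\\ (5-\alpha)/2,&\alpha\in(3,4).\end{cases}$$ *)

theory Defs
  imports "HOL-Probability.Probability" "Jordan_Normal_Form.Matrix"
begin

definition slowly_varying :: "(real \<Rightarrow> real) \<Rightarrow> bool" where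
  "slowly_varying L \<longleftrightarrow>
     (\<exists>x0>0. L \<in> borel_measurable (restrict_space borel {x0..}) \<and> (\<forall>x\<ge>x0. L x > 0)) \<and>
     (\<forall>c>0. ((\<lambda>x. L (c * x) / L x) \<longlongrightarrow> 1) at_top)"

definition symmetric_rv :: "'a measure \<Rightarrow> ('a \<Rightarrow> real) \<Rightarrow> bool" where
  "symmetric_rv M \<xi> \<longleftrightarrow> distr M borel (\<lambda>\<omega>. - \<xi> \<omega>) = distr M borel \<xi>"

definition nondegenerate_rv :: "'a measure \<Rightarrow> ('a \<Rightarrow> real) \<Rightarrow> bool" where
  "nondegenerate_rv M \<xi> \<longleftrightarrow> (\<nexists>c. AE \<omega> in M. \<xi> \<omega> = c)"

definition iid_copies :: "'a measure \<Rightarrow> ('a \<Rightarrow> real) \<Rightarrow> ('i \<Rightarrow> 'a \<Rightarrow> real) \<Rightarrow> 'i set \<Rightarrow> bool" where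
  "iid_copies M \<xi> Z I \<longleftrightarrow>
     prob_space.indep_vars M (\<lambda>_. borel) Z I \<and>
     (\<forall>i\<in>I. distr M borel (Z i) = distr M borel \<xi>)"

text \<open>
  Matrix indices start at 0. A row of \<open>x\<close> that vanishes yields a zero row here; in the
  model below this is a null event.
\<close>

definition self_normalized :: "nat \<Rightarrow> nat \<Rightarrow> (nat \<Rightarrow> nat \<Rightarrow> real) \<Rightarrow> real mat" where
  "self_normalized p n x = mat p n (\<lambda>(i, j). x i j / sqrt (\<Sum>k<n. (x i k)\<^sup>2))"

definition sample_correlation :: "nat \<Rightarrow> nat \<Rightarrow> (nat \<Rightarrow> nat \<Rightarrow> real) \<Rightarrow> real mat" where
  "sample_correlation p n x = self_normalized p n x * transpose_mat (self_normalized p n x)"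

definition mat_tr :: "real mat \<Rightarrow> real" where
  "mat_tr A = (\<Sum>i<dim_row A. A $$ (i, i))"

definition tr_R_sq :: "nat \<Rightarrow> nat \<Rightarrow> (nat \<Rightarrow> nat \<Rightarrow> 'a \<Rightarrow> real) \<Rightarrow> 'a \<Rightarrow> real" where
  "tr_R_sq p n X \<omega> = mat_tr (sample_correlation p n (\<lambda>i j. X i j \<omega>) ^\<^sub>m 2)"

definition delta_star :: "real \<Rightarrow> real" where
  "delta_star \<alpha> = (if \<alpha> < 2 then 1 / 2 else if \<alpha> \<le> 3 then (\<alpha> - 1) / 2 else (5 - \<alpha>) / 2)"

definition kurtosis :: "'a measure \<Rightarrow> ('a \<Rightarrow> real) \<Rightarrow> real" where
  "kurtosis M T = prob_space.expectation M (\<lambda>\<omega>. (T \<omega> - prob_space.expectation M T) ^ 4) /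
                  (prob_space.variance M T)\<^sup>2"

end

theory Submission
  imports Defs "HOL-Combinatorics.Transposition" "HOL-Real_Asymp.Real_Asymp"
begin

text \<open>
  Almost surely every row is nonzero, so the diagonal of \<open>R\<close> is 1 and its off-diagonal entries are
  inner products of independent unit vectors, the directions \<open>Y\<^sub>i\<close> of the rows. By symmetry and
  exchangeability of the entries, \<open>E [R\<^sub>i\<^sub>j\<^sup>2 | Y\<^sub>i] = 1 / n\<close>. Hence \<open>tr R\<^sup>2\<close> minus its mean is twice
  \<open>T = \<Sum>i<j. h (Y\<^sub>i, Y\<^sub>j)\<close> with \<open>h = R\<^sub>i\<^sub>j\<^sup>2 - 1 / n\<close>, a completely degenerate U-statistic of order two in
  independent identically distributed rows.

  In the expansion of \<open>E T\<^sup>4\<close> a product of four factors \<open>h\<close> is a multigraph with four edges on the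
  rows, and by degeneracy only graphs without a vertex of degree one contribute. Two disjoint double
  edges give \<open>3 (E T\<^sup>2)\<^sup>2\<close>, the value 3 of the kurtosis. The other graphs are controlled by three
  numbers, to be compared with \<open>V = E h\<^sup>2\<close>: a quadruple edge has weight \<open>A = E h\<^sup>4\<close>, two double edges
  at a common vertex have weight \<open>B\<close>, the four-cycle has weight \<open>D\<close>. Instead of enumerating graphs,
  the proof adds the rows one at a time; the new row contributes an increment that is centred given
  the past, and only pointwise inequalities of the kind \<open>2 a b \<le> s a\<^sup>2 + b\<^sup>2 / s\<close> are needed.
  The outcome is \<open>U_m4_close\<close>, which yields kurtosis 3 in the limit when
  \<open>A / (p\<^sup>2 V\<^sup>2)\<close>, \<open>B / (p V\<^sup>2)\<close> and \<open>D / V\<^sup>2\<close> vanish, and \<open>U_m4_lower\<close>, which makes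
  the kurtosis diverge when \<open>A / (p\<^sup>2 V\<^sup>2)\<close> diverges.

  For the kernel at hand, \<open>V\<close>, \<open>B\<close> and \<open>D\<close> are evaluated or estimated through the mixed fourth
  moments of the coordinates of one direction, mainly \<open>m4 = E Y\<^sub>1\<^sub>1\<^sup>4\<close>. It turns out that \<open>D / V\<^sup>2 = O(1 / n)\<close> always
  (\<open>cycle_ratio\<close>), that \<open>B\<close> is harmless as soon as \<open>p\<^sup>2 V n\<close> diverges (\<open>wedge_ratio\<close>),
  and that \<open>V\<close> has the order of \<open>n m4\<^sup>2 + 1 / n\<^sup>2\<close>. So \<open>A / (p\<^sup>2 V\<^sup>2)\<close> decides. Here \<open>A\<close> is at most
  \<open>V\<close> and at most a constant times \<open>n m4\<^sup>2\<close> (\<open>kernel_m4_le_moment\<close>); it is at least a constant times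
  \<open>n q\<^sup>2\<close>, where \<open>q\<close> is the probability that the first entry carries nine tenths of the squared
  length of its row: two rows that are dominated by the same coordinate have \<open>h\<close> of order one.

  Regular variation enters only through \<open>m4\<close> and \<open>q\<close>, which both are \<open>n\<close> to the power
  \<open>- a + o(1)\<close> with \<open>a = max 1 (\<alpha> / 2)\<close>: one large entry must beat the sum of \<open>n\<close> squares, whose order is
  roughly \<open>n\<close> to the power \<open>max 1 (2 / \<alpha>)\<close>. For \<open>\<alpha> < 3\<close> the term \<open>n m4\<^sup>2\<close> dominates \<open>V\<close> and \<open>A / V\<^sup>2\<close> has exponent
  \<open>2 a - 1\<close>; for \<open>\<alpha> > 3\<close> the term \<open>1 / n\<^sup>2\<close> dominates and the exponent is \<open>5 - \<alpha>\<close>. Both are twice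
  \<open>delta_star \<alpha>\<close>. The slowly varying factors are absorbed by the gap between \<open>\<delta>\<close> and
  \<open>delta_star \<alpha>\<close>.
\<close>

section \<open>Fourth moments of degenerate U-statistics\<close>

locale degenerate_kernel = prob_space \<nu> for \<nu> :: "'b measure" +
  fixes h :: "'b \<Rightarrow> 'b \<Rightarrow> real"
  assumes measurable_kernel [measurable]: "(\<lambda>(x, y). h x y) \<in> borel_measurable (\<nu> \<Otimes>\<^sub>M \<nu>)"
    and kernel_sym: "h x y = h y x"
    and kernel_le_1: "\<bar>h x y\<bar> \<le> 1"
    and kernel_degenerate: "x \<in> space \<nu> \<Longrightarrow> (\<integral>y. h x y \<partial>\<nu>) = 0"
begin

abbreviation sample :: "nat \<Rightarrow> (nat \<Rightarrow> 'b) measure" where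
  "sample p \<equiv> \<Pi>\<^sub>M i\<in>{..<p}. \<nu>"

text \<open>
  The U-statistic is summed column by column, so that a new row \<open>y\<close> changes it by
  \<open>increment p x y\<close>. Given the past \<open>x\<close> the increment is centred; given \<open>y\<close> it is a sum of independent
  centred terms. Both points of view are used.
\<close>

definition increment :: "nat \<Rightarrow> (nat \<Rightarrow> 'b) \<Rightarrow> 'b \<Rightarrow> real" where
  "increment p x y = (\<Sum>i<p. h (x i) y)"

definition U_stat :: "nat \<Rightarrow> (nat \<Rightarrow> 'b) \<Rightarrow> real" where
  "U_stat p x = (\<Sum>j<p. increment j x (x j))"

text \<open>
  The four numbers that govern the fourth moment: \<open>kernel_m2\<close>, \<open>kernel_m4\<close>, \<open>wedge_m4\<close> and \<open>cycle_m4\<close>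
  are the expected products of \<open>h\<close> along a double edge, a quadruple edge, two double edges with
  a common vertex, and a four-cycle. The function \<open>kernel_comp\<close> is the kernel of the square of the
  integral operator with kernel \<open>h\<close>.
\<close>

definition kernel_m2 :: real where "kernel_m2 = (\<integral>x. \<integral>y. (h x y)^2 \<partial>\<nu> \<partial>\<nu>)"
definition kernel_m4 :: real where "kernel_m4 = (\<integral>x. \<integral>y. (h x y)^4 \<partial>\<nu> \<partial>\<nu>)"
definition row_m2 :: "'b \<Rightarrow> real" where "row_m2 x = (\<integral>y. (h x y)^2 \<partial>\<nu>)"
definition wedge_m4 :: real where "wedge_m4 = (\<integral>x. (row_m2 x)^2 \<partial>\<nu>)"
definition kernel_comp :: "'b \<Rightarrow> 'b \<Rightarrow> real" where "kernel_comp x z = (\<integral>y. h x y * h z y \<partial>\<nu>)"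
definition cycle_m4 :: real where "cycle_m4 = (\<integral>x. \<integral>z. (kernel_comp x z)^2 \<partial>\<nu> \<partial>\<nu>)"

sublocale rows: product_prob_space "\<lambda>_. \<nu>" "{..<p}" for p
  by unfold_locales

lemma prob_space_sample: "prob_space (sample p)"
  by (rule prob_space_PiM) (rule prob_space_axioms)

lemma measurable_kernel_compose [measurable (raw)]:
  assumes "f \<in> measurable N \<nu>" "g \<in> measurable N \<nu>"
  shows "(\<lambda>x. h (f x) (g x)) \<in> borel_measurable N"
proof -
  have "(\<lambda>x. (\<lambda>(x, y). h x y) (f x, g x)) \<in> borel_measurable N"
    using assms measurable_kernel by measurable
  then show ?thesis by simp
qed

lemma measurable_increment [measurable (raw)]:
  assumes "\<And>i. i < p \<Longrightarrow> (\<lambda>z. f z i) \<in> measurable N \<nu>" "g \<in> measurable N \<nu>"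
  shows "(\<lambda>z. increment p (f z) (g z)) \<in> borel_measurable N"
  unfolding increment_def using assms by (intro borel_measurable_sum measurable_kernel_compose) auto

lemma measurable_U_stat [measurable (raw)]:
  assumes "\<And>i. i < p \<Longrightarrow> (\<lambda>z. f z i) \<in> measurable N \<nu>"
  shows "(\<lambda>z. U_stat p (f z)) \<in> borel_measurable N"
  unfolding U_stat_def using assms by (intro borel_measurable_sum measurable_increment) auto

lemma measurable_row_m2 [measurable]: "row_m2 \<in> borel_measurable \<nu>"
  unfolding row_m2_def by measurable

lemma measurable_kernel_comp [measurable]:
  "(\<lambda>(x, z). kernel_comp x z) \<in> borel_measurable (\<nu> \<Otimes>\<^sub>M \<nu>)"
  unfolding kernel_comp_def by measurable

lemma increment_bound: "\<bar>increment p x y\<bar> \<le> real p"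
  unfolding increment_def
  by (rule order_trans[OF sum_abs]) (use kernel_le_1 sum_bounded_above[of "{..<p}" "\<lambda>i. \<bar>h (x i) y\<bar>" 1] in auto)

lemma U_stat_bound: "\<bar>U_stat p x\<bar> \<le> real p * real p"
proof -
  have "\<bar>U_stat p x\<bar> \<le> (\<Sum>j<p. \<bar>increment j x (x j)\<bar>)"
    unfolding U_stat_def by (rule sum_abs)
  also have "\<dots> \<le> (\<Sum>j<p. real p)"
    by (intro sum_mono order_trans[OF increment_bound]) auto
  finally show ?thesis by simp
qed

lemma U_stat_Suc: "U_stat (Suc p) x = U_stat p x + increment p x (x p)"
  by (simp add: U_stat_def)

lemma increment_upd: "i \<ge> p \<Longrightarrow> increment p (x(i := y)) z = increment p x z"
  by (simp add: increment_def)

lemma U_stat_upd: "i \<ge> p \<Longrightarrow> U_stat p (x(i := y)) = U_stat p x"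
  by (auto simp: U_stat_def increment_upd intro!: sum.cong)

lemma integral_sample_Suc:
  fixes f :: "(nat \<Rightarrow> 'b) \<Rightarrow> real"
  assumes "integrable (sample (Suc p)) f"
  shows "integral\<^sup>L (sample (Suc p)) f = (\<integral>x. (\<integral>y. f (x(p := y)) \<partial>\<nu>) \<partial>sample p)"
  unfolding lessThan_Suc
  by (rule rows.product_integral_insert) (use assms in \<open>auto simp: lessThan_Suc\<close>)

end

context prob_space
begin

lemma integrable_bounded:
  fixes f :: "'a \<Rightarrow> real"
  assumes "f \<in> borel_measurable M" "\<And>x. x \<in> space M \<Longrightarrow> \<bar>f x\<bar> \<le> B"
  shows "integrable M f"
  by (rule integrable_const_bound[where B=B]) (use assms in \<open>auto intro!: AE_I2\<close>)

lemma abs_integral_le: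
  fixes f :: "'a \<Rightarrow> real"
  assumes "f \<in> borel_measurable M" "\<And>x. x \<in> space M \<Longrightarrow> \<bar>f x\<bar> \<le> B"
  shows "\<bar>integral\<^sup>L M f\<bar> \<le> B"
proof -
  have "B \<ge> 0"
    using assms(2) not_empty abs_ge_zero by (meson equals0I order_trans)
  have "\<bar>integral\<^sup>L M f\<bar> \<le> (\<integral>x. \<bar>f x\<bar> \<partial>M)" by (rule integral_abs_bound)
  also have "\<dots> \<le> (\<integral>x. B \<partial>M)"
    using assms \<open>B \<ge> 0\<close> by (intro integral_mono integrable_bounded[where B=B]) auto
  finally show ?thesis by (simp add: prob_space)
qed

end

lemma abs_power_prod_le:
  fixes s t a b :: real
  assumes "\<bar>s\<bar> \<le> a" "\<bar>t\<bar> \<le> b"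
  shows "\<bar>s ^ i * t ^ j\<bar> \<le> a ^ i * b ^ j"
  unfolding abs_mult power_abs by (intro mult_mono power_mono) (use assms in auto)

context degenerate_kernel
begin

lemma pair_prob_sample: "prob_space (sample p \<Otimes>\<^sub>M \<nu>)"
proof -
  interpret s: prob_space "sample p" by (rule prob_space_sample)
  interpret pair_prob_space "sample p" \<nu> by unfold_locales
  show ?thesis by (rule prob_space_axioms)
qed

lemma pair_sigma_sample: "pair_sigma_finite (sample p) \<nu>"
proof -
  interpret s: prob_space "sample p" by (rule prob_space_sample)
  show ?thesis by unfold_locales
qed

lemma measurable_sample_component [measurable]:
  "i < p \<Longrightarrow> (\<lambda>x. x i) \<in> measurable (sample p) \<nu>"
  by (rule measurable_component_singleton) auto

lemma measurable_sample_fst [measurable]: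
  "i < p \<Longrightarrow> (\<lambda>z. fst z i) \<in> measurable (sample p \<Otimes>\<^sub>M \<nu>) \<nu>"
  by (rule measurable_compose[OF measurable_fst]) (rule measurable_sample_component)

text \<open>
  One step of the recursion in the number of rows, on a single product measure: the first
  component is the past, the second one the new row. Pointwise inequalities then need only one
  integral.
\<close>

lemma integral_sample_Suc_pair:
  fixes f :: "(nat \<Rightarrow> 'b) \<Rightarrow> real"
  assumes f: "f \<in> borel_measurable (sample (Suc p))" and B: "\<And>x. \<bar>f x\<bar> \<le> B"
  shows "integral\<^sup>L (sample (Suc p)) f = (\<integral>z. f ((fst z)(p := snd z)) \<partial>(sample p \<Otimes>\<^sub>M \<nu>))"
proof -
  interpret Q: prob_space "sample p \<Otimes>\<^sub>M \<nu>" by (rule pair_prob_sample)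
  interpret P: pair_sigma_finite "sample p" \<nu> by (rule pair_sigma_sample)
  have upd: "(\<lambda>z. (fst z)(p := snd z)) \<in> measurable (sample p \<Otimes>\<^sub>M \<nu>) (sample (Suc p))"
    unfolding lessThan_Suc by measurable
  have "integral\<^sup>L (sample (Suc p)) f = (\<integral>x. (\<integral>y. f (x(p := y)) \<partial>\<nu>) \<partial>sample p)"
    by (rule integral_sample_Suc) (rule prob_space.integrable_bounded[OF prob_space_sample f B])
  also have "\<dots> = (\<integral>x. (\<integral>y. (\<lambda>z. f ((fst z)(p := snd z))) (x, y) \<partial>\<nu>) \<partial>sample p)" by simp
  also have "\<dots> = (\<integral>z. f ((fst z)(p := snd z)) \<partial>(sample p \<Otimes>\<^sub>M \<nu>))"
    by (rule P.integral_fst'[OF Q.integrable_bounded[OF measurable_compose[OF upd f] B]])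
  finally show ?thesis .
qed

lemma integral_sample_pair_fst:
  fixes f :: "(nat \<Rightarrow> 'b) \<times> 'b \<Rightarrow> real"
  assumes f: "f \<in> borel_measurable (sample p \<Otimes>\<^sub>M \<nu>)" and B: "\<And>x. \<bar>f x\<bar> \<le> B"
  shows "integral\<^sup>L (sample p \<Otimes>\<^sub>M \<nu>) f = (\<integral>x. \<integral>y. f (x, y) \<partial>\<nu> \<partial>sample p)"
    "integral\<^sup>L (sample p \<Otimes>\<^sub>M \<nu>) f = (\<integral>y. \<integral>x. f (x, y) \<partial>sample p \<partial>\<nu>)"
proof -
  interpret Q: prob_space "sample p \<Otimes>\<^sub>M \<nu>" by (rule pair_prob_sample)
  interpret P: pair_sigma_finite "sample p" \<nu> by (rule pair_sigma_sample)
  have i: "integrable (sample p \<Otimes>\<^sub>M \<nu>) f" by (rule Q.integrable_bounded[OF f B])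
  show "integral\<^sup>L (sample p \<Otimes>\<^sub>M \<nu>) f = (\<integral>x. \<integral>y. f (x, y) \<partial>\<nu> \<partial>sample p)"
    by (rule P.integral_fst'[OF i, symmetric])
  show "integral\<^sup>L (sample p \<Otimes>\<^sub>M \<nu>) f = (\<integral>y. \<integral>x. f (x, y) \<partial>sample p \<partial>\<nu>)"
    using P.integral_snd[of "\<lambda>x y. f (x, y)"] i by simp
qed

text \<open>
  For a centred sum of independent terms the odd products vanish, so each new term adds
  \<open>6 E[S\<^sup>2] E[k\<^sup>2] + E[k\<^sup>4]\<close> to the fourth moment.
\<close>

lemma iid_sum_moments:
  fixes k :: "'b \<Rightarrow> real"
  assumes [measurable]: "k \<in> borel_measurable \<nu>" and k1: "\<And>x. \<bar>k x\<bar> \<le> 1"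
    and k0: "(\<integral>x. k x \<partial>\<nu>) = 0"
  shows "(\<integral>x. (\<Sum>i<p. k (x i)) \<partial>sample p) = 0"
    and "(\<integral>x. (\<Sum>i<p. k (x i))^2 \<partial>sample p) = real p * (\<integral>x. (k x)^2 \<partial>\<nu>)"
    and "(\<integral>x. (\<Sum>i<p. k (x i))^4 \<partial>sample p) =
      real p * (\<integral>x. (k x)^4 \<partial>\<nu>) + 3 * real p * (real p - 1) * (\<integral>x. (k x)^2 \<partial>\<nu>)^2"
proof -
  define S where "S p x = (\<Sum>i<p. k (x i))" for p and x :: "nat \<Rightarrow> 'b"
  have Sb: "\<bar>S p x\<bar> \<le> real p" for p x
    unfolding S_def by (rule order_trans[OF sum_abs])
      (use k1 sum_bounded_above[of "{..<p}" "\<lambda>i. \<bar>k (x i)\<bar>" 1] in auto)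
  have Sm [measurable]: "S p \<in> borel_measurable (sample p)" for p
    unfolding S_def by (intro borel_measurable_sum) (auto intro: measurable_compose[OF measurable_sample_component])
  have Smf [measurable]: "(\<lambda>z. S p (fst z)) \<in> borel_measurable (sample p \<Otimes>\<^sub>M \<nu>)" for p
    by measurable
  have step: "(\<integral>x. S (Suc p) x ^ m \<partial>sample (Suc p)) =
      (\<integral>x. \<integral>y. (S p x + k y) ^ m \<partial>\<nu> \<partial>sample p)" for p m
  proof -
    have "(\<integral>x. S (Suc p) x ^ m \<partial>sample (Suc p)) =
       (\<integral>z. S (Suc p) ((fst z)(p := snd z)) ^ m \<partial>(sample p \<Otimes>\<^sub>M \<nu>))"
      by (rule integral_sample_Suc_pair[where B="real (Suc p) ^ m"])
         (use Sb[of "Suc p"] in \<open>auto simp: power_abs intro!: power_mono simp del: of_nat_Suc\<close>)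
    also have "\<dots> = (\<integral>z. (S p (fst z) + k (snd z)) ^ m \<partial>(sample p \<Otimes>\<^sub>M \<nu>))"
      by (simp add: S_def)
    also have "\<dots> = (\<integral>x. \<integral>y. (S p x + k y) ^ m \<partial>\<nu> \<partial>sample p)"
    proof (subst integral_sample_pair_fst(1)[where B="(real p + 1) ^ m"])
      fix z :: "(nat \<Rightarrow> 'b) \<times> 'b"
      have "\<bar>S p (fst z) + k (snd z)\<bar> \<le> real p + 1"
        using Sb[of p "fst z"] k1[of "snd z"] by linarith
      then show "\<bar>(S p (fst z) + k (snd z)) ^ m\<bar> \<le> (real p + 1) ^ m"
        by (simp add: power_abs power_mono)
    qed auto
    finally show ?thesis .
  qed
  have ki: "integrable \<nu> (\<lambda>y. k y ^ m)" for m
    by (rule integrable_bounded[where B=1]) (use k1 in \<open>auto simp: power_abs power_le_one\<close>)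
  have Si: "integrable (sample p) (\<lambda>x. S p x ^ m)" for p m
      by (rule prob_space.integrable_bounded[OF prob_space_sample, where B="real p ^ m"]) (use Sb[of p] in \<open>auto simp: power_abs power_mono\<close>)
  note ki1 = ki[of 1, simplified] and Si1 = Si[of _ 1, simplified]
  have c: "(\<integral>x. c \<partial>sample p) = (c::real)" for p c
    by (simp add: prob_space.prob_space[OF prob_space_sample])
  have c': "(\<integral>x. c \<partial>\<nu>) = (c::real)" for c by (simp add: prob_space)
  have ci: "integrable (sample p) (\<lambda>x. c::real)" for p c
    by simp
  have 1: "(\<integral>x. S p x \<partial>sample p) = 0" for p
  proof (induction p)
    case (Suc p)
    have "(\<integral>x. S (Suc p) x \<partial>sample (Suc p)) = (\<integral>x. \<integral>y. (S p x + k y) \<partial>\<nu> \<partial>sample p)"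
      using step[of p 1] by simp
    also have "\<dots> = (\<integral>x. S p x \<partial>sample p)"
      using k0 ki1 by (simp add: c' prob_space)
    finally show ?case using Suc by simp
  qed (simp add: S_def)
  have 2: "(\<integral>x. (S p x)^2 \<partial>sample p) = real p * (\<integral>x. (k x)^2 \<partial>\<nu>)" for p
  proof (induction p)
    case (Suc p)
    have "(\<integral>y. (S p x + k y)^2 \<partial>\<nu>) = (S p x)^2 + (\<integral>y. (k y)^2 \<partial>\<nu>)" for x
    proof -
      have "(\<integral>y. (S p x + k y)^2 \<partial>\<nu>) = (\<integral>y. (S p x)^2 + (k y)^2 + 2 * S p x * k y \<partial>\<nu>)"
        by (simp add: power2_sum)
      then show ?thesis using k0 ki[of 2] ki1 by (simp add: c' prob_space)
    qed
    then have "(\<integral>x. (S (Suc p) x)^2 \<partial>sample (Suc p)) = (\<integral>x. (S p x)^2 + (\<integral>y. (k y)^2 \<partial>\<nu>) \<partial>sample p)"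
      using step[of p 2] by simp
    also have "\<dots> = real (Suc p) * (\<integral>x. (k x)^2 \<partial>\<nu>)"
      using Suc Si[of p 2] by (simp add: prob_space.prob_space[OF prob_space_sample] ci algebra_simps)
    finally show ?case .
  qed (simp add: S_def)
  have 4: "(\<integral>x. (S p x)^4 \<partial>sample p) =
      real p * (\<integral>x. (k x)^4 \<partial>\<nu>) + 3 * real p * (real p - 1) * (\<integral>x. (k x)^2 \<partial>\<nu>)^2" for p
  proof (induction p)
    case (Suc p)
    have "(\<integral>y. (S p x + k y)^4 \<partial>\<nu>) = (S p x)^4 + 6 * (\<integral>y. (k y)^2 \<partial>\<nu>) * (S p x)^2 +
       4 * (\<integral>y. (k y)^3 \<partial>\<nu>) * S p x + (\<integral>y. (k y)^4 \<partial>\<nu>)" for x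
    proof -
      have "(\<integral>y. (S p x + k y)^4 \<partial>\<nu>) = (\<integral>y. (S p x)^4 + 4 * (S p x)^3 * k y + 6 * (S p x)^2 * (k y)^2
         + 4 * S p x * (k y)^3 + (k y)^4 \<partial>\<nu>)"
        by (rule Bochner_Integration.integral_cong) (auto simp: eval_nat_numeral algebra_simps)
      then show ?thesis using k0 ki[of 2] ki[of 3] ki[of 4] ki1 by (simp add: c' prob_space)
    qed
    then have "(\<integral>x. (S (Suc p) x)^4 \<partial>sample (Suc p)) =
       (\<integral>x. (S p x)^4 + 6 * (\<integral>y. (k y)^2 \<partial>\<nu>) * (S p x)^2 +
       4 * (\<integral>y. (k y)^3 \<partial>\<nu>) * S p x + (\<integral>y. (k y)^4 \<partial>\<nu>) \<partial>sample p)"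
      using step[of p 4] by simp
    also have "\<dots> = (\<integral>x. (S p x)^4 \<partial>sample p) + 6 * (\<integral>y. (k y)^2 \<partial>\<nu>) * (\<integral>x. (S p x)^2 \<partial>sample p)
       + (\<integral>y. (k y)^4 \<partial>\<nu>)"
      using Si[of p 2] Si[of p 4] Si1[of p] 1 by (simp add: prob_space.prob_space[OF prob_space_sample] ci)
    also have "\<dots> = real (Suc p) * (\<integral>x. (k x)^4 \<partial>\<nu>) + 3 * real (Suc p) * (real (Suc p) - 1) * (\<integral>x. (k x)^2 \<partial>\<nu>)^2"
      unfolding Suc 2 by (simp add: algebra_simps power2_eq_square)
    finally show ?case .
  qed (simp add: S_def)
  show "(\<integral>x. (\<Sum>i<p. k (x i)) \<partial>sample p) = 0"
    "(\<integral>x. (\<Sum>i<p. k (x i))^2 \<partial>sample p) = real p * (\<integral>x. (k x)^2 \<partial>\<nu>)"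
    "(\<integral>x. (\<Sum>i<p. k (x i))^4 \<partial>sample p) =
      real p * (\<integral>x. (k x)^4 \<partial>\<nu>) + 3 * real p * (real p - 1) * (\<integral>x. (k x)^2 \<partial>\<nu>)^2"
    using 1[of p] 2[of p] 4[of p] unfolding S_def by auto
qed

lemma pair_T_measurable [measurable]:
  "(\<lambda>z. U_stat p (fst z)) \<in> borel_measurable (sample p \<Otimes>\<^sub>M \<nu>)"
  by (rule measurable_U_stat) (rule measurable_sample_fst)

lemma pair_D_measurable [measurable]:
  "(\<lambda>z. increment p (fst z) (snd z)) \<in> borel_measurable (sample p \<Otimes>\<^sub>M \<nu>)"
  by (rule measurable_increment) (auto intro: measurable_sample_fst)

lemma U_stat_sample_measurable [measurable]: "U_stat p \<in> borel_measurable (sample p)"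
  using measurable_U_stat[of p "\<lambda>x. x" "sample p"] measurable_sample_component by simp

lemma integrable_pair:
  "integrable (sample p \<Otimes>\<^sub>M \<nu>) (\<lambda>z. U_stat p (fst z) ^ i * increment p (fst z) (snd z) ^ j)"
  by (rule prob_space.integrable_bounded[OF pair_prob_sample, where B="(real p * real p) ^ i * real p ^ j"])
     (auto intro!: abs_power_prod_le U_stat_bound increment_bound)

lemma integrable_U_stat: "integrable (sample p) (\<lambda>x. U_stat p x ^ m)"
  by (rule prob_space.integrable_bounded[OF prob_space_sample, where B="(real p * real p) ^ m"])
     (auto simp: power_abs intro!: power_mono U_stat_bound)

lemma U_stat_step:
  "(\<integral>x. U_stat (Suc p) x ^ m \<partial>sample (Suc p)) =
    (\<integral>z. (U_stat p (fst z) + increment p (fst z) (snd z)) ^ m \<partial>(sample p \<Otimes>\<^sub>M \<nu>))"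
  by (subst integral_sample_Suc_pair[where B="(real (Suc p) * real (Suc p)) ^ m"])
     (use U_stat_bound[of "Suc p"] in
       \<open>auto simp: power_abs U_stat_Suc U_stat_upd increment_upd simp del: of_nat_Suc intro!: power_mono\<close>)

lemma pair_T:
  "(\<integral>z. U_stat p (fst z) ^ m \<partial>(sample p \<Otimes>\<^sub>M \<nu>)) = (\<integral>x. U_stat p x ^ m \<partial>sample p)"
  by (subst integral_sample_pair_fst(1)[where B="(real p * real p) ^ m"])
     (auto simp: power_abs prob_space intro!: power_mono U_stat_bound)

lemma space_sample: "x \<in> space (sample p) \<Longrightarrow> i < p \<Longrightarrow> x i \<in> space \<nu>"
  by (auto simp: space_PiM PiE_iff)

lemma kernel_section_measurable [measurable]:
  "x \<in> space \<nu> \<Longrightarrow> (\<lambda>y. h x y) \<in> borel_measurable \<nu>"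
  "x \<in> space \<nu> \<Longrightarrow> (\<lambda>y. h y x) \<in> borel_measurable \<nu>"
  by measurable

lemma increment_section_measurable [measurable]:
  "x \<in> space (sample p) \<Longrightarrow> increment p x \<in> borel_measurable \<nu>"
  unfolding increment_def by (auto intro!: borel_measurable_sum kernel_section_measurable space_sample)

lemma pair_T_D_eq_0:
  "(\<integral>z. U_stat p (fst z) ^ m * increment p (fst z) (snd z) \<partial>(sample p \<Otimes>\<^sub>M \<nu>)) = 0"
proof -
  have inc: "(\<integral>y. increment p x y \<partial>\<nu>) = 0" if x: "x \<in> space (sample p)" for x
  proof -
    have "integrable \<nu> (\<lambda>y. h (x i) y)" if "i < p" for i
      by (rule integrable_bounded[where B=1]) (use that x space_sample kernel_le_1 in auto)
    then show ?thesis unfolding increment_def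
      by (subst Bochner_Integration.integral_sum) (use x space_sample kernel_degenerate in auto)
  qed
  have "(\<integral>z. U_stat p (fst z) ^ m * increment p (fst z) (snd z) \<partial>(sample p \<Otimes>\<^sub>M \<nu>))
     = (\<integral>x. \<integral>y. U_stat p x ^ m * increment p x y \<partial>\<nu> \<partial>sample p)"
    by (subst integral_sample_pair_fst(1)[where B="(real p * real p) ^ m * real p ^ 1"])
       (use abs_power_prod_le[OF U_stat_bound increment_bound, where i=m and j=1] in auto)
  also have "\<dots> = (\<integral>x. 0 \<partial>sample p)"
    by (rule Bochner_Integration.integral_cong) (auto simp: inc)
  finally show ?thesis by simp
qed

text \<open>
  Integrating over the past first, for a fixed new row \<open>y\<close>, turns the increment into a sum of
  independent centred terms \<open>h y (x i)\<close>.
\<close>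

lemma pair_D:
  "(\<integral>z. increment p (fst z) (snd z) ^ 2 \<partial>(sample p \<Otimes>\<^sub>M \<nu>)) = real p * kernel_m2"
  "(\<integral>z. increment p (fst z) (snd z) ^ 4 \<partial>(sample p \<Otimes>\<^sub>M \<nu>)) =
     real p * kernel_m4 + 3 * real p * (real p - 1) * wedge_m4"
proof -
  have sw: "(\<integral>z. increment p (fst z) (snd z) ^ m \<partial>(sample p \<Otimes>\<^sub>M \<nu>)) =
     (\<integral>y. \<integral>x. (\<Sum>i<p. h y (x i)) ^ m \<partial>sample p \<partial>\<nu>)" for m
  proof -
    have "\<bar>increment p x y ^ m\<bar> \<le> real p ^ m" for x y
      using increment_bound[of p x y] by (simp add: power_abs power_mono)
    then show ?thesis
    by (subst integral_sample_pair_fst(2)[where B="real p ^ m"])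
       (auto simp: increment_def kernel_sym)
  qed
  have s: "h y \<in> borel_measurable \<nu>" "\<And>x. \<bar>h y x\<bar> \<le> 1" "(\<integral>x. h y x \<partial>\<nu>) = 0" if "y \<in> space \<nu>" for y
    using that kernel_le_1 kernel_degenerate kernel_section_measurable[of y] by auto
  show "(\<integral>z. increment p (fst z) (snd z) ^ 2 \<partial>(sample p \<Otimes>\<^sub>M \<nu>)) = real p * kernel_m2"
  proof -
    have "(\<integral>y. \<integral>x. (\<Sum>i<p. h y (x i)) ^ 2 \<partial>sample p \<partial>\<nu>) = (\<integral>y. real p * (\<integral>x. (h y x)^2 \<partial>\<nu>) \<partial>\<nu>)"
      by (rule Bochner_Integration.integral_cong[OF refl]) (rule iid_sum_moments(2)[OF s])
    then show ?thesis unfolding sw kernel_m2_def by simp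
  qed
  have i: "integrable \<nu> (\<lambda>y. \<integral>x. (h y x)^4 \<partial>\<nu>)" "integrable \<nu> (\<lambda>y. (\<integral>x. (h y x)^2 \<partial>\<nu>)^2)"
  proof -
    have b: "\<bar>\<integral>x. (h y x)^m \<partial>\<nu>\<bar> \<le> 1" if "y \<in> space \<nu>" for y m
      using that by (intro abs_integral_le) (auto simp: power_abs power_le_one kernel_le_1)
    show "integrable \<nu> (\<lambda>y. \<integral>x. (h y x)^4 \<partial>\<nu>)"
      by (rule integrable_bounded[where B=1]) (use b in \<open>auto dest: abs_le_D1\<close>)
    show "integrable \<nu> (\<lambda>y. (\<integral>x. (h y x)^2 \<partial>\<nu>)^2)"
      by (rule integrable_bounded[where B="1"])
         (use b[of _ 2] in \<open>auto simp: power_abs abs_square_le_1\<close>)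
  qed
  have "(\<integral>y. \<integral>x. (\<Sum>i<p. h y (x i)) ^ 4 \<partial>sample p \<partial>\<nu>) =
    (\<integral>y. real p * (\<integral>x. (h y x)^4 \<partial>\<nu>) + 3 * real p * (real p - 1) * (\<integral>x. (h y x)^2 \<partial>\<nu>)^2 \<partial>\<nu>)"
    by (rule Bochner_Integration.integral_cong[OF refl]) (rule iid_sum_moments(3)[OF s])
  also have "\<dots> = real p * kernel_m4 + 3 * real p * (real p - 1) * wedge_m4"
    using i by (simp add: kernel_m4_def wedge_m4_def row_m2_def)
  finally show "(\<integral>z. increment p (fst z) (snd z) ^ 4 \<partial>(sample p \<Otimes>\<^sub>M \<nu>)) =
     real p * kernel_m4 + 3 * real p * (real p - 1) * wedge_m4"
    unfolding sw .
qed

lemma U_stat_mean: "(\<integral>x. U_stat p x \<partial>sample p) = 0"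
proof (induction p)
  case (Suc p)
  then show ?case
    using U_stat_step[of p 1] integrable_pair[of p 1 0] integrable_pair[of p 0 1]
      pair_T_D_eq_0[of p 0] pair_T[of p 1] by simp
qed (simp add: U_stat_def)

lemma U_stat_second_moment:
  "(\<integral>x. (U_stat p x)^2 \<partial>sample p) = real p * (real p - 1) / 2 * kernel_m2"
proof (induction p)
  case (Suc p)
  have "(\<integral>x. (U_stat (Suc p) x)^2 \<partial>sample (Suc p)) =
     (\<integral>z. (U_stat p (fst z))^2 + (increment p (fst z) (snd z))^2
       + 2 * (U_stat p (fst z) * increment p (fst z) (snd z)) \<partial>(sample p \<Otimes>\<^sub>M \<nu>))"
    unfolding U_stat_step by (simp add: power2_sum algebra_simps)
  also have "\<dots> = (\<integral>x. (U_stat p x)^2 \<partial>sample p) + real p * kernel_m2"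
    using integrable_pair[of p 2 0] integrable_pair[of p 0 2] integrable_pair[of p 1 1]
      pair_T_D_eq_0[of p 1] pair_T[of p 2] pair_D(1)[of p] by simp
  finally show ?case unfolding Suc by (simp add: field_simps)
qed (simp add: U_stat_def)

text \<open>
  The composition of a degenerate kernel with itself is degenerate again. Hence the second moment
  formula applies to it as well, which is how the four-cycle enters without any combinatorics.
\<close>

lemma kernel_comp_degenerate: "degenerate_kernel \<nu> kernel_comp"
proof unfold_locales
  show "(\<lambda>(x, y). kernel_comp x y) \<in> borel_measurable (\<nu> \<Otimes>\<^sub>M \<nu>)" by measurable
  show "kernel_comp x y = kernel_comp y x" for x y
    by (simp add: kernel_comp_def mult.commute)
next
  fix x y
  show "\<bar>kernel_comp x y\<bar> \<le> 1"
  proof (cases "(\<lambda>z. h x z * h y z) \<in> borel_measurable \<nu>")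
    case True
    show ?thesis unfolding kernel_comp_def
      by (rule abs_integral_le[OF True]) (use kernel_le_1 in \<open>auto simp: abs_mult intro!: mult_le_one\<close>)
  next
    case False
    then have "\<not> integrable \<nu> (\<lambda>z. h x z * h y z)" by auto
    then show ?thesis by (simp add: kernel_comp_def not_integrable_integral_eq)
  qed
next
  fix x assume x: "x \<in> space \<nu>"
  interpret PP: pair_prob_space \<nu> \<nu> by unfold_locales
  have "(\<integral>z. kernel_comp x z \<partial>\<nu>) = (\<integral>z. \<integral>y. h x y * h z y \<partial>\<nu> \<partial>\<nu>)"
    by (simp add: kernel_comp_def)
  also have "\<dots> = (\<integral>y. \<integral>z. h x y * h z y \<partial>\<nu> \<partial>\<nu>)"
  proof (rule PP.Fubini_integral)
    show "integrable (\<nu> \<Otimes>\<^sub>M \<nu>) (\<lambda>(y, z). h x y * h z y)"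
      by (rule PP.P.integrable_bounded[where B=1])
         (use kernel_le_1 x in \<open>auto simp: abs_mult intro!: mult_le_one\<close>)
  qed
  also have "\<dots> = (\<integral>y. 0 \<partial>\<nu>)"
    by (rule Bochner_Integration.integral_cong[OF refl])
       (use kernel_degenerate in \<open>auto simp: kernel_sym\<close>)
  finally show "(\<integral>z. kernel_comp x z \<partial>\<nu>) = 0" by simp
qed

end

lemma square_sum_eq:
  fixes f :: "nat \<Rightarrow> real"
  shows "(\<Sum>i<p. f i)^2 = (\<Sum>i<p. (f i)^2) + 2 * (\<Sum>j<p. \<Sum>i<j. f i * f j)"
  by (induction p) (simp_all add: power2_sum sum_distrib_left sum_distrib_right algebra_simps)

context degenerate_kernel
begin

definition pair_m22 :: "nat \<Rightarrow> real" where
  "pair_m22 p = (\<integral>z. (U_stat p (fst z))^2 * (increment p (fst z) (snd z))^2 \<partial>(sample p \<Otimes>\<^sub>M \<nu>))"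

definition pair_m04 :: "nat \<Rightarrow> real" where
  "pair_m04 p = (\<integral>z. (increment p (fst z) (snd z))^4 \<partial>(sample p \<Otimes>\<^sub>M \<nu>))"

definition U_m4 :: "nat \<Rightarrow> real" where
  "U_m4 p = (\<integral>x. (U_stat p x)^4 \<partial>sample p)"

definition U_m2 :: "nat \<Rightarrow> real" where
  "U_m2 p = (\<integral>x. (U_stat p x)^2 \<partial>sample p)"

lemma U_m4_step:
  "U_m4 (Suc p) = U_m4 p + 6 * pair_m22 p
     + 4 * (\<integral>z. U_stat p (fst z) * (increment p (fst z) (snd z))^3 \<partial>(sample p \<Otimes>\<^sub>M \<nu>)) + pair_m04 p"
proof -
  have "U_m4 (Suc p) =
     (\<integral>z. (U_stat p (fst z))^4 + 4 * ((U_stat p (fst z))^3 * increment p (fst z) (snd z))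
       + 6 * ((U_stat p (fst z))^2 * (increment p (fst z) (snd z))^2)
       + 4 * (U_stat p (fst z) * (increment p (fst z) (snd z))^3)
       + (increment p (fst z) (snd z))^4 \<partial>(sample p \<Otimes>\<^sub>M \<nu>))"
    unfolding U_m4_def U_stat_step
    by (rule Bochner_Integration.integral_cong) (auto simp: eval_nat_numeral algebra_simps)
  then show ?thesis
    using integrable_pair[of p 4 0] integrable_pair[of p 3 1] integrable_pair[of p 2 2]
      integrable_pair[of p 1 3] integrable_pair[of p 0 4] pair_T_D_eq_0[of p 3] pair_T[of p 4]
    by (simp add: U_m4_def pair_m22_def pair_m04_def)
qed

text \<open>
  With \<open>T\<close> the statistic and \<open>D\<close> its increment, the mixed term \<open>T D\<^sup>3\<close> has no sign; it is absorbed into \<open>T\<^sup>2 D\<^sup>2\<close> and \<open>D\<^sup>4\<close> with a free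
  weight \<open>s\<close>. The weights 6 and 4 give the two monotonicity statements that follow.
\<close>

lemma pair_m13_bound:
  assumes "s > 0"
  shows "4 * \<bar>\<integral>z. U_stat p (fst z) * (increment p (fst z) (snd z))^3 \<partial>(sample p \<Otimes>\<^sub>M \<nu>)\<bar>
    \<le> s * pair_m22 p + 4 / s * pair_m04 p"
proof -
  let ?T = "\<lambda>z. U_stat p (fst z)" and ?D = "\<lambda>z. increment p (fst z) (snd z)"
  have pw: "4 * \<bar>?T z * (?D z)^3\<bar> \<le> s * ((?T z)^2 * (?D z)^2) + 4 / s * (?D z)^4" for z
  proof -
    have "0 \<le> (s * \<bar>?T z\<bar> - 2 * \<bar>?D z\<bar>)^2 * (?D z)^2 / s" using assms by simp
    also have "\<dots> = s * ((?T z)^2 * (?D z)^2) + 4 / s * (?D z)^4 - 4 * \<bar>?T z * (?D z)^3\<bar>"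
    proof -
      have "\<bar>?D z\<bar> * (?D z)^2 = \<bar>?D z ^ 3\<bar>"
        by (simp add: power3_eq_cube power2_eq_square abs_mult)
      moreover have "(s * \<bar>?T z\<bar> - 2 * \<bar>?D z\<bar>)^2 * (?D z)^2 / s
        = s * ((?T z)^2 * (?D z)^2) + 4 / s * (?D z)^4 - 4 * \<bar>?T z\<bar> * (\<bar>?D z\<bar> * (?D z)^2)"
        using assms by (simp add: power2_diff field_simps power_mult_distrib eval_nat_numeral)
      ultimately show ?thesis by (simp add: abs_mult)
    qed
    finally show ?thesis by simp
  qed
  have i: "integrable (sample p \<Otimes>\<^sub>M \<nu>) (\<lambda>z. ?T z * (?D z)^3)" using integrable_pair[of p 1 3] by simp
  have "4 * \<bar>\<integral>z. ?T z * (?D z)^3 \<partial>(sample p \<Otimes>\<^sub>M \<nu>)\<bar> \<le> 4 * (\<integral>z. \<bar>?T z * (?D z)^3\<bar> \<partial>(sample p \<Otimes>\<^sub>M \<nu>))"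
    by (intro mult_left_mono integral_abs_bound) auto
  also have "\<dots> = (\<integral>z. 4 * \<bar>?T z * (?D z)^3\<bar> \<partial>(sample p \<Otimes>\<^sub>M \<nu>))" by simp
  also have "\<dots> \<le> (\<integral>z. s * ((?T z)^2 * (?D z)^2) + 4 / s * (?D z)^4 \<partial>(sample p \<Otimes>\<^sub>M \<nu>))"
    by (rule integral_mono)
       (use pw i integrable_pair[of p 2 2] integrable_pair[of p 0 4] in auto)
  also have "\<dots> = s * pair_m22 p + 4 / s * pair_m04 p"
    using integrable_pair[of p 2 2] integrable_pair[of p 0 4] by (simp add: pair_m22_def pair_m04_def)
  finally show ?thesis .
qed

lemma pair_m04_nonneg: "pair_m04 p \<ge> 0"
  unfolding pair_m04_def by (auto intro!: Bochner_Integration.integral_nonneg)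

lemma U_m4_step_ge_m04: "U_m4 (Suc p) \<ge> U_m4 p + pair_m04 p / 3"
  using U_m4_step[of p] pair_m13_bound[of 6 p] by simp

lemma U_m4_step_ge_m22: "U_m4 (Suc p) \<ge> U_m4 p + 2 * pair_m22 p"
  using U_m4_step[of p] pair_m13_bound[of 4 p] by simp

lemma mono_U_m4: "mono U_m4"
  using U_m4_step_ge_m04 pair_m04_nonneg by (intro mono_iff_le_Suc[THEN iffD2] allI)
    (meson add_increasing2 divide_nonneg_pos order.trans zero_less_numeral order_refl)

lemma wedge_m4_nonneg: "wedge_m4 \<ge> 0" and kernel_m4_nonneg: "kernel_m4 \<ge> 0"
  and kernel_m2_nonneg: "kernel_m2 \<ge> 0" and cycle_m4_nonneg: "cycle_m4 \<ge> 0"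
  unfolding wedge_m4_def kernel_m4_def kernel_m2_def cycle_m4_def
  by (auto intro!: Bochner_Integration.integral_nonneg)

text \<open>
  Each increment raises the fourth moment of the statistic by at least a third of its own fourth
  moment, which in turn is at least \<open>p\<close> times that of the kernel.
\<close>

lemma U_m4_lower: "U_m4 p \<ge> real p * (real p - 1) / 6 * kernel_m4"
proof (induction p)
  case (Suc p)
  have "pair_m04 p \<ge> real p * kernel_m4"
  proof (cases p)
    case (Suc q)
    then have "3 * real p * (real p - 1) * wedge_m4 \<ge> 0" using wedge_m4_nonneg by simp
    then show ?thesis unfolding pair_m04_def pair_D(2) by simp
  qed (simp add: pair_m04_nonneg)
  then show ?case using U_m4_step_ge_m04[of p] Suc by (simp add: field_simps)
qed (simp add: U_m4_def U_stat_def)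

lemma row_m2_bounds: "x \<in> space \<nu> \<Longrightarrow> 0 \<le> row_m2 x \<and> row_m2 x \<le> 1"
proof -
  assume x: "x \<in> space \<nu>"
  have "\<bar>row_m2 x\<bar> \<le> 1" unfolding row_m2_def
    by (rule abs_integral_le) (use x kernel_le_1 in \<open>auto simp: abs_square_le_1\<close>)
  then show ?thesis by (auto simp: row_m2_def)
qed

lemma increment_m2:
  assumes x: "x \<in> space (sample p)"
  shows "(\<integral>y. (increment p x y)^2 \<partial>\<nu>) =
    (\<Sum>i<p. row_m2 (x i)) + 2 * (\<Sum>j<p. \<Sum>i<j. kernel_comp (x i) (x j))"
proof -
  have i: "integrable \<nu> (\<lambda>y. h (x i) y * h (x j) y)" if "i < p" "j < p" for i j
    by (rule integrable_bounded[where B=1])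
      (use that x space_sample kernel_le_1 in \<open>auto simp: abs_mult intro!: mult_le_one\<close>)
  have "(\<integral>y. (increment p x y)^2 \<partial>\<nu>) =
     (\<integral>y. (\<Sum>i<p. h (x i) y * h (x i) y) + 2 * (\<Sum>j<p. \<Sum>i<j. h (x i) y * h (x j) y) \<partial>\<nu>)"
    unfolding increment_def square_sum_eq by (simp add: power2_eq_square)
  also have "\<dots> = (\<Sum>i<p. \<integral>y. h (x i) y * h (x i) y \<partial>\<nu>) + 2 * (\<Sum>j<p. \<Sum>i<j. \<integral>y. h (x i) y * h (x j) y \<partial>\<nu>)"
  proof -
    have "(\<integral>y. (\<Sum>j<p. \<Sum>i<j. h (x i) y * h (x j) y) \<partial>\<nu>) = (\<Sum>j<p. \<integral>y. (\<Sum>i<j. h (x i) y * h (x j) y) \<partial>\<nu>)"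
      using i by (intro Bochner_Integration.integral_sum Bochner_Integration.integrable_sum) auto
    also have "\<dots> = (\<Sum>j<p. \<Sum>i<j. \<integral>y. h (x i) y * h (x j) y \<partial>\<nu>)"
      using i by (intro sum.cong Bochner_Integration.integral_sum) auto
    finally show ?thesis
      using i by (subst Bochner_Integration.integral_add)
        (auto simp: Bochner_Integration.integral_sum intro!: Bochner_Integration.integrable_sum integrable_mult_right)
  qed
  finally show ?thesis by (simp add: row_m2_def kernel_comp_def power2_eq_square)
qed

text \<open>
  The conditional variance of the increment differs from its mean by a centred sum over single rows,
  of variance at most \<open>p wedge_m4\<close>, and twice the U-statistic of the composed kernel.
\<close>

lemma increment_m2_deviation:
  "(\<integral>x. ((\<integral>y. (increment p x y)^2 \<partial>\<nu>) - real p * kernel_m2)^2 \<partial>sample p)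
     \<le> 2 * real p * wedge_m4 + 4 * (real p)^2 * cycle_m4"
proof -
  interpret C: degenerate_kernel \<nu> kernel_comp by (rule kernel_comp_degenerate)
  \<comment> \<open>The centred second moment of a row of the kernel. Outside the space of \<open>\<nu>\<close> it is set to 0, to be bounded everywhere.\<close>
  define k where "k x = (if x \<in> space \<nu> then row_m2 x - kernel_m2 else 0)" for x
  have V1: "kernel_m2 = (\<integral>x. row_m2 x \<partial>\<nu>)" by (simp add: kernel_m2_def row_m2_def)
  have V2: "kernel_m2 \<le> 1" unfolding V1
    using abs_integral_le[OF measurable_row_m2, of 1] row_m2_bounds by (auto dest: abs_le_D1)
  have km [measurable]: "k \<in> borel_measurable \<nu>"
    unfolding k_def by (subst measurable_cong[where g="\<lambda>x. row_m2 x - kernel_m2"]) auto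
  have kb: "\<bar>k x\<bar> \<le> 1" for x
    using row_m2_bounds[of x] V2 kernel_m2_nonneg by (auto simp: k_def)
  have ri: "integrable \<nu> row_m2" "integrable \<nu> (\<lambda>x. (row_m2 x)^2)"
    by (rule integrable_bounded[where B=1], use row_m2_bounds in \<open>auto simp: abs_square_le_1\<close>)+
  have k0: "(\<integral>x. k x \<partial>\<nu>) = 0"
  proof -
    have "(\<integral>x. k x \<partial>\<nu>) = (\<integral>x. row_m2 x - kernel_m2 \<partial>\<nu>)"
      by (rule Bochner_Integration.integral_cong) (auto simp: k_def)
    then show ?thesis using ri V1 by (simp add: prob_space)
  qed
  have k2: "(\<integral>x. (k x)^2 \<partial>\<nu>) \<le> wedge_m4"
  proof -
    have "(\<integral>x. (k x)^2 \<partial>\<nu>) = (\<integral>x. (row_m2 x)^2 - 2 * kernel_m2 * row_m2 x + kernel_m2^2 \<partial>\<nu>)"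
      by (rule Bochner_Integration.integral_cong) (auto simp: k_def power2_diff)
    also have "\<dots> = wedge_m4 - kernel_m2^2"
      using ri V1 by (simp add: prob_space wedge_m4_def power2_eq_square)
    finally show ?thesis by simp
  qed
  let ?K = "\<lambda>x. \<Sum>i<p. k (x i)"
  have eq: "(\<integral>y. (increment p x y)^2 \<partial>\<nu>) - real p * kernel_m2 = ?K x + 2 * C.U_stat p x"
    if "x \<in> space (sample p)" for x
  proof -
    have "?K x = (\<Sum>i<p. row_m2 (x i)) - real p * kernel_m2"
      using that space_sample by (simp add: k_def sum_subtractf)
    then show ?thesis using increment_m2[OF that]
      by (simp add: C.U_stat_def C.increment_def)
  qed
  have Kb: "\<bar>?K x\<bar> \<le> real p" for x
    by (rule order_trans[OF sum_abs])
      (use kb sum_bounded_above[of "{..<p}" "\<lambda>i. \<bar>k (x i)\<bar>" 1] in auto)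
  have Km [measurable]: "?K \<in> borel_measurable (sample p)"
    by (intro borel_measurable_sum) (auto intro: measurable_compose[OF measurable_sample_component])
  have Ki: "integrable (sample p) (\<lambda>x. (?K x)^2)"
    by (rule prob_space.integrable_bounded[OF prob_space_sample, where B="real p ^ 2"])
      (use Kb in \<open>auto simp: power2_le_iff_abs_le\<close>)
  have "(\<integral>x. ((\<integral>y. (increment p x y)^2 \<partial>\<nu>) - real p * kernel_m2)^2 \<partial>sample p)
     = (\<integral>x. (?K x + 2 * C.U_stat p x)^2 \<partial>sample p)"
    by (rule Bochner_Integration.integral_cong) (auto simp: eq)
  also have "\<dots> \<le> (\<integral>x. 2 * (?K x)^2 + 8 * (C.U_stat p x)^2 \<partial>sample p)"
  proof (rule integral_mono')
    show "integrable (sample p) (\<lambda>x. 2 * (?K x)^2 + 8 * (C.U_stat p x)^2)"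
      using Ki C.integrable_U_stat[of p 2] by simp
    show "(?K x + 2 * C.U_stat p x)^2 \<le> 2 * (?K x)^2 + 8 * (C.U_stat p x)^2" for x
      using sum_squares_bound[of "?K x" "2 * C.U_stat p x"] by (simp add: power2_sum)
  qed auto
  also have "\<dots> = 2 * (real p * (\<integral>x. (k x)^2 \<partial>\<nu>)) + 8 * (real p * (real p - 1) / 2 * cycle_m4)"
    using Ki C.integrable_U_stat[of p 2] iid_sum_moments(2)[OF km kb k0, of p]
      C.U_stat_second_moment[of p]
    by (simp add: C.kernel_m2_def cycle_m4_def)
  also have "\<dots> \<le> 2 * (real p * wedge_m4) + 8 * ((real p)^2 / 2 * cycle_m4)"
  proof -
    have "real p * (real p - 1) / 2 \<le> (real p)^2 / 2" by (simp add: power2_eq_square algebra_simps)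
    then show ?thesis
      using k2 cycle_m4_nonneg by (intro add_mono mult_left_mono mult_right_mono) auto
  qed
  finally show ?thesis by (simp add: algebra_simps)
qed

lemma pair_m22_deviation:
  assumes "s > 0"
  shows "\<bar>pair_m22 p - real p * kernel_m2 * U_m2 p\<bar>
     \<le> s / 2 * U_m4 p + (real p * wedge_m4 + 2 * (real p)^2 * cycle_m4) / s"
proof -
  define \<psi> where "\<psi> x = (\<integral>y. (increment p x y)^2 \<partial>\<nu>)" for x
  have pm [measurable]: "\<psi> \<in> borel_measurable (sample p)"
    unfolding \<psi>_def
  proof (rule borel_measurable_lebesgue_integral)
    have "(\<lambda>z. (increment p (fst z) (snd z))^2) \<in> borel_measurable (sample p \<Otimes>\<^sub>M \<nu>)" by measurable
    then show "(\<lambda>(x, y). (increment p x y)^2) \<in> borel_measurable (sample p \<Otimes>\<^sub>M \<nu>)"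
      by (simp add: case_prod_beta')
  qed
  have pb: "\<bar>\<psi> x\<bar> \<le> (real p)^2" if "x \<in> space (sample p)" for x
    unfolding \<psi>_def by (rule abs_integral_le)
      (use that increment_bound[of p x] in \<open>auto simp: power2_le_iff_abs_le\<close>)
  have b: "(U_stat p x)^2 * (increment p x y)^2 \<le> (real p * real p)^2 * (real p)^2" for x y
    using abs_power_prod_le[OF U_stat_bound increment_bound, where i=2 and j=2] by (simp add: abs_mult)
  have m22: "pair_m22 p = (\<integral>x. (U_stat p x)^2 * \<psi> x \<partial>sample p)"
    unfolding pair_m22_def \<psi>_def
    by (subst integral_sample_pair_fst(1)[where B="(real p * real p) ^ 2 * real p ^ 2"])
      (auto intro: b)
  have pvb: "\<bar>\<psi> x - real p * kernel_m2\<bar> \<le> (real p)^2 + real p * kernel_m2" if "x \<in> space (sample p)" for x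
    using pb[OF that] kernel_m2_nonneg mult_nonneg_nonneg[of "real p" kernel_m2] by linarith
  have i1: "integrable (sample p) (\<lambda>x. (U_stat p x)^2 * \<psi> x)"
    by (rule prob_space.integrable_bounded[OF prob_space_sample, where B="(real p * real p)^2 * (real p)^2"])
      (use pb U_stat_bound in \<open>auto simp: abs_mult power2_le_iff_abs_le intro!: mult_mono\<close>)
  have i2: "integrable (sample p) (\<lambda>x. (\<psi> x - real p * kernel_m2)^2)"
    by (rule prob_space.integrable_bounded[OF prob_space_sample, where B="((real p)^2 + real p * kernel_m2)^2"])
      (use pvb kernel_m2_nonneg in \<open>auto simp: power2_le_iff_abs_le\<close>)
  have "pair_m22 p - real p * kernel_m2 * U_m2 p = (\<integral>x. (U_stat p x)^2 * (\<psi> x - real p * kernel_m2) \<partial>sample p)"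
    using i1 integrable_U_stat[of p 2] by (simp add: m22 U_m2_def algebra_simps)
  also have "\<bar>\<dots>\<bar> \<le> (\<integral>x. \<bar>(U_stat p x)^2 * (\<psi> x - real p * kernel_m2)\<bar> \<partial>sample p)"
    by (rule integral_abs_bound)
  also have "\<dots> \<le> (\<integral>x. s / 2 * (U_stat p x)^4 + 1 / (2 * s) * (\<psi> x - real p * kernel_m2)^2 \<partial>sample p)"
  proof (rule integral_mono')
    fix x
    let ?a = "(U_stat p x)^2" and ?b = "\<psi> x - real p * kernel_m2"
    have "0 \<le> (s * ?a - \<bar>?b\<bar>)^2 / (2 * s)" using assms by simp
    also have "\<dots> = s / 2 * ?a^2 + 1 / (2 * s) * ?b^2 - ?a * \<bar>?b\<bar>"
      using assms by (simp add: power2_diff field_simps power2_eq_square)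
    finally show "\<bar>?a * ?b\<bar> \<le> s / 2 * (U_stat p x)^4 + 1 / (2 * s) * ?b^2"
      by (simp add: abs_mult flip: power_mult)
    show "0 \<le> s / 2 * (U_stat p x)^4 + 1 / (2 * s) * ?b^2" using assms by simp
  next
    show "integrable (sample p) (\<lambda>x. s / 2 * (U_stat p x)^4 + 1 / (2 * s) * (\<psi> x - real p * kernel_m2)^2)"
      using i2 integrable_U_stat[of p 4] by simp
  qed
  also have "\<dots> = s / 2 * U_m4 p + 1 / (2 * s) * (\<integral>x. (\<psi> x - real p * kernel_m2)^2 \<partial>sample p)"
    using i2 integrable_U_stat[of p 4] by (simp add: U_m4_def)
  also have "\<dots> \<le> s / 2 * U_m4 p + 1 / (2 * s) * (2 * real p * wedge_m4 + 4 * (real p)^2 * cycle_m4)"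
    using increment_m2_deviation[of p] assms by (intro add_left_mono mult_left_mono) (auto simp: \<psi>_def)
  also have "\<dots> = s / 2 * U_m4 p + (real p * wedge_m4 + 2 * (real p)^2 * cycle_m4) / s"
    using assms by (simp add: field_simps)
  finally show ?thesis .
qed

text \<open>
  With \<open>T\<close> the statistic and \<open>D\<close> its increment, \<open>E T\<^sup>4 - 3 (E T\<^sup>2)\<^sup>2\<close> changes in one step by
  \<open>6 (E[T\<^sup>2 D\<^sup>2] - E[T\<^sup>2] E[D\<^sup>2]) + 4 E[T D\<^sup>3] + E D\<^sup>4 - 3 (E D\<^sup>2)\<^sup>2\<close>. The bracket is bounded through the
  conditional variance of the increment, the other terms through the fourth moment of the increment; every
  error that involves \<open>E T\<^sup>4\<close> is made a small multiple of it. Since \<open>E T\<^sup>4\<close> is monotone in the number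
  of rows, these multiples add up to at most \<open>t E T\<^sup>4\<close>.
\<close>

lemma U_m4_close:
  assumes t: "0 < t" "t \<le> 1"
  shows "\<bar>U_m4 P - 3 * (U_m2 P)^2\<bar> \<le> t * U_m4 P + 3 * (real P)^3 * kernel_m2^2
     + 72 / t * ((real P)^2 * kernel_m4 + (real P)^3 * wedge_m4 + (real P)^4 * cycle_m4)"
proof (cases "P = 0")
  case True
  then show ?thesis by (simp add: U_m4_def U_m2_def U_stat_def)
next
  case False
  define R where "R = real P"
  have R: "R \<ge> 1" using False by (simp add: R_def)
  let ?f = "\<lambda>p. U_m4 p - 3 * (U_m2 p)^2"
  define c where "c = t / (2 * R) * U_m4 P + 36 * R / t * (R * wedge_m4 + 2 * R^2 * cycle_m4)
    + 5 / t * (R * kernel_m4 + 3 * R^2 * wedge_m4) + 3 * R^2 * kernel_m2^2"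
  have step: "\<bar>?f (Suc p) - ?f p\<bar> \<le> c + t / 2 * (U_m4 (Suc p) - U_m4 p)" if p: "p < P" for p
  proof -
    let ?c = "(\<integral>z. U_stat p (fst z) * (increment p (fst z) (snd z))^3 \<partial>(sample p \<Otimes>\<^sub>M \<nu>))"
    have pR: "0 \<le> real p" "real p \<le> R" "(real p)^2 \<le> R^2" using p by (auto simp: R_def)
    have f: "?f (Suc p) - ?f p = 6 * (pair_m22 p - real p * kernel_m2 * U_m2 p) + 4 * ?c + pair_m04 p
        - 3 * (real p)^2 * kernel_m2^2"
    proof -
      have "U_m2 (Suc p) = U_m2 p + real p * kernel_m2"
        unfolding U_m2_def U_stat_second_moment by (simp add: field_simps)
      then show ?thesis unfolding U_m4_step by (simp add: power2_eq_square algebra_simps)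
    qed
    have m04: "pair_m04 p \<le> R * kernel_m4 + 3 * R^2 * wedge_m4"
    proof -
      have "real p * (real p - 1) \<le> R^2" using pR by (simp add: power2_eq_square algebra_simps)
      then have "3 * (real p * (real p - 1)) * wedge_m4 \<le> 3 * R^2 * wedge_m4"
        using wedge_m4_nonneg by (intro mult_right_mono mult_left_mono) auto
      moreover have "real p * kernel_m4 \<le> R * kernel_m4"
        using pR kernel_m4_nonneg by (intro mult_right_mono)
      ultimately show ?thesis unfolding pair_m04_def pair_D(2) by (simp add: mult.assoc)
    qed
    have d1: "6 * \<bar>pair_m22 p - real p * kernel_m2 * U_m2 p\<bar> \<le>
        t / (2 * R) * U_m4 P + 36 * R / t * (R * wedge_m4 + 2 * R^2 * cycle_m4)"
    proof -
      \<comment> \<open>The weight \<open>t / (6 R)\<close> makes the \<open>P\<close> multiples of the fourth moment sum up to \<open>t / 2\<close> times it.\<close>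
      have s: "t / (6 * R) > 0" using t R by simp
      have "6 * \<bar>pair_m22 p - real p * kernel_m2 * U_m2 p\<bar> \<le>
         t / (2 * R) * U_m4 p + 36 * R / t * (real p * wedge_m4 + 2 * (real p)^2 * cycle_m4)"
        using pair_m22_deviation[OF s, of p] R t by (simp add: field_simps)
      also have "\<dots> \<le> t / (2 * R) * U_m4 P + 36 * R / t * (R * wedge_m4 + 2 * R^2 * cycle_m4)"
        using t R p pR wedge_m4_nonneg cycle_m4_nonneg monoD[OF mono_U_m4, of p P]
        by (intro add_mono mult_left_mono mult_right_mono) auto
      finally show ?thesis .
    qed
    have d2: "4 * \<bar>?c\<bar> \<le> t / 2 * (U_m4 (Suc p) - U_m4 p) + 4 / t * (R * kernel_m4 + 3 * R^2 * wedge_m4)"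
    proof -
      have "4 * \<bar>?c\<bar> \<le> t * pair_m22 p + 4 / t * pair_m04 p" by (rule pair_m13_bound[OF t(1)])
      also have "\<dots> \<le> t * ((U_m4 (Suc p) - U_m4 p) / 2) + 4 / t * (R * kernel_m4 + 3 * R^2 * wedge_m4)"
        using t m04 U_m4_step_ge_m22[of p] by (intro add_mono mult_left_mono) auto
      finally show ?thesis by simp
    qed
    have d3: "\<bar>pair_m04 p\<bar> \<le> 1 / t * (R * kernel_m4 + 3 * R^2 * wedge_m4)"
    proof -
      have "1 * pair_m04 p \<le> 1 / t * (R * kernel_m4 + 3 * R^2 * wedge_m4)"
        using m04 t pair_m04_nonneg by (intro mult_mono) auto
      then show ?thesis using pair_m04_nonneg[of p] by simp
    qed
    have d4: "\<bar>3 * (real p)^2 * kernel_m2^2\<bar> \<le> 3 * R^2 * kernel_m2^2"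
      using pR by (auto intro!: mult_right_mono)
    have "c = (t / (2 * R) * U_m4 P + 36 * R / t * (R * wedge_m4 + 2 * R^2 * cycle_m4))
       + 4 / t * (R * kernel_m4 + 3 * R^2 * wedge_m4) + 1 / t * (R * kernel_m4 + 3 * R^2 * wedge_m4)
       + 3 * R^2 * kernel_m2^2"
      unfolding c_def using t by (simp add: field_simps)
    then have "c + t / 2 * (U_m4 (Suc p) - U_m4 p) =
       (t / (2 * R) * U_m4 P + 36 * R / t * (R * wedge_m4 + 2 * R^2 * cycle_m4))
       + (t / 2 * (U_m4 (Suc p) - U_m4 p) + 4 / t * (R * kernel_m4 + 3 * R^2 * wedge_m4))
       + 1 / t * (R * kernel_m4 + 3 * R^2 * wedge_m4) + 3 * R^2 * kernel_m2^2"
      by (simp only: ac_simps)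
    moreover have "\<bar>6 * a + 4 * b + d - e\<bar> \<le> a' + b' + d' + e'"
      if "6 * \<bar>a\<bar> \<le> a'" "4 * \<bar>b\<bar> \<le> b'" "\<bar>d\<bar> \<le> d'" "\<bar>e\<bar> \<le> e'" for a b d e a' b' d' e' :: real
      using that by linarith
    ultimately show ?thesis unfolding f using d1 d2 d3 d4 by presburger
  qed
  have "\<bar>?f p\<bar> \<le> real p * c + t / 2 * U_m4 p" if "p \<le> P" for p
    using that
  proof (induction p)
    case (Suc p)
    then have "\<bar>?f p\<bar> \<le> real p * c + t / 2 * U_m4 p" by simp
    then show ?case using step[of p] Suc.prems by (simp add: algebra_simps)
  qed (simp add: U_m4_def U_m2_def U_stat_def)
  then have "\<bar>?f P\<bar> \<le> R * c + t / 2 * U_m4 P" by (simp add: R_def)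
  also have "R * c + t / 2 * U_m4 P = t * U_m4 P + 3 * R^3 * kernel_m2^2
     + 1 / t * (5 * R^2 * kernel_m4 + 51 * R^3 * wedge_m4 + 72 * R^4 * cycle_m4)"
    unfolding c_def using t R by (simp add: field_simps eval_nat_numeral)
  also have "\<dots> \<le> t * U_m4 P + 3 * R^3 * kernel_m2^2
     + 1 / t * (72 * R^2 * kernel_m4 + 72 * R^3 * wedge_m4 + 72 * R^4 * cycle_m4)"
    using t R wedge_m4_nonneg cycle_m4_nonneg kernel_m4_nonneg
    by (intro add_mono mult_left_mono mult_right_mono order_refl) auto
  also have "\<dots> = t * U_m4 P + 3 * R^3 * kernel_m2^2
     + 72 / t * (R^2 * kernel_m4 + R^3 * wedge_m4 + R^4 * cycle_m4)"
    by (simp add: algebra_simps add_divide_distrib)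
  finally show ?thesis by (simp add: R_def)
qed

end

section \<open>Directions of rows with symmetric entries\<close>

text \<open>
  Most functions of a row that occur below are polynomials in bounded coordinates. This predicate is
  closed under the ring operations and settles their integrability by introduction rules.
\<close>

definition bounded_measurable :: "'a measure \<Rightarrow> ('a \<Rightarrow> real) \<Rightarrow> bool" where
  "bounded_measurable M f \<longleftrightarrow> f \<in> borel_measurable M \<and> (\<exists>B. \<forall>x. \<bar>f x\<bar> \<le> B)"

named_theorems bm_intros

lemma bounded_measurableI: "f \<in> borel_measurable M \<Longrightarrow> (\<And>x. \<bar>f x\<bar> \<le> B) \<Longrightarrow> bounded_measurable M f"
  unfolding bounded_measurable_def by blast

lemma bm_const [bm_intros]: "bounded_measurable M (\<lambda>_. c)"
  by (rule bounded_measurableI[where B="\<bar>c\<bar>"]) auto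

lemma bm_add [bm_intros]:
  assumes "bounded_measurable M f" "bounded_measurable M g"
  shows "bounded_measurable M (\<lambda>x. f x + g x)"
proof -
  obtain A B where "\<And>x. \<bar>f x\<bar> \<le> A" "\<And>x. \<bar>g x\<bar> \<le> B" using assms by (auto simp: bounded_measurable_def)
  then have "\<bar>f x + g x\<bar> \<le> A + B" for x using abs_triangle_ineq[of "f x" "g x"] by (meson add_mono order_trans)
  with assms show ?thesis by (intro bounded_measurableI[where B="A+B"]) (auto simp: bounded_measurable_def)
qed

lemma bm_mult [bm_intros]:
  assumes "bounded_measurable M f" "bounded_measurable M g"
  shows "bounded_measurable M (\<lambda>x. f x * g x)"
proof -
  obtain A B where "\<And>x. \<bar>f x\<bar> \<le> A" "\<And>x. \<bar>g x\<bar> \<le> B" using assms by (auto simp: bounded_measurable_def)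
  then have "\<bar>f x * g x\<bar> \<le> A * B" for x
    unfolding abs_mult by (meson abs_ge_zero mult_mono order_trans)
  with assms show ?thesis by (intro bounded_measurableI[where B="A*B"]) (auto simp: bounded_measurable_def)
qed

lemma bm_minus [bm_intros]: "bounded_measurable M f \<Longrightarrow> bounded_measurable M (\<lambda>x. - f x)"
  using bm_mult[OF bm_const[of M "-1"], of f] by simp

lemma bm_diff [bm_intros]:
  "bounded_measurable M f \<Longrightarrow> bounded_measurable M g \<Longrightarrow> bounded_measurable M (\<lambda>x. f x - g x)"
  using bm_add[OF _ bm_minus, of M f g] by simp

lemma bm_divide [bm_intros]: "bounded_measurable M f \<Longrightarrow> bounded_measurable M (\<lambda>x. f x / c)"
  using bm_mult[OF _ bm_const[of M "1/c"], of f] by simp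

lemma bm_power [bm_intros]: "bounded_measurable M f \<Longrightarrow> bounded_measurable M (\<lambda>x. f x ^ m)"
  by (induction m) (auto intro!: bm_intros)

lemma bm_sum [bm_intros]:
  "(\<And>i. i \<in> I \<Longrightarrow> bounded_measurable M (f i)) \<Longrightarrow> bounded_measurable M (\<lambda>x. \<Sum>i\<in>I. f i x)"
  by (induction I rule: infinite_finite_induct) (auto intro!: bm_intros)

lemma bm_integrable: "prob_space M \<Longrightarrow> bounded_measurable M f \<Longrightarrow> integrable M f"
  unfolding bounded_measurable_def by (auto intro: prob_space.integrable_bounded)

lemma bm_measurable: "bounded_measurable M f \<Longrightarrow> f \<in> borel_measurable M"
  by (simp add: bounded_measurable_def)

text \<open>
  For a zero row the convention \<open>x / 0 = 0\<close> makes all coordinates vanish. The squared length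
  \<open>row_mass\<close> of a direction is therefore 0 or 1, and it is 1 almost surely.
\<close>

definition direction :: "nat \<Rightarrow> (nat \<Rightarrow> real) \<Rightarrow> nat \<Rightarrow> real" where
  "direction n x t = x t / sqrt (\<Sum>k<n. (x k)\<^sup>2)"

definition row_mass :: "nat \<Rightarrow> (nat \<Rightarrow> real) \<Rightarrow> real" where
  "row_mass n x = (\<Sum>t<n. (direction n x t)\<^sup>2)"

lemma row_mass_eq: "row_mass n x = (if (\<Sum>k<n. (x k)\<^sup>2) = 0 then 0 else 1)"
proof -
  have "row_mass n x = (\<Sum>t<n. (x t)^2 / (\<Sum>k<n. (x k)\<^sup>2))"
    unfolding row_mass_def direction_def by (simp add: power_divide sum_nonneg)
  also have "\<dots> = (\<Sum>t<n. (x t)^2) / (\<Sum>k<n. (x k)\<^sup>2)" by (rule sum_divide_distrib[symmetric])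
  finally show ?thesis by auto
qed

lemma row_mass_bounds: "0 \<le> row_mass n x" "row_mass n x \<le> 1"
  by (auto simp: row_mass_eq)

lemma row_mass_sq: "row_mass n x ^ 2 = row_mass n x"
  by (simp add: row_mass_eq)

lemma direction_sq_le: "t < n \<Longrightarrow> (direction n x t)^2 \<le> 1"
  using member_le_sum[of t "{..<n}" "\<lambda>t. (direction n x t)^2"] row_mass_bounds(2)[of n x]
  by (simp add: row_mass_def)

lemma direction_abs_le: "t < n \<Longrightarrow> \<bar>direction n x t\<bar> \<le> 1"
  using direction_sq_le abs_square_le_1 by blast

lemma direction_flip:
  "s < n \<Longrightarrow> direction n (x(s := - x s)) t = (if t = s then - direction n x t else direction n x t)"
proof -
  have "(\<Sum>k<n. ((x(s := - x s)) k)\<^sup>2) = (\<Sum>k<n. (x k)\<^sup>2)" by (rule sum.cong) auto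
  then show ?thesis by (simp add: direction_def)
qed

lemma direction_permute:
  assumes "bij_betw \<pi> {..<n} {..<n}" "t < n"
  shows "direction n (\<lambda>i\<in>{..<n}. x (\<pi> i)) t = direction n x (\<pi> t)"
proof -
  have "(\<Sum>k<n. ((\<lambda>i\<in>{..<n}. x (\<pi> i)) k)\<^sup>2) = (\<Sum>k<n. (x (\<pi> k))\<^sup>2)" by (rule sum.cong) auto
  also have "\<dots> = (\<Sum>k<n. (x k)\<^sup>2)" by (rule sum.reindex_bij_betw[OF assms(1)])
  finally show ?thesis using assms(2) by (simp add: direction_def)
qed

locale symmetric_entries = prob_space N for N :: "real measure" +
  fixes n :: nat
  assumes sets_N [measurable_cong]: "sets N = sets borel"
    and symmetric_N: "distr N borel uminus = N"
    and AE_nonzero: "AE x in N. x \<noteq> 0"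
    and two_le_n: "2 \<le> n"
begin

abbreviation row_law :: "(nat \<Rightarrow> real) measure" where
  "row_law \<equiv> \<Pi>\<^sub>M i\<in>{..<n}. N"

abbreviation "dir \<equiv> direction n"
abbreviation "mass \<equiv> row_mass n"

lemma prob_space_row_law: "prob_space row_law"
  by (rule prob_space_PiM) (rule prob_space_axioms)

sublocale row: prob_space row_law by (rule prob_space_row_law)

lemma space_N [simp]: "space N = UNIV"
  using sets_eq_imp_space_eq[OF sets_N] by simp

lemma row_component_measurable [measurable]: "t < n \<Longrightarrow> (\<lambda>x. x t) \<in> borel_measurable row_law"
  using measurable_component_singleton[of t "{..<n}" "\<lambda>_. N"] by (simp cong: measurable_cong_sets add: sets_N)

lemma dir_measurable [measurable]: "t < n \<Longrightarrow> (\<lambda>x. dir x t) \<in> borel_measurable row_law"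
proof -
  assume "t < n"
  have "(\<lambda>x. \<Sum>k<n. (x k)\<^sup>2) \<in> borel_measurable row_law"
    by (intro borel_measurable_sum borel_measurable_power row_component_measurable) auto
  with \<open>t < n\<close> show ?thesis unfolding direction_def by measurable
qed

lemma bm_dir [bm_intros]: "t < n \<Longrightarrow> bounded_measurable row_law (\<lambda>x. dir x t)"
  by (rule bounded_measurableI[where B=1]) (auto intro: direction_abs_le)

lemma bm_mass [bm_intros]: "bounded_measurable row_law mass"
  unfolding row_mass_def by (auto intro!: bm_intros)

lemma bm_row_integrable: "bounded_measurable row_law f \<Longrightarrow> integrable row_law f"
  by (rule bm_integrable[OF prob_space_row_law])

lemma AE_mass: "AE x in row_law. mass x = 1"
proof -
  have "AE x in row_law. x 0 \<noteq> 0"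
    using AE_PiM_component[of "{..<n}" "\<lambda>_. N" 0 "\<lambda>x. x \<noteq> 0"] AE_nonzero two_le_n prob_space_axioms by auto
  then show ?thesis
  proof eventually_elim
    case (elim x)
    have "(x 0)\<^sup>2 \<le> (\<Sum>k<n. (x k)\<^sup>2)"
      by (rule member_le_sum) (use two_le_n in auto)
    with elim have "(\<Sum>k<n. (x k)\<^sup>2) \<noteq> 0" by (metis zero_less_power2 not_le)
    then show ?case by (simp add: row_mass_eq)
  qed
qed

lemma flip_measurable: "s < n \<Longrightarrow> (\<lambda>x. x(s := - x s)) \<in> measurable row_law row_law"
  by (rule measurable_PiM_single')
     (auto simp: space_PiM PiE_def extensional_def sets_N cong: measurable_cong_sets)

lemma distr_flip:
  assumes s: "s < n"
  shows "distr row_law row_law (\<lambda>x. x(s := - x s)) = row_law"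
proof -
  note fm = flip_measurable[OF s]
  interpret product_sigma_finite "\<lambda>_::nat. N" by unfold_locales
  show ?thesis
  proof (rule PiM_eqI)
    fix A :: "nat \<Rightarrow> real set" assume A: "\<And>i. i \<in> {..<n} \<Longrightarrow> A i \<in> sets N"
    define B where "B = A(s := uminus -` A s)"
    have um: "uminus \<in> measurable N borel"
      unfolding measurable_cong_sets[OF sets_N refl] by measurable
    have Bs: "B i \<in> sets N" if "i < n" for i
    proof -
      have "uminus -` A s \<inter> space N \<in> sets N"
        by (rule measurable_sets[OF um]) (use A s in \<open>auto simp: sets_N\<close>)
      then show ?thesis using A[of i] that by (cases "i = s") (simp_all add: B_def)
    qed
    have eq: "emeasure N (B i) = emeasure N (A i)" if "i < n" for i
    proof (cases "i = s")
      case True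
      have "emeasure N (A s) = emeasure (distr N borel uminus) (A s)" by (simp add: symmetric_N)
      also have "\<dots> = emeasure N (uminus -` A s \<inter> space N)"
        by (rule emeasure_distr[OF um]) (use A s in \<open>auto simp: sets_N\<close>)
      finally show ?thesis using True by (simp add: B_def)
    qed (simp add: B_def)
    have pre: "(\<lambda>x. x(s := - x s)) -` Pi\<^sub>E {..<n} A \<inter> space row_law = Pi\<^sub>E {..<n} B"
    proof (intro Set.set_eqI iffI)
      fix x assume "x \<in> (\<lambda>x. x(s := - x s)) -` Pi\<^sub>E {..<n} A \<inter> space row_law"
      then show "x \<in> Pi\<^sub>E {..<n} B"
        by (auto simp: B_def space_PiM PiE_iff extensional_def split: if_splits)
    next
      fix x assume "x \<in> Pi\<^sub>E {..<n} B"
      then show "x \<in> (\<lambda>x. x(s := - x s)) -` Pi\<^sub>E {..<n} A \<inter> space row_law"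
        using s by (auto simp: B_def space_PiM PiE_iff extensional_def split: if_splits)
    qed
    have "emeasure (distr row_law row_law (\<lambda>x. x(s := - x s))) (Pi\<^sub>E {..<n} A) = emeasure row_law (Pi\<^sub>E {..<n} B)"
      by (subst emeasure_distr) (use A fm in \<open>auto simp: pre\<close>)
    also have "\<dots> = (\<Prod>i<n. emeasure N (B i))"
      by (rule emeasure_PiM) (use Bs in auto)
    finally show "emeasure (distr row_law row_law (\<lambda>x. x(s := - x s))) (Pi\<^sub>E {..<n} A) = (\<Prod>i<n. emeasure N (A i))"
      using eq by simp
  qed auto
qed

lemma integral_flip:
  fixes f :: "(nat \<Rightarrow> real) \<Rightarrow> real"
  assumes "s < n" "f \<in> borel_measurable row_law"
  shows "(\<integral>x. f (x(s := - x s)) \<partial>row_law) = integral\<^sup>L row_law f"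
  using integral_distr[OF flip_measurable[OF assms(1)] assms(2)] distr_flip[OF assms(1)] by simp

lemma integral_permute:
  fixes f :: "(nat \<Rightarrow> real) \<Rightarrow> real"
  assumes "bij_betw \<pi> {..<n} {..<n}" and [measurable]: "f \<in> borel_measurable row_law"
  shows "(\<integral>x. f (\<lambda>i\<in>{..<n}. x (\<pi> i)) \<partial>row_law) = integral\<^sup>L row_law f"
proof -
  have m: "(\<lambda>x. \<lambda>i\<in>{..<n}. x (\<pi> i)) \<in> measurable row_law row_law"
    using assms(1) by (intro measurable_restrict measurable_component_singleton) (auto simp: bij_betw_def)
  have "distr row_law row_law (\<lambda>x. \<lambda>i\<in>{..<n}. x (\<pi> i)) = row_law"
    by (rule distr_PiM_reindex) (use assms(1) prob_space_axioms in \<open>auto simp: bij_betw_def\<close>)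
  then show ?thesis using integral_distr[OF m assms(2)] by simp
qed

lemma bij_transpose: "s < n \<Longrightarrow> t < n \<Longrightarrow> bij_betw (Transposition.transpose s t) {..<n} {..<n}"
  by (rule bij_betw_imageI) (auto simp: inj_on_def Transposition.transpose_def image_iff split: if_splits)

end

context symmetric_entries
begin

definition m4 :: real where "m4 = (\<integral>x. (dir x 0)^4 \<partial>row_law)"
definition m22 :: real where "m22 = (\<integral>x. (dir x 0)^2 * (dir x 1)^2 \<partial>row_law)"

lemma integral_dir_permute:
  assumes "bij_betw \<pi> {..<n} {..<n}" "s < n" "t < n"
  shows "(\<integral>x. (dir x s)^i * (dir x t)^j \<partial>row_law) = (\<integral>x. (dir x (\<pi> s))^i * (dir x (\<pi> t))^j \<partial>row_law)"
proof -
  have "(\<lambda>x. (dir x s)^i * (dir x t)^j) \<in> borel_measurable row_law"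
    using assms by (intro bm_measurable bm_intros) auto
  from integral_permute[OF assms(1) this] show ?thesis
    using assms direction_permute[OF assms(1)] by simp
qed

lemma integral_dir_single:
  assumes "t < n"
  shows "(\<integral>x. (dir x t)^i \<partial>row_law) = (\<integral>x. (dir x 0)^i \<partial>row_law)"
  using integral_dir_permute[OF bij_transpose[of t 0], of t t i 0] assms two_le_n by simp

lemma integral_dir_pair:
  assumes "s < n" "t < n" "s \<noteq> t"
  shows "(\<integral>x. (dir x s)^2 * (dir x t)^2 \<partial>row_law) = m22"
proof -
  define t' where "t' = Transposition.transpose s 0 t"
  have t': "t' < n" "t' \<noteq> 0"
    using assms two_le_n by (auto simp: t'_def Transposition.transpose_def)
  have "(\<integral>x. (dir x s)^2 * (dir x t)^2 \<partial>row_law) = (\<integral>x. (dir x 0)^2 * (dir x t')^2 \<partial>row_law)"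
    using integral_dir_permute[OF bij_transpose[of s 0], of s t 2 2] assms two_le_n by (simp add: t'_def)
  also have "\<dots> = m22"
    using integral_dir_permute[OF bij_transpose[of t' 1], of 0 t' 2 2] t' two_le_n
    by (simp add: m22_def Transposition.transpose_def)
  finally show ?thesis .
qed

lemma integral_mass: "(\<integral>x. mass x * f x \<partial>row_law) = integral\<^sup>L row_law f"
  if "f \<in> borel_measurable row_law" for f :: "(nat \<Rightarrow> real) \<Rightarrow> real"
  by (rule integral_cong_AE) (use that AE_mass bm_measurable[OF bm_mass] in auto)

lemma integral_dir_sq: "t < n \<Longrightarrow> (\<integral>x. (dir x t)^2 \<partial>row_law) = 1 / n"
proof -
  assume t: "t < n"
  have "1 = (\<integral>x. mass x \<partial>row_law)" using integral_mass[of "\<lambda>_. 1"] by (simp add: row.prob_space)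
  also have "\<dots> = (\<Sum>t<n. \<integral>x. (dir x t)^2 \<partial>row_law)"
    unfolding row_mass_def by (intro Bochner_Integration.integral_sum bm_row_integrable bm_intros) auto
  also have "\<dots> = real n * (\<integral>x. (dir x 0)^2 \<partial>row_law)"
  proof -
    have "(\<Sum>t<n. \<integral>x. (dir x t)^2 \<partial>row_law) = (\<Sum>t<n. \<integral>x. (dir x 0)^2 \<partial>row_law)"
      by (intro sum.cong refl integral_dir_single) simp
    then show ?thesis by simp
  qed
  finally show ?thesis using integral_dir_single[OF t, of 2] two_le_n by (simp add: field_simps)
qed

text \<open>Integrating \<open>(\<Sum>t. Y\<^sub>t\<^sup>2)\<^sup>2 = 1\<close>, which holds almost surely.\<close>

lemma moment_relation: "n * m4 + n * (real n - 1) * m22 = 1"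
proof -
  have w: "(\<integral>x. (dir x s)^2 * (dir x t)^2 \<partial>row_law) = (if s = t then m4 else m22)" if "s < n" "t < n" for s t
    using that integral_dir_pair[of s t] integral_dir_single[of s 4]
    by (auto simp: m4_def power4_eq_xxxx power2_eq_square mult.assoc)
  have row: "(\<Sum>t<n. if s = t then m4 else m22) = m4 + (real n - 1) * m22" if "s < n" for s
  proof -
    have "(\<Sum>t<n. if s = t then m4 else m22) = (\<Sum>t<n. m22 + (if s = t then m4 - m22 else 0))"
      by (rule sum.cong) auto
    then show ?thesis using that by (simp add: sum.distrib algebra_simps)
  qed
  have "1 = (\<integral>x. mass x * mass x \<partial>row_law)"
    using integral_mass[of mass] integral_mass[of "\<lambda>_. 1"] bm_measurable[OF bm_mass] by (simp add: row.prob_space)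
  also have "\<dots> = (\<integral>x. (\<Sum>s<n. \<Sum>t<n. (dir x s)^2 * (dir x t)^2) \<partial>row_law)"
    by (simp add: row_mass_def sum_product)
  also have "\<dots> = (\<Sum>s<n. \<Sum>t<n. \<integral>x. (dir x s)^2 * (dir x t)^2 \<partial>row_law)"
    by (subst Bochner_Integration.integral_sum)
       (auto intro!: bm_row_integrable bm_intros sum.cong Bochner_Integration.integral_sum)
  also have "\<dots> = (\<Sum>s<n. \<Sum>t<n. if s = t then m4 else m22)"
    by (intro sum.cong) (auto simp: w)
  also have "\<dots> = (\<Sum>s<n. m4 + (real n - 1) * m22)" by (intro sum.cong) (auto simp: row)
  finally show ?thesis by (simp add: algebra_simps)
qed

lemma integral_odd:
  fixes f :: "(nat \<Rightarrow> real) \<Rightarrow> real"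
  assumes "s < n" "f \<in> borel_measurable row_law" "\<And>x. f (x(s := - x s)) = - f x"
  shows "integral\<^sup>L row_law f = 0"
  using integral_flip[OF assms(1,2)] assms(3) by simp

lemma integral_dir_odd:
  assumes "s < n" "t < n" "s \<noteq> t"
  shows "(\<integral>x. dir x s * dir x t \<partial>row_law) = 0"
  by (rule integral_odd[OF assms(1)])
     (use assms in \<open>auto simp: direction_flip intro!: bm_measurable bm_intros\<close>)

text \<open>
  Flipping the sign of one entry preserves the law of the row, so the moment vanishes unless the
  indices coincide in pairs; permuting the entries leaves only the two values \<open>m4\<close> and \<open>m22\<close>. The
  right-hand side is the formula for a Gaussian vector plus a correction on the diagonal.
\<close>

lemma integral_dir4:
  assumes "s < n" "t < n" "u < n" "v < n"
  shows "(\<integral>x. dir x s * dir x t * (dir x u * dir x v) \<partial>row_law) =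
     m22 * ((if s = t then 1 else 0) * (if u = v then 1 else 0)
        + (if s = u then 1 else 0) * (if t = v then 1 else 0)
        + (if s = v then 1 else 0) * (if t = u then 1 else 0))
     + (m4 - 3 * m22) * (if s = t \<and> t = u \<and> u = v then 1 else 0)"
proof -
  define I where "I = (\<integral>x. dir x s * dir x t * (dir x u * dir x v) \<partial>row_law)"
  have m: "(\<lambda>x. dir x s * dir x t * (dir x u * dir x v)) \<in> borel_measurable row_law"
    using assms by (intro bm_measurable bm_intros)
  define sg where "sg r a = (if a = r then -1 else 1 :: real)" for r a :: nat
  have flip: "I = sg r s * sg r t * sg r u * sg r v * I" if r: "r < n" for r
  proof -
    have d: "dir (x(r := - x r)) a = sg r a * dir x a" for x a
      using direction_flip[OF r, of x a] by (simp add: sg_def)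
    have "I = (\<integral>x. dir (x(r := - x r)) s * dir (x(r := - x r)) t * (dir (x(r := - x r)) u * dir (x(r := - x r)) v) \<partial>row_law)"
      unfolding I_def by (rule integral_flip[OF r m, symmetric])
    also have "\<dots> = (\<integral>x. (sg r s * sg r t * sg r u * sg r v) * (dir x s * dir x t * (dir x u * dir x v)) \<partial>row_law)"
      unfolding d by (simp only: mult_ac)
    finally show ?thesis by (simp add: I_def)
  qed
  have all: "I = m4" if "t = s" "u = s" "v = s"
    using integral_dir_single[OF assms(1), of 4] that
    by (simp add: I_def m4_def power4_eq_xxxx mult.assoc)
  have p1: "I = m22" if "t = s" "v = u" "s \<noteq> u"
    using integral_dir_pair[of s u] assms that by (simp add: I_def power2_eq_square)
  have p2: "I = m22" if "u = s" "v = t" "s \<noteq> t"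
    using integral_dir_pair[of s t] assms that by (simp add: I_def power2_eq_square mult_ac)
  have p3: "I = m22" if "v = s" "u = t" "s \<noteq> t"
    using integral_dir_pair[of s t] assms that by (simp add: I_def power2_eq_square mult_ac)
  note fs = flip[OF assms(1)] and ft = flip[OF assms(2)] and fu = flip[OF assms(3)] and fv = flip[OF assms(4)]
  have "I = m22 * ((if s = t then 1 else 0) * (if u = v then 1 else 0)
        + (if s = u then 1 else 0) * (if t = v then 1 else 0)
        + (if s = v then 1 else 0) * (if t = u then 1 else 0))
     + (m4 - 3 * m22) * (if s = t \<and> t = u \<and> u = v then 1 else 0)"
  proof (cases "s = t")
    case st: True
    show ?thesis
    proof (cases "u = v")
      case True
      then show ?thesis using st all p1 by (cases "s = u") auto
    next
      case False
      then have "I = 0" using st fu fv by (cases "u = s") (auto simp: sg_def)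
      then show ?thesis using st False by simp
    qed
  next
    case st: False
    show ?thesis
    proof (cases "s = u")
      case su: True
      show ?thesis
      proof (cases "t = v")
        case True
        then show ?thesis using st su p2 by auto
      next
        case False
        then have "I = 0" using st su ft by (auto simp: sg_def)
        then show ?thesis using st su False by simp
      qed
    next
      case su: False
      show ?thesis
      proof (cases "s = v")
        case sv: True
        show ?thesis
        proof (cases "t = u")
          case True
          then show ?thesis using st sv p3 by auto
        next
          case False
          then have "I = 0" using st sv ft by (auto simp: sg_def)
          then show ?thesis using st su sv False by simp
        qed
      next
        case False
        then have "I = 0" using st su fs by (auto simp: sg_def)
        then show ?thesis using st su False by simp
      qed
    qed
  qed
  then show ?thesis by (simp only: I_def)
qed

lemma integral_quadratic_form:
  fixes a :: "nat \<Rightarrow> real"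
  shows "(\<integral>x. (\<Sum>t<n. a t * dir x t)^2 \<partial>row_law) = (\<Sum>t<n. (a t)^2) / n"
proof -
  have d: "(\<integral>x. dir x s * dir x t \<partial>row_law) = (if s = t then 1 / n else 0)" if "s < n" "t < n" for s t
    using that integral_dir_odd[of s t] integral_dir_sq[of s] by (auto simp: power2_eq_square)
  have "(\<integral>x. (\<Sum>t<n. a t * dir x t)^2 \<partial>row_law) =
     (\<integral>x. (\<Sum>s<n. \<Sum>t<n. (a s * a t) * (dir x s * dir x t)) \<partial>row_law)"
    by (simp add: power2_eq_square sum_product mult_ac)
  also have "\<dots> = (\<Sum>s<n. \<integral>x. (\<Sum>t<n. (a s * a t) * (dir x s * dir x t)) \<partial>row_law)"
    by (intro Bochner_Integration.integral_sum bm_row_integrable bm_intros) auto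
  also have "\<dots> = (\<Sum>s<n. \<Sum>t<n. \<integral>x. (a s * a t) * (dir x s * dir x t) \<partial>row_law)"
    by (intro sum.cong refl Bochner_Integration.integral_sum bm_row_integrable bm_intros) auto
  also have "\<dots> = (\<Sum>s<n. \<Sum>t<n. (a s * a t) * (if s = t then 1 / n else 0))"
    by (intro sum.cong refl) (auto simp: d)
  also have "\<dots> = (\<Sum>s<n. a s * a s / n)"
    by (intro sum.cong refl) (simp add: if_distrib cong: if_cong)
  finally show ?thesis by (simp add: power2_eq_square sum_divide_distrib)
qed

lemma integral_biquadratic_form:
  fixes a b :: "nat \<Rightarrow> real"
  shows "(\<integral>x. (\<Sum>t<n. a t * dir x t)^2 * (\<Sum>t<n. b t * dir x t)^2 \<partial>row_law) =
     m22 * ((\<Sum>t<n. (a t)^2) * (\<Sum>t<n. (b t)^2) + 2 * (\<Sum>t<n. a t * b t)^2)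
     + (m4 - 3 * m22) * (\<Sum>t<n. (a t)^2 * (b t)^2)"
proof -
  let ?c = "\<lambda>s t u v. a s * a t * (b u * b v)"
  let ?d = "\<lambda>s t u v x. dir x s * dir x t * (dir x u * dir x v)"
  let ?\<delta> = "\<lambda>s t. if s = t then 1 else 0 :: real"
  have ex: "(\<Sum>t<n. a t * dir x t)^2 * (\<Sum>t<n. b t * dir x t)^2
    = (\<Sum>s<n. \<Sum>t<n. \<Sum>u<n. \<Sum>v<n. ?c s t u v * ?d s t u v x)" for x
  proof -
    have q: "(\<Sum>t<n. c t * dir x t)^2 = (\<Sum>s<n. \<Sum>t<n. c s * c t * (dir x s * dir x t))" for c
      unfolding power2_eq_square sum_product by (intro sum.cong refl) (simp only: mult_ac)
    have "(\<Sum>t<n. a t * dir x t)^2 * (\<Sum>t<n. b t * dir x t)^2 =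
      (\<Sum>s<n. \<Sum>t<n. \<Sum>u<n. \<Sum>v<n. (a s * a t * (dir x s * dir x t)) * (b u * b v * (dir x u * dir x v)))"
      unfolding q by (subst sum_distrib_right, intro sum.cong refl)+
        (subst sum_distrib_left, intro sum.cong refl)+
    then show ?thesis by (simp only: mult_ac)
  qed
  have "(\<integral>x. (\<Sum>t<n. a t * dir x t)^2 * (\<Sum>t<n. b t * dir x t)^2 \<partial>row_law)
     = (\<Sum>s<n. \<Sum>t<n. \<Sum>u<n. \<Sum>v<n. \<integral>x. ?c s t u v * ?d s t u v x \<partial>row_law)"
    unfolding ex
    by (subst Bochner_Integration.integral_sum, (intro bm_row_integrable bm_intros; simp), intro sum.cong refl)+
  also have "\<dots> = (\<Sum>s<n. \<Sum>t<n. \<Sum>u<n. \<Sum>v<n. ?c s t u v *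
       (m22 * (?\<delta> s t * ?\<delta> u v + ?\<delta> s u * ?\<delta> t v + ?\<delta> s v * ?\<delta> t u)
        + (m4 - 3 * m22) * (if s = t \<and> t = u \<and> u = v then 1 else 0)))"
    by (intro sum.cong refl) (simp add: integral_dir4)
  also have "\<dots> = (\<Sum>s<n. \<Sum>t<n. \<Sum>u<n. \<Sum>v<n.
       m22 * (?c s t u v * (?\<delta> s t * ?\<delta> u v)) + m22 * (?c s t u v * (?\<delta> s u * ?\<delta> t v))
       + m22 * (?c s t u v * (?\<delta> s v * ?\<delta> t u))
        + (m4 - 3 * m22) * (?c s t u v * (?\<delta> s t * ?\<delta> t u * ?\<delta> u v)))"
    by (intro sum.cong refl) (simp add: algebra_simps)
  also have "\<dots> = m22 * (\<Sum>s<n. \<Sum>t<n. \<Sum>u<n. \<Sum>v<n. ?c s t u v * (?\<delta> s t * ?\<delta> u v))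
     + m22 * (\<Sum>s<n. \<Sum>t<n. \<Sum>u<n. \<Sum>v<n. ?c s t u v * (?\<delta> s u * ?\<delta> t v))
     + m22 * (\<Sum>s<n. \<Sum>t<n. \<Sum>u<n. \<Sum>v<n. ?c s t u v * (?\<delta> s v * ?\<delta> t u))
     + (m4 - 3 * m22) * (\<Sum>s<n. \<Sum>t<n. \<Sum>u<n. \<Sum>v<n. ?c s t u v * (?\<delta> s t * ?\<delta> t u * ?\<delta> u v))"
    by (simp only: sum.distrib sum_distrib_left)
  also have "(\<Sum>s<n. \<Sum>t<n. \<Sum>u<n. \<Sum>v<n. ?c s t u v * (?\<delta> s t * ?\<delta> u v))
     = (\<Sum>t<n. (a t)^2) * (\<Sum>t<n. (b t)^2)"
  proof -
    have "(\<Sum>s<n. \<Sum>t<n. \<Sum>u<n. \<Sum>v<n. ?c s t u v * (?\<delta> s t * ?\<delta> u v))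
      = (\<Sum>s<n. \<Sum>t<n. (a s * a t * ?\<delta> s t) * (\<Sum>u<n. \<Sum>v<n. b u * b v * ?\<delta> u v))"
      by (intro sum.cong refl) (simp add: sum_distrib_left mult.assoc mult.left_commute)
    also have "\<dots> = (\<Sum>s<n. \<Sum>t<n. a s * a t * ?\<delta> s t) * (\<Sum>u<n. \<Sum>v<n. b u * b v * ?\<delta> u v)"
      by (simp only: sum_distrib_right)
    finally show ?thesis by (simp add: if_distrib power2_eq_square cong: if_cong)
  qed
  also have "(\<Sum>s<n. \<Sum>t<n. \<Sum>u<n. \<Sum>v<n. ?c s t u v * (?\<delta> s u * ?\<delta> t v)) = (\<Sum>t<n. a t * b t)^2"
  proof -
    have "(\<Sum>v<n. ?c s t u v * (?\<delta> s u * ?\<delta> t v)) = a s * a t * b u * ?\<delta> s u * b t" if "t < n" for s t u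
    proof -
      have "(\<Sum>v<n. ?c s t u v * (?\<delta> s u * ?\<delta> t v)) = (\<Sum>v<n. if t = v then a s * a t * b u * ?\<delta> s u * b v else 0)"
        by (intro sum.cong refl) simp
      then show ?thesis using that by simp
    qed
    then have "(\<Sum>s<n. \<Sum>t<n. \<Sum>u<n. \<Sum>v<n. ?c s t u v * (?\<delta> s u * ?\<delta> t v))
       = (\<Sum>s<n. \<Sum>t<n. \<Sum>u<n. if s = u then a s * a t * b u * b t else 0)"
      by (intro sum.cong refl) auto
    also have "\<dots> = (\<Sum>s<n. \<Sum>t<n. (a s * b s) * (a t * b t))"
      by (intro sum.cong refl) (simp add: mult_ac)
    finally show ?thesis by (simp add: power2_eq_square sum_product)
  qed
  also have "(\<Sum>s<n. \<Sum>t<n. \<Sum>u<n. \<Sum>v<n. ?c s t u v * (?\<delta> s v * ?\<delta> t u)) = (\<Sum>t<n. a t * b t)^2"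
  proof -
    have "(\<Sum>v<n. ?c s t u v * (?\<delta> s v * ?\<delta> t u)) = a s * a t * b u * ?\<delta> t u * b s" if "s < n" for s t u
    proof -
      have "(\<Sum>v<n. ?c s t u v * (?\<delta> s v * ?\<delta> t u)) = (\<Sum>v<n. if s = v then a s * a t * b u * ?\<delta> t u * b v else 0)"
        by (intro sum.cong refl) simp
      then show ?thesis using that by simp
    qed
    then have "(\<Sum>s<n. \<Sum>t<n. \<Sum>u<n. \<Sum>v<n. ?c s t u v * (?\<delta> s v * ?\<delta> t u))
       = (\<Sum>s<n. \<Sum>t<n. \<Sum>u<n. if t = u then a s * a t * b u * b s else 0)"
      by (intro sum.cong refl) auto
    also have "\<dots> = (\<Sum>s<n. \<Sum>t<n. (a s * b s) * (a t * b t))"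
      by (intro sum.cong refl) (simp add: mult_ac)
    finally show ?thesis by (simp add: power2_eq_square sum_product)
  qed
  also have "(\<Sum>s<n. \<Sum>t<n. \<Sum>u<n. \<Sum>v<n. ?c s t u v * (?\<delta> s t * ?\<delta> t u * ?\<delta> u v))
     = (\<Sum>t<n. (a t)^2 * (b t)^2)"
  proof -
    have "(\<Sum>v<n. ?c s t u v * (?\<delta> s t * ?\<delta> t u * ?\<delta> u v)) =
       (if t = u then if s = t then a s * a s * (b s * b s) else 0 else 0)" if "u < n" for s t u
    proof -
      have "(\<Sum>v<n. ?c s t u v * (?\<delta> s t * ?\<delta> t u * ?\<delta> u v)) =
         (\<Sum>v<n. if u = v then a s * a t * (b u * b v) * ?\<delta> s t * ?\<delta> t u else 0)"
        by (intro sum.cong refl) simp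
      then show ?thesis using that by simp
    qed
    then have "(\<Sum>s<n. \<Sum>t<n. \<Sum>u<n. \<Sum>v<n. ?c s t u v * (?\<delta> s t * ?\<delta> t u * ?\<delta> u v)) =
       (\<Sum>s<n. \<Sum>t<n. \<Sum>u<n. if t = u then if s = t then a s * a s * (b s * b s) else 0 else 0)"
      by (intro sum.cong refl) auto
    then show ?thesis by (simp add: power2_eq_square)
  qed
  finally show ?thesis by (simp add: algebra_simps)
qed

end

section \<open>The squared-overlap kernel\<close>

definition overlap :: "nat \<Rightarrow> (nat \<Rightarrow> real) \<Rightarrow> (nat \<Rightarrow> real) \<Rightarrow> real" where
  "overlap n x y = (\<Sum>t<n. direction n x t * direction n y t)"

definition weight_overlap :: "nat \<Rightarrow> (nat \<Rightarrow> real) \<Rightarrow> (nat \<Rightarrow> real) \<Rightarrow> real" where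
  "weight_overlap n x y = (\<Sum>t<n. (direction n x t)\<^sup>2 * (direction n y t)\<^sup>2)"

text \<open>
  The factor \<open>row_mass n x * row_mass n y\<close> is 1 almost surely. With it the kernel is
  degenerate at every point, also at the zero row.
\<close>

definition corr_kernel :: "nat \<Rightarrow> (nat \<Rightarrow> real) \<Rightarrow> (nat \<Rightarrow> real) \<Rightarrow> real" where
  "corr_kernel n x y = (overlap n x y)\<^sup>2 - row_mass n x * row_mass n y / n"

lemma overlap_sq_le: "(overlap n x y)^2 \<le> row_mass n x * row_mass n y"
  unfolding overlap_def row_mass_def by (rule Cauchy_Schwarz_ineq_sum)

lemma mass_prod_bounds: "0 \<le> row_mass n x * row_mass n y" "row_mass n x * row_mass n y \<le> 1"
  using row_mass_bounds by (auto intro: mult_le_one)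

lemma overlap_sq_le_1: "(overlap n x y)^2 \<le> 1"
  using overlap_sq_le mass_prod_bounds(2) order_trans by blast

lemma weight_overlap_bounds: "0 \<le> weight_overlap n x y" "weight_overlap n x y \<le> 1"
proof -
  show "0 \<le> weight_overlap n x y" unfolding weight_overlap_def by (intro sum_nonneg) auto
  have "weight_overlap n x y \<le> (\<Sum>t<n. (direction n x t)^2 * 1)"
    unfolding weight_overlap_def by (intro sum_mono mult_left_mono) (auto simp: direction_sq_le)
  also have "\<dots> \<le> 1" using row_mass_bounds(2)[of n x] by (simp add: row_mass_def)
  finally show "weight_overlap n x y \<le> 1" .
qed

lemma corr_kernel_sym: "corr_kernel n x y = corr_kernel n y x"
  by (simp add: corr_kernel_def overlap_def mult.commute)

lemma corr_kernel_bound: "\<bar>corr_kernel n x y\<bar> \<le> 1"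
proof -
  have "0 \<le> row_mass n x * row_mass n y / n" using mass_prod_bounds by simp
  moreover have "row_mass n x * row_mass n y / n \<le> 1"
    using mass_prod_bounds[of n x y] by (cases n) (auto simp: field_simps intro: order_trans)
  ultimately show ?thesis
    using overlap_sq_le_1[of n x y] zero_le_power2[of "overlap n x y"] unfolding corr_kernel_def by linarith
qed

lemma overlap_self: "overlap n x x = row_mass n x"
  by (simp add: overlap_def row_mass_def power2_eq_square)

context symmetric_entries
begin

lemma n_pos: "real n > 0" "real n \<ge> 2" using two_le_n by auto

lemma bm_overlap [bm_intros]: "bounded_measurable row_law (overlap n x)"
  unfolding overlap_def by (intro bm_intros) auto

lemma bm_weight_overlap [bm_intros]: "bounded_measurable row_law (weight_overlap n x)"
  unfolding weight_overlap_def by (intro bm_intros) auto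

lemma bm_corr_kernel [bm_intros]: "bounded_measurable row_law (corr_kernel n x)"
  unfolding corr_kernel_def by (intro bm_intros)

lemma bm_weight_overlap_self [bm_intros]: "bounded_measurable row_law (\<lambda>x. weight_overlap n x x)"
  unfolding weight_overlap_def by (intro bm_intros) auto

lemma integral_mass_1: "(\<integral>x. mass x \<partial>row_law) = 1"
  using integral_mass[of "\<lambda>_. 1"] by (simp add: row.prob_space)

lemma integral_overlap_sq: "(\<integral>y. (overlap n x y)^2 \<partial>row_law) = mass x / n"
  unfolding overlap_def integral_quadratic_form row_mass_def ..

sublocale K: degenerate_kernel row_law "corr_kernel n"
proof unfold_locales
  have "(\<lambda>z. direction n (fst z) t) \<in> borel_measurable (row_law \<Otimes>\<^sub>M row_law)"
    "(\<lambda>z. direction n (snd z) t) \<in> borel_measurable (row_law \<Otimes>\<^sub>M row_law)" if "t < n" for t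
    using that by (auto intro: measurable_compose[OF measurable_fst] measurable_compose[OF measurable_snd])
  then show "(\<lambda>(x, y). corr_kernel n x y) \<in> borel_measurable (row_law \<Otimes>\<^sub>M row_law)"
    unfolding corr_kernel_def overlap_def row_mass_def split_beta'
    by (intro borel_measurable_diff borel_measurable_power borel_measurable_sum borel_measurable_times
        borel_measurable_divide borel_measurable_const) auto
  show "corr_kernel n x y = corr_kernel n y x" for x y by (rule corr_kernel_sym)
  show "\<bar>corr_kernel n x y\<bar> \<le> 1" for x y by (rule corr_kernel_bound)
  show "(\<integral>y. corr_kernel n x y \<partial>row_law) = 0" for x
  proof -
    have "(\<integral>y. corr_kernel n x y \<partial>row_law) =
      (\<integral>y. (overlap n x y)^2 \<partial>row_law) - (\<integral>y. mass x * mass y / n \<partial>row_law)"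
      unfolding corr_kernel_def by (intro Bochner_Integration.integral_diff bm_row_integrable bm_intros)
    then show ?thesis by (simp add: integral_overlap_sq integral_mass_1)
  qed
qed

text \<open>
  Expanding the product of two kernels leaves one biquadratic form in the direction that is integrated
  out; the other terms are second moments.
\<close>

lemma kernel_comp_eq:
  "K.kernel_comp x z = m22 * (mass x * mass z + 2 * (overlap n x z)^2)
     + (m4 - 3 * m22) * weight_overlap n x z - mass x * mass z / n^2"
proof -
  have i: "integrable row_law (\<lambda>y. (overlap n x y)^2 * (overlap n z y)^2)"
    "integrable row_law (\<lambda>y. mass z / n * (mass y * (overlap n x y)^2))"
    "integrable row_law (\<lambda>y. mass x / n * (mass y * (overlap n z y)^2))"
    "integrable row_law (\<lambda>y. mass x * mass z / n^2 * (mass y * mass y))"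
    by (intro bm_row_integrable bm_intros)+
  have mm: "(\<integral>y. mass y * mass y \<partial>row_law) = 1"
    using integral_mass[of mass] bm_measurable[OF bm_mass] integral_mass_1 by simp
  have mo: "(\<integral>y. mass y * (overlap n x y)^2 \<partial>row_law) = mass x / n" for x
    using integral_mass[of "\<lambda>y. (overlap n x y)^2"] integral_overlap_sq
    by (simp add: bm_measurable bm_intros)
  have "K.kernel_comp x z = (\<integral>y. (overlap n x y)^2 * (overlap n z y)^2
      - mass z / n * (mass y * (overlap n x y)^2) - mass x / n * (mass y * (overlap n z y)^2)
      + mass x * mass z / n^2 * (mass y * mass y) \<partial>row_law)"
    unfolding K.kernel_comp_def corr_kernel_def
    by (rule Bochner_Integration.integral_cong) (auto simp: algebra_simps power2_eq_square)
  also have "\<dots> = (\<integral>y. (overlap n x y)^2 * (overlap n z y)^2 \<partial>row_law)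
      - mass z / n * (mass x / n) - mass x / n * (mass z / n) + mass x * mass z / n^2"
    using i by (simp add: mm mo)
  also have "(\<integral>y. (overlap n x y)^2 * (overlap n z y)^2 \<partial>row_law) =
     m22 * (mass x * mass z + 2 * (overlap n x z)^2) + (m4 - 3 * m22) * weight_overlap n x z"
    unfolding overlap_def integral_biquadratic_form row_mass_def weight_overlap_def ..
  finally show ?thesis by (simp add: power2_eq_square)
qed

lemma row_m2_eq:
  "K.row_m2 x = 3 * m22 * mass x + (m4 - 3 * m22) * weight_overlap n x x - mass x / n^2"
proof -
  have "K.row_m2 x = K.kernel_comp x x" by (simp add: K.row_m2_def K.kernel_comp_def power2_eq_square)
  moreover have "mass x * mass x = mass x" using row_mass_sq[of n x] by (simp add: power2_eq_square)
  ultimately show ?thesis by (simp add: kernel_comp_eq overlap_self power2_eq_square algebra_simps)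
qed

lemma integral_weight_overlap_self: "(\<integral>x. weight_overlap n x x \<partial>row_law) = n * m4"
proof -
  have "(\<integral>x. weight_overlap n x x \<partial>row_law) = (\<integral>x. (\<Sum>t<n. (dir x t)^4) \<partial>row_law)"
    by (simp add: weight_overlap_def flip: power_add)
  also have "\<dots> = (\<Sum>t<n. \<integral>x. (dir x t)^4 \<partial>row_law)"
    by (intro Bochner_Integration.integral_sum bm_row_integrable bm_intros) auto
  also have "\<dots> = (\<Sum>t<n. m4)"
    unfolding m4_def by (intro sum.cong refl integral_dir_single) auto
  finally show ?thesis by simp
qed

lemma m4_nonneg: "m4 \<ge> 0" and m22_nonneg: "m22 \<ge> 0"
  unfolding m4_def m22_def by (auto intro!: Bochner_Integration.integral_nonneg)

lemma kernel_m2_eq: "K.kernel_m2 = n * m4^2 + 3 * n * (real n - 1) * m22^2 - 1 / n^2"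
proof -
  have "K.kernel_m2 = (\<integral>x. K.row_m2 x \<partial>row_law)" by (simp add: K.kernel_m2_def K.row_m2_def)
  also have "\<dots> = (\<integral>x. 3 * m22 * mass x \<partial>row_law) + (\<integral>x. (m4 - 3 * m22) * weight_overlap n x x \<partial>row_law)
      - (\<integral>x. mass x / n^2 \<partial>row_law)"
    unfolding row_m2_eq
    by (subst Bochner_Integration.integral_diff Bochner_Integration.integral_add,
        (intro bm_row_integrable bm_intros)+)+ simp
  also have "\<dots> = 3 * m22 + (m4 - 3 * m22) * (n * m4) - 1 / n^2"
    by (simp add: integral_mass_1 integral_weight_overlap_self)
  also have "\<dots> = n * m4^2 + 3 * m22 * (1 - n * m4) - 1 / n^2"
    by (simp add: algebra_simps power2_eq_square)
  also have "1 - n * m4 = n * (real n - 1) * m22"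
    using moment_relation by linarith
  finally show ?thesis by (simp add: algebra_simps power2_eq_square)
qed

definition centered_overlap :: "(nat \<Rightarrow> real) \<Rightarrow> (nat \<Rightarrow> real) \<Rightarrow> real" where
  "centered_overlap x z = weight_overlap n x z - mass x * mass z / n"

lemma bm_centered_overlap [bm_intros]: "bounded_measurable row_law (centered_overlap x)"
  unfolding centered_overlap_def by (intro bm_intros)

text \<open>
  By \<open>moment_relation\<close> the constants in \<open>kernel_comp_eq\<close> combine into the centring of both terms. The
  composed kernel is thus small in \<open>L\<^sup>2\<close>, relative to the kernel itself.
\<close>

lemma kernel_comp_decomp:
  "K.kernel_comp x z = (m4 - 3 * m22) * centered_overlap x z + 2 * m22 * corr_kernel n x z"
proof -
  have z: "m22 - 1 / n^2 + (m4 - 3 * m22) / n + 2 * m22 / n = 0"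
  proof -
    have "real n * (real n * m4 + real n * (real n - 1) * m22) = real n * 1" by (simp only: moment_relation)
    then show ?thesis using n_pos by (simp add: field_simps power2_eq_square)
  qed
  have "K.kernel_comp x z = (m4 - 3 * m22) * centered_overlap x z + 2 * m22 * corr_kernel n x z
     + (m22 - 1 / n^2 + (m4 - 3 * m22) / n + 2 * m22 / n) * (mass x * mass z)"
    unfolding kernel_comp_eq centered_overlap_def corr_kernel_def
    by (simp add: algebra_simps add_divide_distrib diff_divide_distrib)
  then show ?thesis unfolding z by simp
qed

lemma integral_weight_overlap: "(\<integral>z. weight_overlap n x z \<partial>row_law) = mass x / n"
proof -
  have "(\<integral>z. weight_overlap n x z \<partial>row_law) = (\<Sum>t<n. \<integral>z. (dir x t)^2 * (dir z t)^2 \<partial>row_law)"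
    unfolding weight_overlap_def by (intro Bochner_Integration.integral_sum bm_row_integrable bm_intros) auto
  also have "\<dots> = (\<Sum>t<n. (dir x t)^2 * (1 / n))"
    by (intro sum.cong refl) (simp add: integral_dir_sq)
  finally show ?thesis by (simp add: row_mass_def sum_divide_distrib)
qed

lemma integral_weight_overlap_sq:
  "(\<integral>z. (weight_overlap n x z)^2 \<partial>row_law) = m22 * mass x + (m4 - m22) * weight_overlap n x x"
proof -
  let ?w = "\<lambda>x t. (dir x t)^2"
  have M: "(\<integral>z. ?w z s * ?w z t \<partial>row_law) = m22 + (if s = t then m4 - m22 else 0)" if "s < n" "t < n" for s t
    using that integral_dir_pair[of s t] integral_dir_single[of s 4]
    by (auto simp: m4_def simp flip: power_add)
  have "(\<integral>z. (weight_overlap n x z)^2 \<partial>row_law) =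
     (\<integral>z. (\<Sum>s<n. \<Sum>t<n. (?w x s * ?w x t) * (?w z s * ?w z t)) \<partial>row_law)"
    unfolding weight_overlap_def power2_eq_square[of "sum _ _"] sum_product by (simp only: mult_ac)
  also have "\<dots> = (\<Sum>s<n. \<Sum>t<n. \<integral>z. (?w x s * ?w x t) * (?w z s * ?w z t) \<partial>row_law)"
    by (subst Bochner_Integration.integral_sum, (intro bm_row_integrable bm_intros; simp), intro sum.cong refl)+
  also have "\<dots> = (\<Sum>s<n. \<Sum>t<n. (?w x s * ?w x t) * (m22 + (if s = t then m4 - m22 else 0)))"
    by (intro sum.cong refl) (simp add: M)
  also have "\<dots> = (\<Sum>s<n. \<Sum>t<n. m22 * (?w x s * ?w x t)) + (\<Sum>s<n. \<Sum>t<n. if s = t then (m4 - m22) * (?w x s * ?w x t) else 0)"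
    unfolding sum.distrib[symmetric] by (intro sum.cong refl) (simp add: algebra_simps)
  also have "(\<Sum>s<n. \<Sum>t<n. m22 * (?w x s * ?w x t)) = m22 * (mass x)^2"
  proof -
    have "(mass x)^2 = (\<Sum>s<n. \<Sum>t<n. ?w x s * ?w x t)"
      unfolding row_mass_def power2_eq_square[of "sum _ _"] sum_product ..
    then show ?thesis by (simp only: sum_distrib_left)
  qed
  also have "(\<Sum>s<n. \<Sum>t<n. if s = t then (m4 - m22) * (?w x s * ?w x t) else 0) = (m4 - m22) * weight_overlap n x x"
    by (simp add: weight_overlap_def sum_distrib_left flip: power_add)
  finally show ?thesis by (simp add: row_mass_sq)
qed

text \<open>Almost surely the mean of \<open>weight_overlap n x z\<close> given \<open>x\<close> is \<open>1 / n\<close>, so this is a variance.\<close>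

definition overlap_var :: real where
  "overlap_var = (\<integral>x. \<integral>z. (centered_overlap x z)^2 \<partial>row_law \<partial>row_law)"

lemma centered_overlap_row:
  "(\<integral>z. (centered_overlap x z)^2 \<partial>row_law) = m22 * mass x + (m4 - m22) * weight_overlap n x x - mass x / n^2"
proof -
  have mx: "mass x * mass x = mass x" "mass x * (mass x * c) = mass x * c" for x c
    using row_mass_sq[of n x] by (simp_all add: power2_eq_square flip: mult.assoc)
  have mw: "(\<integral>z. mass z * weight_overlap n x z \<partial>row_law) = mass x / n"
    using integral_mass[of "weight_overlap n x"] integral_weight_overlap
    by (simp add: bm_measurable bm_intros)
  have i: "integrable row_law (\<lambda>z. (weight_overlap n x z)^2)"
    "integrable row_law (\<lambda>z. 2 * mass x / n * (mass z * weight_overlap n x z))"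
    "integrable row_law (\<lambda>z. mass x / n^2 * mass z)"
    by (intro bm_row_integrable bm_intros)+
  have "(\<integral>z. (centered_overlap x z)^2 \<partial>row_law) =
    (\<integral>z. (weight_overlap n x z)^2 - 2 * mass x / n * (mass z * weight_overlap n x z)
       + mass x / n^2 * mass z \<partial>row_law)"
    unfolding centered_overlap_def
    by (rule Bochner_Integration.integral_cong) (auto simp: power2_diff power_mult_distrib power_divide row_mass_sq)
  also have "\<dots> = (m22 * mass x + (m4 - m22) * weight_overlap n x x) - 2 * mass x / n * (mass x / n) + mass x / n^2"
    using i by (simp add: integral_weight_overlap_sq mw integral_mass_1)
  also have "2 * mass x / n * (mass x / n) = 2 * mass x / n^2"
    by (simp add: power2_eq_square mult.assoc mx)
  finally show ?thesis by simp
qed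

lemma overlap_var_eq: "overlap_var = n * m4^2 + n * (real n - 1) * m22^2 - 1 / n^2"
proof -
  have "overlap_var = (\<integral>x. m22 * mass x \<partial>row_law) + (\<integral>x. (m4 - m22) * weight_overlap n x x \<partial>row_law)
      - (\<integral>x. mass x / n^2 \<partial>row_law)"
    unfolding overlap_var_def centered_overlap_row
    by (subst Bochner_Integration.integral_diff Bochner_Integration.integral_add,
        (intro bm_row_integrable bm_intros)+)+ simp
  also have "\<dots> = m22 + (m4 - m22) * (n * m4) - 1 / n^2"
    by (simp add: integral_mass_1 integral_weight_overlap_self)
  also have "\<dots> = n * m4^2 + m22 * (1 - n * m4) - 1 / n^2"
    by (simp add: algebra_simps power2_eq_square)
  also have "1 - n * m4 = n * (real n - 1) * m22"
    using moment_relation by linarith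
  finally show ?thesis by (simp add: algebra_simps power2_eq_square)
qed

lemma overlap_var_le: "overlap_var \<le> K.kernel_m2"
  using n_pos mult_nonneg_nonneg[of "real n * (real n - 1)" "m22^2"]
  by (simp add: overlap_var_eq kernel_m2_eq mult.assoc)

lemma cycle_m4_le: "K.cycle_m4 \<le> (2 * (m4 - 3 * m22)^2 + 8 * m22^2) * K.kernel_m2"
proof -
  let ?c = "m4 - 3 * m22"
  have pw: "(K.kernel_comp x z)^2 \<le> 2 * ?c^2 * (centered_overlap x z)^2 + 8 * m22^2 * (corr_kernel n x z)^2" for x z
  proof -
    have "(a + b)^2 \<le> 2 * a^2 + 2 * b^2" for a b :: real
      using sum_squares_bound[of a b] by (simp add: power2_sum)
    from this[of "?c * centered_overlap x z" "2 * m22 * corr_kernel n x z"]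
    show ?thesis by (simp add: kernel_comp_decomp power_mult_distrib)
  qed
  have inner: "(\<integral>z. (K.kernel_comp x z)^2 \<partial>row_law) \<le>
     2 * ?c^2 * (\<integral>z. (centered_overlap x z)^2 \<partial>row_law) + 8 * m22^2 * K.row_m2 x" for x
  proof -
    have i: "integrable row_law (\<lambda>z. (centered_overlap x z)^2)" "integrable row_law (\<lambda>z. (corr_kernel n x z)^2)"
      by (intro bm_row_integrable bm_intros)+
    have "(\<integral>z. (K.kernel_comp x z)^2 \<partial>row_law) \<le>
      (\<integral>z. 2 * ?c^2 * (centered_overlap x z)^2 + 8 * m22^2 * (corr_kernel n x z)^2 \<partial>row_law)"
      by (rule integral_mono') (use pw i in auto)
    then show ?thesis using i by (simp add: K.row_m2_def)
  qed
  have bm1: "integrable row_law (\<lambda>x. \<integral>z. (centered_overlap x z)^2 \<partial>row_law)" "integrable row_law K.row_m2"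
    unfolding centered_overlap_row row_m2_eq[abs_def] by (intro bm_row_integrable bm_intros)+
  have "K.cycle_m4 \<le> (\<integral>x. 2 * ?c^2 * (\<integral>z. (centered_overlap x z)^2 \<partial>row_law) + 8 * m22^2 * K.row_m2 x \<partial>row_law)"
    unfolding K.cycle_m4_def
    by (rule integral_mono')
       (use inner bm1 K.row_m2_bounds in \<open>auto intro!: add_nonneg_nonneg mult_nonneg_nonneg Bochner_Integration.integral_nonneg\<close>)
  also have "\<dots> = 2 * ?c^2 * overlap_var + 8 * m22^2 * K.kernel_m2"
  proof -
    have "K.kernel_m2 = (\<integral>x. K.row_m2 x \<partial>row_law)" by (simp add: K.kernel_m2_def K.row_m2_def)
    then show ?thesis using bm1 by (simp add: overlap_var_def)
  qed
  also have "\<dots> \<le> 2 * ?c^2 * K.kernel_m2 + 8 * m22^2 * K.kernel_m2"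
    using overlap_var_le by (intro add_mono mult_left_mono) auto
  finally show ?thesis by (simp add: algebra_simps)
qed

lemma wedge_m4_le: "K.wedge_m4 \<le> 2 * n * m4^3 + 18 * m22^2"
proof -
  have pw: "(K.row_m2 x)^2 \<le> 2 * m4^2 * weight_overlap n x x + 18 * m22^2" if "x \<in> space row_law" for x
  proof -
    let ?q = "weight_overlap n x x"
    have q: "0 \<le> ?q" "?q \<le> 1" using weight_overlap_bounds by auto
    have "0 \<le> m22 * ?q" "m22 * mass x \<le> m22" "0 \<le> mass x / n^2"
      using q m22_nonneg row_mass_bounds[of n x] by (auto intro: mult_left_le)
    then have "K.row_m2 x \<le> m4 * ?q + 3 * m22" by (simp add: row_m2_eq algebra_simps)
    then have "(K.row_m2 x)^2 \<le> (m4 * ?q + 3 * m22)^2"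
      using K.row_m2_bounds[OF that] by (intro power_mono) auto
    also have "\<dots> \<le> 2 * (m4 * ?q)^2 + 2 * (3 * m22)^2"
      using sum_squares_bound[of "m4 * ?q" "3 * m22"] by (simp add: power2_sum)
    also have "(m4 * ?q)^2 \<le> m4^2 * ?q"
    proof -
      have "?q^2 \<le> ?q" using q by (simp add: power2_eq_square mult_left_le)
      then show ?thesis by (simp add: power_mult_distrib mult_left_mono)
    qed
    finally show ?thesis by (simp add: power_mult_distrib)
  qed
  have "integrable row_law (\<lambda>x. weight_overlap n x x)" by (intro bm_row_integrable bm_intros)
  then have "K.wedge_m4 \<le> (\<integral>x. 2 * m4^2 * weight_overlap n x x + 18 * m22^2 \<partial>row_law)"
    unfolding K.wedge_m4_def
    by (intro integral_mono') (use pw weight_overlap_bounds in auto)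
  also have "\<dots> = 2 * n * m4^3 + 18 * m22^2"
    using \<open>integrable row_law (\<lambda>x. weight_overlap n x x)\<close>
    by (simp add: integral_weight_overlap_self row.prob_space power3_eq_cube power2_eq_square)
  finally show ?thesis .
qed

lemma kernel_m4_le_m2: "K.kernel_m4 \<le> K.kernel_m2"
proof -
  have i: "integrable row_law (\<lambda>z. (corr_kernel n x z)^2)" for x
    by (intro bm_row_integrable bm_intros)
  have pw: "(corr_kernel n x z)^4 \<le> (corr_kernel n x z)^2" for x z
  proof -
    have "\<bar>corr_kernel n x z\<bar>^4 \<le> \<bar>corr_kernel n x z\<bar>^2"
      by (rule power_decreasing) (auto simp: corr_kernel_bound)
    then show ?thesis by simp
  qed
  have "(\<integral>z. (corr_kernel n x z)^4 \<partial>row_law) \<le> K.row_m2 x" for x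
    unfolding K.row_m2_def by (rule integral_mono'[OF i]) (use pw in auto)
  moreover have "integrable row_law K.row_m2"
    unfolding row_m2_eq[abs_def] by (intro bm_row_integrable bm_intros)
  ultimately have "K.kernel_m4 \<le> (\<integral>x. K.row_m2 x \<partial>row_law)"
    unfolding K.kernel_m4_def using K.row_m2_bounds by (intro integral_mono') auto
  then show ?thesis by (simp add: K.kernel_m2_def K.row_m2_def)
qed

end

section \<open>A Khintchine inequality for the sixth moment\<close>

context symmetric_entries
begin

text \<open>
  Weights that ignore the signs of the entries. Carrying such a weight through the induction below
  replaces conditioning on the absolute values.
\<close>

definition sign_even :: "((nat \<Rightarrow> real) \<Rightarrow> real) \<Rightarrow> bool" where
  "sign_even G \<longleftrightarrow> bounded_measurable row_law G \<and> (\<forall>x. 0 \<le> G x) \<and> (\<forall>s<n. \<forall>x. G (x(s := - x s)) = G x)"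

definition part_sum :: "(nat \<Rightarrow> real) \<Rightarrow> nat \<Rightarrow> (nat \<Rightarrow> real) \<Rightarrow> real" where
  "part_sum a k x = (\<Sum>t<k. a t * dir x t)"

definition part_sq :: "(nat \<Rightarrow> real) \<Rightarrow> nat \<Rightarrow> (nat \<Rightarrow> real) \<Rightarrow> real" where
  "part_sq a k x = (\<Sum>t<k. (a t * dir x t)^2)"

lemma bm_part_sum: "k \<le> n \<Longrightarrow> bounded_measurable row_law (part_sum a k)"
  unfolding part_sum_def[abs_def] by (intro bm_intros) auto

lemma bm_part_sq: "k \<le> n \<Longrightarrow> bounded_measurable row_law (part_sq a k)"
  unfolding part_sq_def[abs_def] by (intro bm_intros) auto

lemma bm_sign_even: "sign_even G \<Longrightarrow> bounded_measurable row_law G"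
  by (simp add: sign_even_def)

lemma sign_even_weight:
  assumes "sign_even G" "k < n"
  shows "sign_even (\<lambda>x. (a k * dir x k)^(2 * m) * G x)"
proof -
  have "(a k * dir (x(s := - x s)) k)^(2 * m) = (a k * dir x k)^(2 * m)" if "s < n" for x s
    using that by (auto simp: direction_flip power_mult)
  then show ?thesis using assms unfolding sign_even_def
    by (auto intro!: bm_intros)
qed

text \<open>
  Flipping the sign of coordinate \<open>k\<close> fixes the partial sum and the weight, so the last summand
  may be averaged over both signs; its odd powers disappear.
\<close>

lemma part_sum_flip_step:
  assumes G: "sign_even G" and k: "k < n"
  shows "(\<integral>x. (part_sum a (Suc k) x)^m * G x \<partial>row_law) =
    (\<integral>x. ((part_sum a k x + a k * dir x k)^m + (part_sum a k x - a k * dir x k)^m) / 2 * G x \<partial>row_law)"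
proof -
  let ?f = "\<lambda>x. (part_sum a k x + a k * dir x k)^m * G x"
  let ?g = "\<lambda>x. (part_sum a k x - a k * dir x k)^m * G x"
  have b: "bounded_measurable row_law ?f" "bounded_measurable row_law ?g"
    using k G bm_part_sum[of k a] bm_sign_even[OF G] by (auto intro!: bm_intros)
  have fl: "?f (x(k := - x k)) = ?g x" for x
  proof -
    have "part_sum a k (x(k := - x k)) = part_sum a k x"
      unfolding part_sum_def using k by (intro sum.cong refl) (auto simp: direction_flip)
    then show ?thesis using G k by (simp add: direction_flip sign_even_def)
  qed
  have "(\<integral>x. ?g x \<partial>row_law) = (\<integral>x. ?f x \<partial>row_law)"
    using integral_flip[OF k bm_measurable[OF b(1)]] unfolding fl .
  then have "(\<integral>x. ?f x \<partial>row_law) = (\<integral>x. (?f x + ?g x) / 2 \<partial>row_law)"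
    using b[THEN bm_row_integrable] by simp
  then show ?thesis by (simp add: part_sum_def algebra_simps)
qed

lemma khintchine_2:
  assumes "sign_even G" "k \<le> n"
  shows "(\<integral>x. (part_sum a k x)^2 * G x \<partial>row_law) = (\<integral>x. part_sq a k x * G x \<partial>row_law)"
  using assms
proof (induction k)
  case (Suc k)
  let ?b = "\<lambda>x. a k * dir x k"
  have k: "k < n" "k \<le> n" using Suc.prems by auto
  have i: "integrable row_law (\<lambda>x. (part_sum a k x)^2 * G x)" "integrable row_law (\<lambda>x. (?b x)^2 * G x)"
    "integrable row_law (\<lambda>x. part_sq a k x * G x)"
    using k bm_part_sum[of k a] bm_part_sq[of k a] bm_sign_even[OF Suc.prems(1)] by (auto intro!: bm_row_integrable bm_intros)
  have "(\<integral>x. (part_sum a (Suc k) x)^2 * G x \<partial>row_law) = (\<integral>x. (part_sum a k x)^2 * G x + (?b x)^2 * G x \<partial>row_law)"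
    unfolding part_sum_flip_step[OF Suc.prems(1) k(1)]
    by (rule Bochner_Integration.integral_cong) (auto simp: power2_sum power2_diff algebra_simps)
  also have "\<dots> = (\<integral>x. part_sq a k x * G x + (?b x)^2 * G x \<partial>row_law)"
    using i Suc by simp
  finally show ?case by (simp add: part_sq_def algebra_simps)
qed (simp add: part_sum_def part_sq_def)

lemma khintchine_4:
  assumes "sign_even G" "k \<le> n"
  shows "(\<integral>x. (part_sum a k x)^4 * G x \<partial>row_law) \<le> 3 * (\<integral>x. (part_sq a k x)^2 * G x \<partial>row_law)"
  using assms
proof (induction k)
  case (Suc k)
  let ?b = "\<lambda>x. a k * dir x k" and ?Z = "part_sum a k" and ?s = "part_sq a k"
  have k: "k < n" "k \<le> n" using Suc.prems by auto
  note bms = bm_part_sum[OF k(2), of a] bm_part_sq[OF k(2), of a] bm_sign_even[OF Suc.prems(1)] bm_dir[OF k(1)]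
  have i: "integrable row_law (\<lambda>x. (?Z x)^4 * G x)" "integrable row_law (\<lambda>x. (?Z x)^2 * ((?b x)^2 * G x))"
    "integrable row_law (\<lambda>x. (?b x)^4 * G x)"
    "integrable row_law (\<lambda>x. (?s x)^2 * G x)" "integrable row_law (\<lambda>x. ?s x * ((?b x)^2 * G x))"
    using bms by (auto intro!: bm_row_integrable bm_intros)
  have G0: "0 \<le> G x" for x using Suc.prems by (simp add: sign_even_def)
  have "(\<integral>x. (part_sum a (Suc k) x)^4 * G x \<partial>row_law) =
      (\<integral>x. (?Z x)^4 * G x + 6 * ((?Z x)^2 * ((?b x)^2 * G x)) + (?b x)^4 * G x \<partial>row_law)"
    unfolding part_sum_flip_step[OF Suc.prems(1) k(1)]
    by (rule Bochner_Integration.integral_cong) (auto simp: eval_nat_numeral field_simps)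
  also have "\<dots> = (\<integral>x. (?Z x)^4 * G x \<partial>row_law) + 6 * (\<integral>x. (?Z x)^2 * ((?b x)^2 * G x) \<partial>row_law)
      + (\<integral>x. (?b x)^4 * G x \<partial>row_law)"
    using i by simp
  also have "\<dots> \<le> 3 * (\<integral>x. (?s x)^2 * G x \<partial>row_law) + 6 * (\<integral>x. ?s x * ((?b x)^2 * G x) \<partial>row_law)
      + 3 * (\<integral>x. (?b x)^4 * G x \<partial>row_law)"
    using Suc.IH[OF Suc.prems(1) k(2)] khintchine_2[OF sign_even_weight[OF Suc.prems(1) k(1), of a 1] k(2), of a]
    by (intro add_mono) (auto intro!: Bochner_Integration.integral_nonneg mult_nonneg_nonneg G0)
  also have "\<dots> = 3 * (\<integral>x. (?s x)^2 * G x + 2 * (?s x * ((?b x)^2 * G x)) + (?b x)^4 * G x \<partial>row_law)"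
    using i by simp
  also have "\<dots> = 3 * (\<integral>x. (part_sq a (Suc k) x)^2 * G x \<partial>row_law)"
    by (intro arg_cong[where f="\<lambda>z. 3 * z"] Bochner_Integration.integral_cong)
       (auto simp: part_sq_def eval_nat_numeral algebra_simps)
  finally show ?case .
qed (simp add: part_sum_def part_sq_def)

text \<open>
  The constant 15 is the sixth moment of a standard Gaussian variable. The induction step
  compares \<open>u\<^sup>6 + 15 u\<^sup>4 v\<^sup>2 + 15 u\<^sup>2 v\<^sup>4 + v\<^sup>6\<close> with \<open>15 (s + v\<^sup>2)\<^sup>3\<close>, using the inequalities for the
  lower even powers with the weights \<open>v\<^sup>2\<close> and \<open>v\<^sup>4\<close>.
\<close>

lemma khintchine_6:
  assumes "sign_even G" "k \<le> n"
  shows "(\<integral>x. (part_sum a k x)^6 * G x \<partial>row_law) \<le> 15 * (\<integral>x. (part_sq a k x)^3 * G x \<partial>row_law)"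
  using assms
proof (induction k)
  case (Suc k)
  let ?b = "\<lambda>x. a k * dir x k" and ?Z = "part_sum a k" and ?s = "part_sq a k"
  have k: "k < n" "k \<le> n" using Suc.prems by auto
  note bms = bm_part_sum[OF k(2), of a] bm_part_sq[OF k(2), of a] bm_sign_even[OF Suc.prems(1)] bm_dir[OF k(1)]
  have i: "integrable row_law (\<lambda>x. (?Z x)^6 * G x)" "integrable row_law (\<lambda>x. (?Z x)^4 * ((?b x)^2 * G x))"
    "integrable row_law (\<lambda>x. (?Z x)^2 * ((?b x)^4 * G x))"
    "integrable row_law (\<lambda>x. (?b x)^6 * G x)" "integrable row_law (\<lambda>x. ?s x * ((?b x)^4 * G x))"
    "integrable row_law (\<lambda>x. (?s x)^3 * G x)" "integrable row_law (\<lambda>x. (?s x)^2 * ((?b x)^2 * G x))"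
    using bms by (auto intro!: bm_row_integrable bm_intros)
  have G0: "0 \<le> G x" for x using Suc.prems by (simp add: sign_even_def)
  have "(\<integral>x. (part_sum a (Suc k) x)^6 * G x \<partial>row_law) =
      (\<integral>x. (?Z x)^6 * G x + 15 * ((?Z x)^4 * ((?b x)^2 * G x))
        + 15 * ((?Z x)^2 * ((?b x)^4 * G x)) + (?b x)^6 * G x \<partial>row_law)"
  proof -
    have eq: "((u + v)^6 + (u - v)^6) / 2 * g = u^6 * g + 15 * (u^4 * (v^2 * g)) + 15 * (u^2 * (v^4 * g)) + v^6 * g"
      for u v g :: real by (simp add: eval_nat_numeral field_simps)
    show ?thesis unfolding part_sum_flip_step[OF Suc.prems(1) k(1)] eq ..
  qed
  also have "\<dots> = (\<integral>x. (?Z x)^6 * G x \<partial>row_law) + 15 * (\<integral>x. (?Z x)^4 * ((?b x)^2 * G x) \<partial>row_law)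
      + 15 * (\<integral>x. (?Z x)^2 * ((?b x)^4 * G x) \<partial>row_law) + (\<integral>x. (?b x)^6 * G x \<partial>row_law)"
    using i by simp
  also have "\<dots> \<le> 15 * (\<integral>x. (?s x)^3 * G x \<partial>row_law) + 15 * (3 * (\<integral>x. (?s x)^2 * ((?b x)^2 * G x) \<partial>row_law))
      + 15 * (3 * (\<integral>x. ?s x * ((?b x)^4 * G x) \<partial>row_law)) + 15 * (\<integral>x. (?b x)^6 * G x \<partial>row_law)"
  proof -
    have nn: "0 \<le> (\<integral>x. ?s x * ((?b x)^4 * G x) \<partial>row_law)" "0 \<le> (\<integral>x. (?b x)^6 * G x \<partial>row_law)"
      by (auto intro!: Bochner_Integration.integral_nonneg mult_nonneg_nonneg G0 simp: part_sq_def sum_nonneg)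
    have "(\<integral>x. (?Z x)^4 * ((?b x)^2 * G x) \<partial>row_law) \<le> 3 * (\<integral>x. (?s x)^2 * ((?b x)^2 * G x) \<partial>row_law)"
      using khintchine_4[OF sign_even_weight[OF Suc.prems(1) k(1), of a 1] k(2), of a] by simp
    moreover have "(\<integral>x. (?Z x)^2 * ((?b x)^4 * G x) \<partial>row_law) = (\<integral>x. ?s x * ((?b x)^4 * G x) \<partial>row_law)"
      using khintchine_2[OF sign_even_weight[OF Suc.prems(1) k(1), of a 2] k(2), of a] by simp
    ultimately show ?thesis using Suc.IH[OF Suc.prems(1) k(2)] nn by linarith
  qed
  also have "\<dots> = 15 * (\<integral>x. (?s x)^3 * G x + 3 * ((?s x)^2 * ((?b x)^2 * G x))
       + 3 * (?s x * ((?b x)^4 * G x)) + (?b x)^6 * G x \<partial>row_law)"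
    using i by simp
  also have "\<dots> = 15 * (\<integral>x. (part_sq a (Suc k) x)^3 * G x \<partial>row_law)"
  proof -
    have "s^3 * g + 3 * (s^2 * (v^2 * g)) + 3 * (s * (v^4 * g)) + v^6 * g = (s + v^2)^3 * g"
      for s v g :: real by (simp add: eval_nat_numeral algebra_simps)
    then show ?thesis by (simp add: part_sq_def)
  qed
  finally show ?case .
qed (simp add: part_sum_def part_sq_def)

lemma overlap_6: "(\<integral>y. (overlap n x y)^6 \<partial>row_law) \<le> 15 * (\<integral>y. (weight_overlap n x y)^3 \<partial>row_law)"
proof -
  have "sign_even (\<lambda>_. 1)" by (auto simp: sign_even_def intro: bm_intros)
  from khintchine_6[OF this order_refl, of "dir x"] show ?thesis
    by (simp add: part_sum_def part_sq_def overlap_def weight_overlap_def power_mult_distrib)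
qed

lemma centered_overlap_bound: "\<bar>centered_overlap x z\<bar> \<le> 1"
proof -
  have "0 \<le> mass x * mass z / n" using mass_prod_bounds by simp
  moreover have "mass x * mass z / n \<le> 1"
    using mass_prod_bounds[of n x z] n_pos by (simp add: field_simps)
  ultimately show ?thesis
    using weight_overlap_bounds[of n x z] unfolding centered_overlap_def by linarith
qed

text \<open>
  The sixth power suffices: \<open>corr_kernel\<close> is bounded by 1 and, being a difference of nonnegative
  numbers, by the larger of the squared overlap and \<open>1 / n\<close>.
\<close>

lemma kernel_4_le: "(corr_kernel n x z)^4 \<le> (overlap n x z)^6 + 1 / n^3"
proof -
  define u c where "u = (overlap n x z)^2" and "c = mass x * mass z / n"
  have u: "0 \<le> u" and c: "0 \<le> c" "c \<le> 1 / n"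
    using mass_prod_bounds[of n x z] n_pos by (auto simp: u_def c_def field_simps)
  have k: "corr_kernel n x z = u - c" by (simp add: corr_kernel_def u_def c_def)
  have "(corr_kernel n x z)^4 = \<bar>u - c\<bar>^4" by (simp add: k)
  also have "\<dots> \<le> \<bar>u - c\<bar>^3"
    by (rule power_decreasing) (use corr_kernel_bound[of n x z] k in auto)
  also have "\<dots> \<le> u^3 + 1 / n^3"
  proof (cases "u \<ge> c")
    case True
    then have "\<bar>u - c\<bar>^3 \<le> u^3" using c u by (intro power_mono) auto
    then show ?thesis using n_pos by (intro add_increasing2) auto
  next
    case False
    then have "\<bar>u - c\<bar>^3 \<le> (1 / n)^3" using c u by (intro power_mono) auto
    then show ?thesis using u by (simp add: power_divide add_increasing)
  qed
  finally show ?thesis by (simp add: u_def flip: power_mult)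
qed

lemma weight_overlap_3_le: "(weight_overlap n x z)^3 \<le> 4 * (centered_overlap x z)^2 + 4 / n^3"
proof -
  define d c where "d = \<bar>centered_overlap x z\<bar>" and "c = 1 / real n"
  have d: "0 \<le> d" "d \<le> 1" using centered_overlap_bound by (auto simp: d_def)
  have c: "0 \<le> c" by (simp add: c_def)
  have "mass x * mass z / n \<le> c"
    using mass_prod_bounds[of n x z] n_pos by (simp add: c_def field_simps)
  then have "weight_overlap n x z \<le> d + c" unfolding d_def centered_overlap_def by linarith
  then have "(weight_overlap n x z)^3 \<le> (d + c)^3"
    using weight_overlap_bounds by (intro power_mono) auto
  also have "\<dots> \<le> 4 * d^3 + 4 * c^3"
  proof -
    have "0 \<le> 3 * (d + c) * (d - c)^2" using c d by simp
    also have "\<dots> = 4 * d^3 + 4 * c^3 - (d + c)^3" by (simp add: eval_nat_numeral algebra_simps)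
    finally show ?thesis by simp
  qed
  also have "d^3 \<le> d^2" by (rule power_decreasing) (use d in auto)
  finally show ?thesis by (simp add: d_def c_def power_divide)
qed

lemma kernel_m4_le_var: "K.kernel_m4 \<le> 60 * overlap_var + 61 / n^3"
proof -
  have row: "(\<integral>z. (corr_kernel n x z)^4 \<partial>row_law) \<le> 60 * (\<integral>z. (centered_overlap x z)^2 \<partial>row_law) + 61 / n^3" for x
  proof -
    have i: "integrable row_law (\<lambda>z. (overlap n x z)^6)" "integrable row_law (\<lambda>z. (centered_overlap x z)^2)"
      by (intro bm_row_integrable bm_intros)+
    have "(\<integral>z. (corr_kernel n x z)^4 \<partial>row_law) \<le> (\<integral>z. (overlap n x z)^6 + 1 / n^3 \<partial>row_law)"
      by (rule integral_mono') (use i kernel_4_le in auto)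
    also have "\<dots> = (\<integral>z. (overlap n x z)^6 \<partial>row_law) + 1 / n^3" using i by (simp add: row.prob_space)
    also have "(\<integral>z. (overlap n x z)^6 \<partial>row_law) \<le> 15 * (\<integral>z. (weight_overlap n x z)^3 \<partial>row_law)" by (rule overlap_6)
    also have "(\<integral>z. (weight_overlap n x z)^3 \<partial>row_law) \<le> (\<integral>z. 4 * (centered_overlap x z)^2 + 4 / n^3 \<partial>row_law)"
      by (rule integral_mono') (use i weight_overlap_3_le in auto)
    also have "\<dots> = 4 * (\<integral>z. (centered_overlap x z)^2 \<partial>row_law) + 4 / n^3" using i by (simp add: row.prob_space)
    finally show ?thesis by simp
  qed
  have i: "integrable row_law (\<lambda>x. \<integral>z. (centered_overlap x z)^2 \<partial>row_law)"
    unfolding centered_overlap_row by (intro bm_row_integrable bm_intros)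
  have "K.kernel_m4 \<le> (\<integral>x. 60 * (\<integral>z. (centered_overlap x z)^2 \<partial>row_law) + 61 / n^3 \<partial>row_law)"
    unfolding K.kernel_m4_def
    by (rule integral_mono') (use i row in \<open>auto intro!: add_nonneg_nonneg Bochner_Integration.integral_nonneg\<close>)
  also have "\<dots> = 60 * overlap_var + 61 / n^3" using i by (simp add: overlap_var_def row.prob_space)
  finally show ?thesis .
qed

lemma m22_le: "m22 \<le> 1 / (n * (real n - 1))"
proof -
  have "n * (real n - 1) * m22 \<le> 1"
    using moment_relation m4_nonneg mult_nonneg_nonneg[of "real n" m4] by linarith
  moreover have "n * (real n - 1) > 0" using n_pos by simp
  ultimately show ?thesis by (simp add: field_simps)
qed

lemma m4_ge: "m4 \<ge> 1 / n^2"
proof -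
  have i: "integrable row_law (\<lambda>x. (dir x 0)^4)" "integrable row_law (\<lambda>x. (dir x 0)^2)"
    using two_le_n by (auto intro!: bm_row_integrable bm_intros)
  have "0 \<le> (\<integral>x. ((dir x 0)^2 - 1 / n)^2 \<partial>row_law)" by (intro Bochner_Integration.integral_nonneg) simp
  also have "\<dots> = (\<integral>x. (dir x 0)^4 - 2 / n * (dir x 0)^2 + 1 / n^2 \<partial>row_law)"
    by (rule Bochner_Integration.integral_cong) (auto simp: power2_diff power_divide simp flip: power_mult)
  also have "\<dots> = m4 - 2 / n * (1 / n) + 1 / n^2"
    using i two_le_n by (simp add: m4_def integral_dir_sq row.prob_space)
  finally show ?thesis by (simp add: power2_eq_square)
qed

lemma m4_le: "m4 \<le> 1 / n"
proof -
  have "n * m4 \<le> 1"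
  proof -
    have "0 \<le> n * (real n - 1) * m22" using m22_nonneg n_pos by (intro mult_nonneg_nonneg) auto
    then show ?thesis using moment_relation by linarith
  qed
  then show ?thesis using n_pos by (simp add: field_simps)
qed

lemma n_m22_sq: "n * (real n - 1) * m22^2 \<le> 1 / (n * (real n - 1))"
proof -
  have p: "n * (real n - 1) > 0" using n_pos by simp
  have "n * (real n - 1) * m22^2 = (n * (real n - 1) * m22) * m22" by (simp add: power2_eq_square)
  also have "\<dots> \<le> 1 * m22"
    using moment_relation m4_nonneg mult_nonneg_nonneg[of "real n" m4] m22_nonneg by (intro mult_right_mono) linarith+
  finally show ?thesis using m22_le by simp
qed

text \<open>
  Conditionally on the absolute values the overlap is a sign sum with squares adding up to
  \<open>weight_overlap\<close>, so its sixth moment is at most 15 times the mean of \<open>weight_overlap\<^sup>3\<close>; the latter is reduced to the variance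
  \<open>overlap_var\<close> because \<open>weight_overlap\<close> is bounded and has mean \<open>1 / n\<close>.
\<close>

lemma kernel_m4_le_moment: "K.kernel_m4 \<le> 241 * (n * m4^2)"
proof -
  have c: "1 / real n^3 \<le> n * m4^2"
  proof -
    have "n * (1 / n^2)^2 \<le> n * m4^2" using m4_ge by (intro mult_left_mono power_mono) auto
    moreover have "real n * (1 / n^2)^2 = 1 / n^3" using n_pos by (simp add: eval_nat_numeral field_simps)
    ultimately show ?thesis by simp
  qed
  have "1 / (n * (real n - 1)) - 1 / n^2 \<le> 2 / real n^3"
  proof -
    have "1 / (n * (real n - 1)) - 1 / n^2 = 1 / (n^2 * (real n - 1))"
      using n_pos by (simp add: field_simps eval_nat_numeral)
    also have "\<dots> \<le> 1 / (n^2 * (real n / 2))"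
      using n_pos by (intro divide_left_mono mult_left_mono) auto
    finally show ?thesis by (simp add: eval_nat_numeral field_simps)
  qed
  then have "overlap_var \<le> n * m4^2 + 2 / real n^3"
    using n_m22_sq unfolding overlap_var_eq by linarith
  then show ?thesis using kernel_m4_le_var c by (simp add: divide_inverse) 
qed

lemma kernel_m2_upper: "K.kernel_m2 \<le> n * m4^2 + 6 / n^2"
proof -
  have "1 / (n * (real n - 1)) \<le> 1 / (n * (real n / 2))"
    using n_pos by (intro divide_left_mono mult_left_mono) auto
  then have "1 / (n * (real n - 1)) \<le> 2 / real n^2" by (simp add: power2_eq_square)
  then have "n * (real n - 1) * m22^2 \<le> 2 / real n^2" using n_m22_sq by linarith
  moreover have "K.kernel_m2 = n * m4^2 + 3 * (n * (real n - 1) * m22^2) - 1 / n^2"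
    by (simp add: kernel_m2_eq)
  moreover have "6 / real n^2 = 3 * (2 / real n^2)" "0 \<le> 1 / real n^2" by simp_all
  ultimately show ?thesis unfolding of_nat_power by linarith
qed

text \<open>
  In terms of \<open>y = n m4\<close> the relation between the moments makes \<open>n\<^sup>2 kernel_m2\<close> at least
  \<open>n y\<^sup>2 + 3 (1 - y)\<^sup>2 - 1\<close>. The two nonnegative squares cannot both be small; from \<open>n = 6\<close> on they pay for the
  constant.
\<close>

lemma kernel_m2_lower:
  assumes "n \<ge> 6"
  shows "K.kernel_m2 \<ge> (n * m4^2 + 1 / n^2) / 2"
proof -
  define y where "y = n * m4"
  define r where "r = real n"
  have r: "r \<ge> 6" using assms by (simp add: r_def)
  have m: "m22 = (1 - y) / (r * (r - 1))"
    using moment_relation r by (simp add: y_def r_def field_simps)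
  have y4: "n * m4^2 = y^2 / r" using r by (simp add: y_def r_def power2_eq_square)
  have e: "3 * n * (real n - 1) * m22^2 = 3 * (1 - y)^2 / (r * (r - 1))"
  proof -
    have "3 * z * (a / z)^2 = 3 * a^2 / z" if "z \<noteq> 0" for a z :: real
      using that by (simp add: power2_eq_square)
    from this[of "r * (r - 1)" "1 - y"] show ?thesis using r by (simp add: m r_def[symmetric] mult.assoc)
  qed
  have "3 * (1 - y)^2 / (r * (r - 1)) \<ge> 3 * (1 - y)^2 / (r * r)"
    using r by (intro divide_left_mono mult_left_mono) auto
  moreover have "y^2 / r + 3 * (1 - y)^2 / (r * r) - 1 / r^2 \<ge> (y^2 / r + 1 / r^2) / 2"
  proof -
    have "0 \<le> 6 * y^2 - 6 * y + 3 / 2" using zero_le_power2[of "2 * y - 1"] by (simp add: power2_eq_square algebra_simps)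
    moreover have "y^2 * 6 \<le> y^2 * r" using r by (intro mult_left_mono) auto
    ultimately have "0 \<le> y^2 * r / 2 + 3 * y^2 - 6 * y + 3 / 2" by simp
    then have "0 \<le> (y^2 * r / 2 + 3 * y^2 - 6 * y + 3 / 2) / (r * r)" using r by simp
    also have "\<dots> = y^2 / r + 3 * (1 - y)^2 / (r * r) - 1 / r^2 - (y^2 / r + 1 / r^2) / 2"
      using r by (simp add: field_simps power2_eq_square)
    finally show ?thesis by simp
  qed
  ultimately show ?thesis unfolding kernel_m2_eq y4 e by (simp add: r_def)
qed

end

section \<open>Rows dominated by one coordinate\<close>

definition dominant :: "nat \<Rightarrow> (nat \<Rightarrow> real) \<Rightarrow> nat \<Rightarrow> real" where
  "dominant n x t = (if (direction n x t)^2 \<ge> 9 / 10 then 1 else 0)"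

text \<open>
  At most one coordinate can carry nine tenths of a unit mass, so the sum is 0 or 1. If both rows
  are dominated by the same coordinate, this coordinate contributes at least 9/10 to the overlap in absolute
  value, the others at most 1/10 by Cauchy-Schwarz, and \<open>(8/10)\<^sup>2 - 1/8\<close> exceeds 1/2.
\<close>

lemma dominant_kernel:
  assumes n: "n \<ge> 8"
  shows "(\<Sum>t<n. dominant n x t * dominant n y t) \<le> 16 * (corr_kernel n x y)^4"
proof (cases "\<exists>s<n. dominant n x s * dominant n y s \<noteq> 0")
  case False
  then have "(\<Sum>t<n. dominant n x t * dominant n y t) = 0" by (intro sum.neutral) auto
  then show ?thesis by simp
next
  case True
  then obtain s where s: "s < n" "dominant n x s \<noteq> 0" "dominant n y s \<noteq> 0" by auto
  let ?J = "{..<n} - {s}"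
  have ws: "(direction n z s)^2 \<ge> 9 / 10" "(\<Sum>t\<in>?J. (direction n z t)^2) \<le> 1 / 10"
    if "dominant n z s \<noteq> 0" for z
  proof -
    show 1: "(direction n z s)^2 \<ge> 9 / 10" using that by (auto simp: dominant_def split: if_splits)
    have "row_mass n z = (direction n z s)^2 + (\<Sum>t\<in>?J. (direction n z t)^2)"
      unfolding row_mass_def using s by (intro sum.remove) auto
    then show "(\<Sum>t\<in>?J. (direction n z t)^2) \<le> 1 / 10" using 1 row_mass_bounds(2)[of n z] by linarith
  qed
  have others: "dominant n x t = 0" if "t \<in> ?J" for t
  proof -
    have "(direction n x t)^2 \<le> (\<Sum>t\<in>?J. (direction n x t)^2)" by (rule member_le_sum[OF that]) auto
    then show ?thesis using ws(2)[OF s(2)] by (simp add: dominant_def)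
  qed
  have "(\<Sum>t<n. dominant n x t * dominant n y t) = dominant n x s * dominant n y s
      + (\<Sum>t\<in>?J. dominant n x t * dominant n y t)"
    using s by (intro sum.remove) auto
  also have "\<dots> \<le> 1" using others by (simp add: dominant_def)
  finally have lhs: "(\<Sum>t<n. dominant n x t * dominant n y t) \<le> 1" .
  let ?p = "direction n x s * direction n y s" and ?r = "\<Sum>t\<in>?J. direction n x t * direction n y t"
  have ov: "overlap n x y = ?p + ?r" unfolding overlap_def using s by (intro sum.remove) auto
  have "(9 / 10) * (9 / 10) \<le> (direction n x s)^2 * (direction n y s)^2"
    using ws(1)[OF s(2)] ws(1)[OF s(3)] by (intro mult_mono) auto
  then have "(9 / 10)^2 \<le> \<bar>?p\<bar>^2" by (simp add: power2_eq_square mult_ac)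
  then have p: "9 / 10 \<le> \<bar>?p\<bar>" by (rule power2_le_imp_le) simp
  have "?r^2 \<le> (\<Sum>t\<in>?J. (direction n x t)^2) * (\<Sum>t\<in>?J. (direction n y t)^2)"
    by (rule Cauchy_Schwarz_ineq_sum)
  also have "\<dots> \<le> (1 / 10) * (1 / 10)"
    using ws(2)[OF s(2)] ws(2)[OF s(3)] by (intro mult_mono sum_nonneg) auto
  finally have "\<bar>?r\<bar>^2 \<le> (1 / 10)^2" by (simp add: power2_eq_square)
  then have r: "\<bar>?r\<bar> \<le> 1 / 10" by (rule power2_le_imp_le) simp
  have "8 / 10 \<le> \<bar>overlap n x y\<bar>" using p r unfolding ov by linarith
  then have "(8 / 10)^2 \<le> \<bar>overlap n x y\<bar>^2" by (intro power_mono) auto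
  moreover have "row_mass n x * row_mass n y / n \<le> 1 / 8"
    using mass_prod_bounds[of n x y] n by (intro frac_le) auto
  ultimately have "1 / 2 \<le> corr_kernel n x y" by (simp add: corr_kernel_def power2_eq_square)
  then have "(1 / 2)^4 \<le> (corr_kernel n x y)^4" by (intro power_mono) auto
  then show ?thesis using lhs by (simp add: eval_nat_numeral)
qed

context symmetric_entries
begin

definition dominance_prob :: real where
  "dominance_prob = (\<integral>x. dominant n x 0 \<partial>row_law)"

lemma bm_dominant [bm_intros]: "t < n \<Longrightarrow> bounded_measurable row_law (\<lambda>x. dominant n x t)"
  by (rule bounded_measurableI[where B=1]) (auto simp: dominant_def)

lemma integral_dominant:
  assumes t: "t < n"
  shows "(\<integral>x. dominant n x t \<partial>row_law) = dominance_prob"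
proof -
  let ?\<pi> = "Transposition.transpose 0 t"
  have b: "bij_betw ?\<pi> {..<n} {..<n}" using t two_le_n by (intro bij_transpose) auto
  have "(\<integral>x. dominant n (\<lambda>i\<in>{..<n}. x (?\<pi> i)) 0 \<partial>row_law) = dominance_prob"
    unfolding dominance_prob_def
    by (rule integral_permute[OF b]) (rule bm_measurable, rule bm_dominant, use two_le_n in simp)
  moreover have "dominant n (\<lambda>i\<in>{..<n}. x (?\<pi> i)) 0 = dominant n x t" for x
    unfolding dominant_def using direction_permute[OF b, of 0 x] two_le_n by simp
  ultimately show ?thesis by simp
qed

lemma kernel_m4_lower:
  assumes "n \<ge> 8"
  shows "K.kernel_m4 \<ge> n * dominance_prob^2 / 16"
proof -
  have row: "(\<Sum>t<n. dominant n x t * dominance_prob) \<le> 16 * (\<integral>y. (corr_kernel n x y)^4 \<partial>row_law)" for x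
  proof -
    have "(\<Sum>t<n. dominant n x t * dominance_prob) = (\<Sum>t<n. \<integral>y. dominant n x t * dominant n y t \<partial>row_law)"
      by (intro sum.cong refl) (simp add: integral_dominant)
    also have "\<dots> = (\<integral>y. (\<Sum>t<n. dominant n x t * dominant n y t) \<partial>row_law)"
      by (intro Bochner_Integration.integral_sum[symmetric] bm_row_integrable bm_intros) auto
    also have "\<dots> \<le> (\<integral>y. 16 * (corr_kernel n x y)^4 \<partial>row_law)"
      by (rule integral_mono)
        (use dominant_kernel[OF assms] in \<open>auto intro!: bm_row_integrable bm_intros\<close>)
    finally show ?thesis by simp
  qed
  have i4: "integrable row_law (\<lambda>x. \<integral>y. (corr_kernel n x y)^4 \<partial>row_law)"
  proof (rule row.integrable_bounded[where B=1])
    show "\<bar>\<integral>y. (corr_kernel n x y)^4 \<partial>row_law\<bar> \<le> 1" for x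
    proof (rule row.abs_integral_le)
      show "(\<lambda>y. (corr_kernel n x y)^4) \<in> borel_measurable row_law" by (intro bm_measurable bm_intros)
      show "\<bar>(corr_kernel n x y)^4\<bar> \<le> 1" for y
        unfolding power_abs by (rule power_le_one) (auto simp: corr_kernel_bound)
    qed
  qed measurable
  have "n * dominance_prob^2 = (\<Sum>t<n. \<integral>x. dominant n x t * dominance_prob \<partial>row_law)"
    by (simp add: integral_dominant power2_eq_square)
  also have "\<dots> = (\<integral>x. (\<Sum>t<n. dominant n x t * dominance_prob) \<partial>row_law)"
    by (intro Bochner_Integration.integral_sum[symmetric] bm_row_integrable bm_intros) auto
  also have "\<dots> \<le> (\<integral>x. 16 * (\<integral>y. (corr_kernel n x y)^4 \<partial>row_law) \<partial>row_law)"
  proof (rule integral_mono)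
    show "integrable row_law (\<lambda>x. \<Sum>t<n. dominant n x t * dominance_prob)"
      by (intro bm_row_integrable bm_intros) auto
  qed (use row i4 in auto)
  finally show ?thesis by (simp add: K.kernel_m4_def)
qed

lemma m4_lower: "m4 \<ge> dominance_prob / 2"
proof -
  have "dominance_prob / 2 = (\<integral>x. dominant n x 0 / 2 \<partial>row_law)" by (simp add: dominance_prob_def)
  also have "\<dots> \<le> m4" unfolding m4_def
  proof (rule integral_mono)
    show "dominant n x 0 / 2 \<le> (dir x 0)^4" for x
    proof (cases "(dir x 0)^2 \<ge> 9 / 10")
      case True
      then have "(9 / 10)^2 \<le> ((dir x 0)^2)^2" by (intro power_mono) auto
      then show ?thesis using True by (simp add: dominant_def power2_eq_square power4_eq_xxxx)
    qed (simp add: dominant_def)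
  qed (use two_le_n in \<open>auto intro!: bm_row_integrable bm_intros\<close>)
  finally show ?thesis .
qed

end

section \<open>Directions and the moments of the entries\<close>

lemma powr_sum_le:
  fixes f :: "'i \<Rightarrow> real"
  assumes "finite I" "\<And>i. i \<in> I \<Longrightarrow> 0 \<le> f i" "0 < \<theta>" "\<theta> \<le> 1"
  shows "(\<Sum>i\<in>I. f i) powr \<theta> \<le> (\<Sum>i\<in>I. f i powr \<theta>)"
  using assms(1,2)
proof (induction I)
  case (insert i I)
  have two: "(a + b) powr \<theta> \<le> a powr \<theta> + b powr \<theta>" if "0 \<le> a" "0 \<le> b" for a b :: real
  proof (cases "a + b = 0")
    case False
    then have s: "a + b > 0" using that by linarith
    have "u powr \<theta> \<ge> u" if "0 \<le> u" "u \<le> 1" for u :: real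
      using that assms(3,4) powr_mono'[of \<theta> 1 u] by (cases "u = 0") auto
    from this[of "a / (a + b)"] this[of "b / (a + b)"]
    have "a / (a + b) + b / (a + b) \<le> (a / (a + b)) powr \<theta> + (b / (a + b)) powr \<theta>"
      using that s by (intro add_mono) auto
    then have "1 \<le> (a powr \<theta> + b powr \<theta>) / (a + b) powr \<theta>"
      using that s by (simp add: powr_divide add_divide_distrib flip: add_divide_distrib[of a])
    then show ?thesis using s by (simp add: field_simps)
  qed (use that assms in \<open>auto simp: add_nonneg_eq_0_iff\<close>)
  have "(\<Sum>i\<in>insert i I. f i) powr \<theta> \<le> f i powr \<theta> + (\<Sum>i\<in>I. f i) powr \<theta>"
    using insert two[of "f i" "\<Sum>i\<in>I. f i"] by (simp add: sum_nonneg)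
  also have "\<dots> \<le> f i powr \<theta> + (\<Sum>i\<in>I. f i powr \<theta>)" using insert by simp
  finally show ?case using insert by simp
qed simp

lemma square_powr: "(x^2) powr \<theta> = \<bar>x\<bar> powr (2 * \<theta>)" for x \<theta> :: real
proof (cases "x = 0")
  case False
  then have "x^2 = \<bar>x\<bar> powr 2" by (simp add: powr_numeral)
  then show ?thesis by (simp only: powr_powr)
qed simp

context symmetric_entries
begin

lemma measure_N_UNIV [simp]: "measure N UNIV = 1"
  using prob_space by simp

lemma N_measurable: "f \<in> borel_measurable borel \<Longrightarrow> f \<in> borel_measurable N" for f :: "real \<Rightarrow> real"
  by (simp add: measurable_cong_sets[OF sets_N refl])

sublocale entries: product_sigma_finite "\<lambda>_::nat. N" by unfold_locales

definition tail_sum :: "(nat \<Rightarrow> real) \<Rightarrow> real" where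
  "tail_sum x = (\<Sum>k\<in>{1..<n}. (x k)^2)"

lemma sum_sq_split: "(\<Sum>k<n. (x k)^2) = (x 0)^2 + tail_sum x" for x :: "nat \<Rightarrow> real"
proof -
  have "{..<n} = insert 0 {1..<n}" using two_le_n by auto
  then show ?thesis by (simp add: tail_sum_def)
qed

lemma tail_sum_nonneg: "0 \<le> tail_sum x"
  unfolding tail_sum_def by (intro sum_nonneg) auto

lemma dir_0_sq: "(dir x 0)^2 = (x 0)^2 / ((x 0)^2 + tail_sum x)"
  unfolding direction_def sum_sq_split by (simp add: power_divide tail_sum_nonneg)

lemma integral_row_single:
  assumes g: "integrable N g" and j: "j < n"
  shows "integrable row_law (\<lambda>x. g (x j) :: real)" "(\<integral>x. g (x j) \<partial>row_law) = integral\<^sup>L N g"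
proof -
  have d: "distr row_law N (\<lambda>x. x j) = N"
    using distr_PiM_component[of "{..<n}" "\<lambda>_. N" j] j prob_space_axioms by simp
  have m: "(\<lambda>x. x j) \<in> measurable row_law N" using j by (intro measurable_component_singleton) auto
  show "integrable row_law (\<lambda>x. g (x j))"
    using integrable_distr[OF m, of g] g d by simp
  show "(\<integral>x. g (x j) \<partial>row_law) = integral\<^sup>L N g"
    using integral_distr[OF m, of g] g d by simp
qed

lemma integral_row_pair:
  assumes f: "integrable N f" and g: "integrable N g" and j: "j < n" "j \<noteq> 0"
  shows "integrable row_law (\<lambda>x. f (x 0) * g (x j) :: real)"
    "(\<integral>x. f (x 0) * g (x j) \<partial>row_law) = integral\<^sup>L N f * integral\<^sup>L N g"
proof -
  let ?F = "\<lambda>i. if i = 0 then f else if i = j then g else (\<lambda>_. 1)"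
  have int: "integrable N (?F i)" for i using f g by auto
  have ex: "(\<Prod>i<n. H i) = H 0 * H j" if "\<And>i. i \<noteq> 0 \<Longrightarrow> i \<noteq> j \<Longrightarrow> H i = 1" for H :: "nat \<Rightarrow> real"
  proof -
    have "(\<Prod>i<n. H i) = (\<Prod>i\<in>{0, j}. H i)"
      by (rule prod.mono_neutral_right) (use that j in auto)
    then show ?thesis using j by simp
  qed
  have p: "(\<Prod>i<n. ?F i (x i)) = f (x 0) * g (x j)" for x
    using ex[of "\<lambda>i. ?F i (x i)"] j by simp
  show "integrable row_law (\<lambda>x. f (x 0) * g (x j))"
    using entries.product_integrable_prod[of "{..<n}" ?F] int p by simp
  have "(\<integral>x. (\<Prod>i<n. ?F i (x i)) \<partial>row_law) = (\<Prod>i<n. integral\<^sup>L N (?F i))"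
    by (rule entries.product_integral_prod) (use int in auto)
  also have "\<dots> = integral\<^sup>L N f * integral\<^sup>L N g"
    by (subst ex) (use j in auto)
  finally show "(\<integral>x. f (x 0) * g (x j) \<partial>row_law) = integral\<^sup>L N f * integral\<^sup>L N g" unfolding p .
qed

text \<open>
  The first entry dominates when its square is at least \<open>9 b\<close> and the other squares sum up to at
  most \<open>b\<close>. The second event fails with small probability by Markov's inequality for the
  power \<open>\<theta>\<close> of the sum, which is subadditive; a moment of order \<open>2 \<theta>\<close> is enough.
\<close>

lemma dominance_prob_lower:
  assumes b: "b > 0" and \<theta>: "0 < \<theta>" "\<theta> \<le> 1"
    and int: "integrable N (\<lambda>y. \<bar>y\<bar> powr (2 * \<theta>))"
  shows "dominance_prob \<ge> measure N {y. y^2 \<ge> 9 * b} * (1 - n * (\<integral>y. \<bar>y\<bar> powr (2 * \<theta>) \<partial>N) / b powr \<theta>)"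
proof -
  define A where "A = {y::real. y^2 \<ge> 9 * b}"
  define q where "q = measure N A"
  define \<mu> where "\<mu> = (\<integral>y. \<bar>y\<bar> powr (2 * \<theta>) \<partial>N)"
  have A: "A \<in> sets N"
  proof -
    have "{y\<in>space borel. y^2 \<ge> 9 * b} \<in> sets (borel::real measure)" by measurable
    then show ?thesis by (simp add: A_def sets_N)
  qed
  let ?i = "indicator A :: real \<Rightarrow> real" and ?g = "\<lambda>y. \<bar>y\<bar> powr (2 * \<theta>) / b powr \<theta>"
  have iA: "integrable N ?i" "integral\<^sup>L N ?i = q" using A by (auto simp: q_def emeasure_eq_measure)
  have ig: "integrable N ?g" "integral\<^sup>L N ?g = \<mu> / b powr \<theta>" using int by (auto simp: \<mu>_def)
  have pw: "?i (x 0) - (\<Sum>k\<in>{1..<n}. ?i (x 0) * ?g (x k)) \<le> dominant n x 0" for x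
  proof (cases "x 0 \<in> A")
    case False
    then show ?thesis by (simp add: dominant_def)
  next
    case True
    show ?thesis
    proof (cases "tail_sum x \<le> b")
      case le: True
      have "9 * b \<le> (x 0)^2" using True by (simp add: A_def)
      then have "9 / 10 * ((x 0)^2 + tail_sum x) \<le> (x 0)^2" using le by simp
      moreover have "(x 0)^2 + tail_sum x > 0" using \<open>9 * b \<le> (x 0)^2\<close> b tail_sum_nonneg[of x] by linarith
      ultimately have "(dir x 0)^2 \<ge> 9 / 10" by (simp add: dir_0_sq pos_le_divide_eq)
      then have "dominant n x 0 = 1" by (simp add: dominant_def)
      moreover have "0 \<le> (\<Sum>k\<in>{1..<n}. ?i (x 0) * ?g (x k))" by (intro sum_nonneg) auto
      ultimately show ?thesis using True by simp
    next
      case False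
      then have "b powr \<theta> \<le> tail_sum x powr \<theta>" using b \<theta> by (intro powr_mono2) auto
      also have "\<dots> \<le> (\<Sum>k\<in>{1..<n}. ((x k)^2) powr \<theta>)"
        unfolding tail_sum_def by (rule powr_sum_le) (use \<theta> in auto)
      also have "\<dots> = (\<Sum>k\<in>{1..<n}. \<bar>x k\<bar> powr (2 * \<theta>))"
        by (intro sum.cong refl) (rule square_powr)
      finally have "1 \<le> (\<Sum>k\<in>{1..<n}. \<bar>x k\<bar> powr (2 * \<theta>)) / b powr \<theta>" using b by (simp add: field_simps)
      then show ?thesis using True by (simp add: dominant_def sum_divide_distrib)
    qed
  qed
  have pairs: "integrable row_law (\<lambda>x. ?i (x 0) * ?g (x k))"
    "(\<integral>x. ?i (x 0) * ?g (x k) \<partial>row_law) = q * (\<mu> / b powr \<theta>)" if "k \<in> {1..<n}" for k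
    using integral_row_pair[OF iA(1) ig(1), of k] that iA ig by auto
  have single: "integrable row_law (\<lambda>x. ?i (x 0))" "(\<integral>x. ?i (x 0) \<partial>row_law) = q"
    using integral_row_single[OF iA(1), of 0] iA two_le_n by auto
  have "(\<integral>x. ?i (x 0) - (\<Sum>k\<in>{1..<n}. ?i (x 0) * ?g (x k)) \<partial>row_law) \<le> dominance_prob"
    unfolding dominance_prob_def
  proof (rule integral_mono)
    show "integrable row_law (\<lambda>x. ?i (x 0) - (\<Sum>k\<in>{1..<n}. ?i (x 0) * ?g (x k)))"
      by (intro Bochner_Integration.integrable_diff Bochner_Integration.integrable_sum single(1) pairs(1))
    show "integrable row_law (\<lambda>x. dominant n x 0)"
      using two_le_n by (intro bm_row_integrable bm_intros) auto
  qed (rule pw)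
  also have "(\<integral>x. ?i (x 0) - (\<Sum>k\<in>{1..<n}. ?i (x 0) * ?g (x k)) \<partial>row_law) =
      q - (\<Sum>k\<in>{1..<n}. q * (\<mu> / b powr \<theta>))"
  proof -
    have "(\<integral>x. ?i (x 0) - (\<Sum>k\<in>{1..<n}. ?i (x 0) * ?g (x k)) \<partial>row_law) =
      (\<integral>x. ?i (x 0) \<partial>row_law) - (\<integral>x. (\<Sum>k\<in>{1..<n}. ?i (x 0) * ?g (x k)) \<partial>row_law)"
      by (intro Bochner_Integration.integral_diff Bochner_Integration.integrable_sum single pairs(1))
    also have "(\<integral>x. (\<Sum>k\<in>{1..<n}. ?i (x 0) * ?g (x k)) \<partial>row_law) = (\<Sum>k\<in>{1..<n}. \<integral>x. ?i (x 0) * ?g (x k) \<partial>row_law)"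
      by (intro Bochner_Integration.integral_sum pairs(1))
    also have "\<dots> = (\<Sum>k\<in>{1..<n}. q * (\<mu> / b powr \<theta>))"
      by (intro sum.cong refl pairs(2))
    finally show ?thesis by (simp add: single)
  qed
  finally have "q - (real n - 1) * (q * (\<mu> / b powr \<theta>)) \<le> dominance_prob"
    using two_le_n by (simp add: of_nat_diff)
  moreover have "0 \<le> q * (\<mu> / b powr \<theta>)"
    by (auto simp: q_def \<mu>_def intro!: mult_nonneg_nonneg divide_nonneg_nonneg Bochner_Integration.integral_nonneg)
  moreover have "q - real n * z \<le> d" if "q - (real n - 1) * z \<le> d" "0 \<le> z" for z d
    using that by (simp add: algebra_simps)
  ultimately have "q - real n * (q * (\<mu> / b powr \<theta>)) \<le> dominance_prob" by blast
  then have "q * (1 - n * \<mu> / b powr \<theta>) \<le> dominance_prob" by (simp add: algebra_simps)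
  then show ?thesis unfolding q_def A_def \<mu>_def .
qed

lemma exp_moment_lt_1: "0 < (\<integral>y. exp (- (y^2)) \<partial>N)" "(\<integral>y. exp (- (y^2)) \<partial>N) < 1"
proof -
  have i: "integrable N (\<lambda>y. exp (- (y^2)))"
    by (rule integrable_bounded[where B=1]) (auto intro!: N_measurable)
  have "(\<integral>y. exp (- (y^2)) \<partial>N) < (\<integral>y. 1 \<partial>N)"
    by (rule integral_less_AE_space) (use i AE_nonzero emeasure_space_1 in auto)
  then show "(\<integral>y. exp (- (y^2)) \<partial>N) < 1" by (simp add: prob_space)
  have "(\<integral>y. 0 \<partial>N) < (\<integral>y. exp (- (y^2)) \<partial>N)"
    by (rule integral_less_AE_space) (use i AE_nonzero emeasure_space_1 in auto)
  then show "0 < (\<integral>y. exp (- (y^2)) \<partial>N)" by simp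
qed

text \<open>
  If the other squares sum up to at least \<open>c n\<close>, the weight \<open>w\<close> of the first entry satisfies
  \<open>w\<^sup>2 \<le> w powr \<beta> \<le> (X\<^sup>2 / (c n)) powr \<beta>\<close>. A sum of nonnegative independent variables is below \<open>c n\<close>, for small
  \<open>c\<close>, only with exponentially small probability, by Chernoff's bound.
\<close>

lemma m4_upper:
  fixes \<beta> c :: real
  assumes \<beta>: "0 < \<beta>" "\<beta> \<le> 2" and c: "c > 0"
    and int: "integrable N (\<lambda>y. \<bar>y\<bar> powr (2 * \<beta>))"
  shows "m4 \<le> exp (c * n) * (\<integral>y. exp (- (y^2)) \<partial>N) ^ (n - 1)
     + (\<integral>y. \<bar>y\<bar> powr (2 * \<beta>) \<partial>N) / (c * n) powr \<beta>"
proof -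
  let ?g = "\<lambda>y. \<bar>y\<bar> powr (2 * \<beta>) / (c * n) powr \<beta>"
  let ?F = "\<lambda>i::nat. if i = 0 then (\<lambda>_. 1) else (\<lambda>y. exp (- (y^2))) :: real \<Rightarrow> real"
  have cn: "c * n > 0" using c n_pos by simp
  have i: "integrable N (\<lambda>y. exp (- (y^2)))"
    by (rule integrable_bounded[where B=1]) (auto intro!: N_measurable)
  then have iF: "integrable N (?F i)" for i by auto
  have P: "(\<Prod>i<n. ?F i (x i)) = exp (- tail_sum x)" for x
  proof -
    have "{..<n} = insert 0 {1..<n}" using two_le_n by auto
    then have "(\<Prod>i<n. ?F i (x i)) = (\<Prod>i\<in>{1..<n}. ?F i (x i))" by simp
    also have "\<dots> = (\<Prod>i\<in>{1..<n}. exp (- ((x i)^2)))" by (intro prod.cong refl) auto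
    finally show ?thesis by (simp add: tail_sum_def exp_sum sum_negf[symmetric])
  qed
  have PI: "integrable row_law (\<lambda>x. exp (- tail_sum x))"
    using entries.product_integrable_prod[of "{..<n}" ?F] iF P by simp
  have "(\<integral>x. exp (- tail_sum x) \<partial>row_law) = (\<Prod>i<n. integral\<^sup>L N (?F i))"
    unfolding P[symmetric] by (rule entries.product_integral_prod) (use iF in auto)
  also have "\<dots> = (\<Prod>i\<in>{1..<n}. integral\<^sup>L N (?F i))"
  proof -
    have "{..<n} = insert 0 {1..<n}" using two_le_n by auto
    then show ?thesis by (simp add: prob_space)
  qed
  also have "\<dots> = (\<Prod>i\<in>{1..<n}. \<integral>y. exp (- (y^2)) \<partial>N)" by (intro prod.cong refl) auto
  finally have PE: "(\<integral>x. exp (- tail_sum x) \<partial>row_law) = (\<integral>y. exp (- (y^2)) \<partial>N) ^ (n - 1)" by simp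
  have single: "integrable row_law (\<lambda>x. ?g (x 0))" "(\<integral>x. ?g (x 0) \<partial>row_law) = (\<integral>y. \<bar>y\<bar> powr (2 * \<beta>) \<partial>N) / (c * n) powr \<beta>"
    using integral_row_single[of ?g 0] int two_le_n by auto
  have pw: "(dir x 0)^4 \<le> exp (c * n) * exp (- tail_sum x) + ?g (x 0)" for x
  proof -
    have w: "0 \<le> (dir x 0)^2" "(dir x 0)^2 \<le> 1" using direction_sq_le[of 0 n x] two_le_n by auto
    have w4: "(dir x 0)^4 = ((dir x 0)^2)^2" by simp
    show ?thesis
    proof (cases "tail_sum x \<le> c * n")
      case True
      have "(dir x 0)^4 \<le> 1" unfolding w4 by (rule power_le_one[OF w])
      also have "1 \<le> exp (c * n) * exp (- tail_sum x)" using True by (simp flip: exp_add)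
      finally show ?thesis by (simp add: add_increasing2)
    next
      case False
      have "(dir x 0)^2 \<le> (x 0)^2 / (c * n)"
        unfolding dir_0_sq using False cn zero_le_power2[of "x 0"] by (intro divide_left_mono) (linarith | simp add: add_nonneg_pos)+
      then have "((dir x 0)^2) powr \<beta> \<le> ((x 0)^2 / (c * n)) powr \<beta>" using \<beta> by (intro powr_mono2) auto
      also have "\<dots> = ?g (x 0)"
        using cn by (simp add: powr_divide square_powr)
      finally have 1: "((dir x 0)^2) powr \<beta> \<le> ?g (x 0)" .
      have "((dir x 0)^2)^2 \<le> ((dir x 0)^2) powr \<beta>"
      proof (cases "(dir x 0)^2 = 0")
        case False
        then have "((dir x 0)^2)^2 = ((dir x 0)^2) powr 2" using w by (simp add: powr_numeral)
        also have "\<dots> \<le> ((dir x 0)^2) powr \<beta>" using w \<beta> False by (intro powr_mono') auto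
        finally show ?thesis .
      qed simp
      then have "(dir x 0)^4 \<le> ?g (x 0)" using 1 unfolding w4 by linarith
      then show ?thesis by (simp add: add_increasing)
    qed
  qed
  have "m4 \<le> (\<integral>x. exp (c * n) * exp (- tail_sum x) + ?g (x 0) \<partial>row_law)"
    unfolding m4_def by (rule integral_mono) (use pw PI single(1) two_le_n in \<open>auto intro!: bm_row_integrable bm_intros Bochner_Integration.integrable_add\<close>)
  also have "\<dots> = exp (c * n) * (\<integral>y. exp (- (y^2)) \<partial>N) ^ (n - 1) + (\<integral>y. \<bar>y\<bar> powr (2 * \<beta>) \<partial>N) / (c * n) powr \<beta>"
    using PI single by (subst Bochner_Integration.integral_add) (auto simp: PE)
  finally show ?thesis .
qed

end

section \<open>Regularly varying tails\<close>

lemma two_power_powr: "((2::real)^k) powr e = (2 powr e)^k"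
proof -
  have "((2::real)^k) powr e = (2 powr real k) powr e" by (simp add: powr_realpow)
  also have "\<dots> = (2 powr e) powr real k" by (simp only: powr_powr mult.commute)
  also have "\<dots> = (2 powr e)^k" by (simp add: powr_realpow)
  finally show ?thesis .
qed

text \<open>
  Monotonicity of the tail \<open>G\<close> makes its behaviour along the powers of two sufficient. Hence only
  the ratio \<open>G (2 x) / G x\<close> is recorded.
\<close>

locale regularly_varying_law = prob_space N for N :: "real measure" +
  fixes \<alpha> :: real and G :: "real \<Rightarrow> real"
  assumes sets_law [measurable_cong]: "sets N = sets borel"
    and alpha_pos: "\<alpha> > 0"
    and tail_def: "\<And>x. x > 0 \<Longrightarrow> measure N {y. \<bar>y\<bar> > x} = G x"
    and tail_pos: "eventually (\<lambda>x. G x > 0) at_top"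
    and tail_ratio: "((\<lambda>x. G (2 * x) / G x) \<longlongrightarrow> 2 powr (- \<alpha>)) at_top"
begin

lemma tail_sets: "{y. \<bar>y\<bar> > x} \<in> sets N" for x :: real
proof -
  have "{y\<in>space borel. \<bar>y\<bar> > x} \<in> sets (borel::real measure)" by measurable
  then show ?thesis by (simp add: sets_law)
qed

lemma tail_antimono:
  assumes "0 < x" "x \<le> y"
  shows "G y \<le> G x"
proof -
  have "measure N {z. \<bar>z\<bar> > y} \<le> measure N {z. \<bar>z\<bar> > x}"
    using assms by (intro finite_measure_mono tail_sets) auto
  then show ?thesis using tail_def[of x] tail_def[of y] assms by simp
qed

lemma dyadic_scale:
  fixes x x1 :: real
  assumes "x1 > 0" "x \<ge> x1"
  obtains k :: nat where "2^k * x1 \<le> x" "x < 2^(Suc k) * x1"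
proof -
  have ex: "\<exists>m. x < 2^m * x1"
  proof -
    obtain m where "x / x1 < 2^m" using real_arch_pow[of 2 "x / x1"] by auto
    then show ?thesis using assms by (auto simp: field_simps)
  qed
  define m where "m = (LEAST m. x < 2^m * x1)"
  have m: "x < 2^m * x1" unfolding m_def by (rule LeastI_ex[OF ex])
  have "m \<noteq> 0" by (rule notI) (use m assms in simp)
  then obtain k where k: "m = Suc k" by (cases m) auto
  have "\<not> x < 2^k * x1" using not_less_Least[of k "\<lambda>m. x < 2^m * x1"] k by (simp add: m_def)
  then show ?thesis using that[of k] m k by simp
qed

lemma tail_upper:
  assumes "\<gamma> < \<alpha>" "\<gamma> > 0"
  shows "\<exists>C>0. \<exists>x1>0. \<forall>x\<ge>x1. G x \<le> C * x powr (- \<gamma>)"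
proof -
  have "2 powr (- \<alpha>) < (2::real) powr (- \<gamma>)" using assms by simp
  then have "eventually (\<lambda>x. G (2 * x) / G x < 2 powr (- \<gamma>)) at_top"
    using tail_ratio by (rule order_tendstoD(2)[rotated])
  then have "eventually (\<lambda>x. G x > 0 \<and> G (2 * x) \<le> 2 powr (- \<gamma>) * G x) at_top"
    using tail_pos by eventually_elim (auto simp: field_simps)
  then obtain x0 where x0: "\<And>x. x \<ge> x0 \<Longrightarrow> G x > 0 \<and> G (2 * x) \<le> 2 powr (- \<gamma>) * G x"
    by (auto simp: eventually_at_top_linorder)
  define x1 where "x1 = max 1 x0"
  have x1: "x1 > 0" "x1 \<ge> x0" by (auto simp: x1_def)
  have it: "G (2^k * x1) \<le> (2 powr (- \<gamma>))^k * G x1" for k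
  proof (induction k)
    case (Suc k)
    have "1 * x1 \<le> 2^k * x1" using x1 by (intro mult_right_mono) auto
    then have "x0 \<le> 2^k * x1" using x1(2) by linarith
    then have "G (2 * (2^k * x1)) \<le> 2 powr (- \<gamma>) * G (2^k * x1)" using x0[of "2^k * x1"] by simp
    also have "\<dots> \<le> 2 powr (- \<gamma>) * ((2 powr (- \<gamma>))^k * G x1)" using Suc by (intro mult_left_mono) auto
    finally show ?case by (simp add: mult_ac)
  qed simp
  define C where "C = G x1 * (2 * x1) powr \<gamma>"
  have "G x \<le> C * x powr (- \<gamma>)" if x: "x \<ge> x1" for x
  proof -
    obtain k where k: "2^k * x1 \<le> x" "x < 2^(Suc k) * x1" using dyadic_scale[OF x1(1) x] by blast
    have "G x \<le> G (2^k * x1)" using k x1 by (intro tail_antimono) auto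
    also have "\<dots> \<le> (2 powr (- \<gamma>))^k * G x1" by (rule it)
    also have "(2 powr (- \<gamma>))^k = (2^k) powr (- \<gamma>)"
      by (rule two_power_powr[symmetric])
    also have "\<dots> \<le> (x / (2 * x1)) powr (- \<gamma>)"
      using k x x1 assms by (intro powr_mono2') (auto simp: field_simps)
    also have "\<dots> = x powr (- \<gamma>) * (2 * x1) powr \<gamma>"
      using x x1 by (simp add: powr_divide powr_minus field_simps)
    finally show ?thesis using x0[of x1] x1 by (simp add: C_def mult_ac)
  qed
  moreover have "C > 0" using x0[of x1] x1 by (simp add: C_def)
  ultimately show ?thesis using x1 by blast
qed

lemma tail_lower:
  assumes "\<gamma> > \<alpha>"
  shows "\<exists>C>0. \<exists>x1>0. \<forall>x\<ge>x1. G x \<ge> C * x powr (- \<gamma>)"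
proof -
  have g: "\<gamma> > 0" using assms alpha_pos by simp
  have "2 powr (- \<alpha>) > (2::real) powr (- \<gamma>)" using assms by simp
  then have "eventually (\<lambda>x. G (2 * x) / G x > 2 powr (- \<gamma>)) at_top"
    using tail_ratio by (rule order_tendstoD(1)[rotated])
  then have "eventually (\<lambda>x. G x > 0 \<and> G (2 * x) \<ge> 2 powr (- \<gamma>) * G x) at_top"
    using tail_pos by eventually_elim (auto simp: field_simps)
  then obtain x0 where x0: "\<And>x. x \<ge> x0 \<Longrightarrow> G x > 0 \<and> G (2 * x) \<ge> 2 powr (- \<gamma>) * G x"
    by (auto simp: eventually_at_top_linorder)
  define x1 where "x1 = max 1 x0"
  have x1: "x1 > 0" "x1 \<ge> x0" by (auto simp: x1_def)
  have it: "G (2^k * x1) \<ge> (2 powr (- \<gamma>))^k * G x1" for k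
  proof (induction k)
    case (Suc k)
    have "1 * x1 \<le> 2^k * x1" using x1 by (intro mult_right_mono) auto
    then have "x0 \<le> 2^k * x1" using x1(2) by linarith
    then have 1: "2 powr (- \<gamma>) * G (2^k * x1) \<le> G (2 * (2^k * x1))" using x0[of "2^k * x1"] by simp
    have "(2 powr (- \<gamma>))^(Suc k) * G x1 = 2 powr (- \<gamma>) * ((2 powr (- \<gamma>))^k * G x1)" by simp
    also have "\<dots> \<le> 2 powr (- \<gamma>) * G (2^k * x1)"
      using Suc by (intro mult_left_mono) auto
    also note 1
    also have "2 * (2^k * x1) = 2^(Suc k) * x1" by simp
    finally show ?case .
  qed simp
  define C where "C = G x1 * (x1 / 2) powr \<gamma>"
  have "C * x powr (- \<gamma>) \<le> G x" if x: "x \<ge> x1" for x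
  proof -
    obtain k where k: "2^k * x1 \<le> x" "x < 2^(Suc k) * x1" using dyadic_scale[OF x1(1) x] by blast
    have "C * x powr (- \<gamma>) = G x1 * (2 * x / x1) powr (- \<gamma>)"
      using x x1 by (simp add: C_def powr_divide powr_minus powr_mult field_simps)
    also have "\<dots> \<le> G x1 * (2^(Suc k)) powr (- \<gamma>)"
    proof -
      have "2^(Suc k) \<le> 2 * x / x1" using k x1 by (simp add: field_simps)
      then have "(2 * x / x1) powr (- \<gamma>) \<le> (2^(Suc k)) powr (- \<gamma>)"
        using g by (intro powr_mono2') auto
      then show ?thesis using x0[of x1] x1 by (intro mult_left_mono) auto
    qed
    also have "(2^(Suc k)) powr (- \<gamma>) = (2 powr (- \<gamma>))^(Suc k)"
      by (rule two_power_powr)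
    also have "G x1 * (2 powr (- \<gamma>))^(Suc k) \<le> G (2^(Suc k) * x1)" using it[of "Suc k"] by (simp add: mult_ac)
    also have "\<dots> \<le> G x" using k x x1 by (intro tail_antimono) auto
    finally show ?thesis .
  qed
  moreover have "C > 0" using x0[of x1] x1 by (simp add: C_def)
  ultimately show ?thesis using x1 by blast
qed

text \<open>Dyadic blocks of \<open>\<bar>y\<bar>\<close> contribute a geometric series, by the bound on the tail with an exponent between \<open>\<gamma>\<close> and \<open>\<alpha>\<close>.\<close>

lemma moments_finite:
  assumes "0 < \<gamma>" "\<gamma> < \<alpha>"
  shows "integrable N (\<lambda>y. \<bar>y\<bar> powr \<gamma>)"
proof -
  define \<eta> where "\<eta> = (\<gamma> + \<alpha>) / 2"
  have \<eta>: "\<gamma> < \<eta>" "\<eta> < \<alpha>" "\<eta> > 0" using assms by (auto simp: \<eta>_def)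
  obtain C x1 where C: "C > 0" "x1 > 0" "\<And>x. x \<ge> x1 \<Longrightarrow> G x \<le> C * x powr (- \<eta>)"
    using tail_upper[OF \<eta>(2,3)] by auto
  define A where "A k = {y. 2^k * x1 < \<bar>y\<bar>}" for k :: nat
  define c where "c k = (2^(Suc k) * x1) powr \<gamma>" for k :: nat
  define f where "f k y = c k * indicator (A k) y" for k and y :: real
  have A [measurable]: "A k \<in> sets N" for k unfolding A_def by (rule tail_sets)
  have c0: "0 \<le> c k" for k by (simp add: c_def)
  have f0: "0 \<le> f k y" for k y by (simp add: f_def c0)
  have fm [measurable]: "f k \<in> borel_measurable N" for k unfolding f_def[abs_def] by measurable
  have m: "(\<lambda>y. \<bar>y\<bar> powr \<gamma>) \<in> borel_measurable N"
    unfolding measurable_cong_sets[OF sets_law refl] by measurable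
  have geo: "c k * measure N (A k) \<le> C * 2 powr \<gamma> * x1 powr (\<gamma> - \<eta>) * (2 powr (\<gamma> - \<eta>))^k" for k
  proof -
    have "x1 \<le> 2^k * x1" using C(2) by simp
    then have "measure N (A k) \<le> C * (2^k * x1) powr (- \<eta>)"
      using tail_def[of "2^k * x1"] C(2) C(3)[of "2^k * x1"] by (simp add: A_def)
    then have "c k * measure N (A k) \<le> c k * (C * (2^k * x1) powr (- \<eta>))" by (intro mult_left_mono c0)
    also have "\<dots> = C * 2 powr \<gamma> * x1 powr (\<gamma> - \<eta>) * (2 powr (\<gamma> - \<eta>))^k"
    proof -
      define u where "u = 2^k * x1"
      have u: "u > 0" using C(2) by (simp add: u_def)
      have "c k * (C * (2^k * x1) powr (- \<eta>)) = (2 * u) powr \<gamma> * (C * u powr (- \<eta>))"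
        by (simp add: u_def c_def mult.assoc)
      also have "\<dots> = C * 2 powr \<gamma> * (u powr \<gamma> * u powr (- \<eta>))"
        using u by (simp add: powr_mult mult_ac)
      also have "u powr \<gamma> * u powr (- \<eta>) = u powr (\<gamma> - \<eta>)" by (simp flip: powr_add)
      also have "\<dots> = (2 powr (\<gamma> - \<eta>))^k * x1 powr (\<gamma> - \<eta>)"
        using C(2) by (simp add: u_def powr_mult two_power_powr)
      finally show ?thesis by (simp add: mult_ac)
    qed
    finally show ?thesis .
  qed
  have nn: "(\<integral>\<^sup>+ y. ennreal (\<bar>y\<bar> powr \<gamma>) \<partial>N) < \<infinity>"
  proof -
    have sm: "summable (\<lambda>k. C * 2 powr \<gamma> * x1 powr (\<gamma> - \<eta>) * (2 powr (\<gamma> - \<eta>))^k)"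
      using \<eta> by (intro summable_mult summable_geometric) (simp add: powr_less_one)
    have s: "summable (\<lambda>k. c k * measure N (A k))"
      by (rule summable_comparison_test'[OF sm, of 0]) (use geo in \<open>simp add: c0\<close>)
    have "ennreal (\<bar>y\<bar> powr \<gamma>) \<le> ennreal (x1 powr \<gamma>) + (\<Sum>k. ennreal (f k y))" for y
    proof (cases "\<bar>y\<bar> \<le> x1")
      case True
      then have "\<bar>y\<bar> powr \<gamma> \<le> x1 powr \<gamma>" using assms by (intro powr_mono2) auto
      then show ?thesis by (intro add_increasing2) auto
    next
      case False
      then have y: "x1 < \<bar>y\<bar>" by simp
      obtain k where k: "2^k * x1 < \<bar>y\<bar>" "\<bar>y\<bar> \<le> 2^(Suc k) * x1"
      proof -
        obtain j where j: "2^j * x1 \<le> \<bar>y\<bar>" "\<bar>y\<bar> < 2^(Suc j) * x1" using dyadic_scale[of x1 "\<bar>y\<bar>"] C(2) y by auto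
        show ?thesis
        proof (cases "2^j * x1 = \<bar>y\<bar>")
          case True
          then obtain i where i: "j = Suc i" using y by (cases j) auto
          have "\<bar>y\<bar> = 2 * (2^i * x1)" using True i by simp
          moreover have "0 < 2^i * x1" using C(2) by simp
          ultimately have "2^i * x1 < \<bar>y\<bar>" by linarith
          moreover have "\<bar>y\<bar> \<le> 2^(Suc i) * x1" using True unfolding i by simp
          ultimately show ?thesis by (rule that)
        next
          case False
          then show ?thesis using that[of j] j by simp
        qed
      qed
      have "\<bar>y\<bar> powr \<gamma> \<le> c k" unfolding c_def using k(2) assms by (intro powr_mono2) auto
      then have "\<bar>y\<bar> powr \<gamma> \<le> f k y" using k(1) by (simp add: f_def A_def)
      then have "ennreal (\<bar>y\<bar> powr \<gamma>) \<le> ennreal (f k y)" by (rule ennreal_leI)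
      also have "\<dots> \<le> (\<Sum>k. ennreal (f k y))"
        using sum_le_suminf[of "\<lambda>k. ennreal (f k y)" "{k}"] by (simp add: summableI)
      finally show ?thesis by (intro add_increasing) auto
    qed
    then have "(\<integral>\<^sup>+ y. ennreal (\<bar>y\<bar> powr \<gamma>) \<partial>N) \<le> (\<integral>\<^sup>+ y. ennreal (x1 powr \<gamma>) + (\<Sum>k. ennreal (f k y)) \<partial>N)"
      by (intro nn_integral_mono)
    also have "\<dots> = ennreal (x1 powr \<gamma>) + (\<integral>\<^sup>+ y. (\<Sum>k. ennreal (f k y)) \<partial>N)"
      by (subst nn_integral_add) (simp_all add: emeasure_space_1)
    also have "(\<integral>\<^sup>+ y. (\<Sum>k. ennreal (f k y)) \<partial>N) = (\<Sum>k. \<integral>\<^sup>+ y. ennreal (f k y) \<partial>N)"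
      by (rule nn_integral_suminf) measurable
    also have "\<dots> = (\<Sum>k. ennreal (c k * measure N (A k)))"
    proof (rule suminf_cong)
      fix k
      have "(\<integral>\<^sup>+ y. ennreal (f k y) \<partial>N) = (\<integral>\<^sup>+ y. ennreal (c k) * indicator (A k) y \<partial>N)"
        by (intro nn_integral_cong) (simp add: f_def split: split_indicator)
      also have "\<dots> = ennreal (c k) * emeasure N (A k)"
        by (rule nn_integral_cmult_indicator[OF A])
      finally show "(\<integral>\<^sup>+ y. ennreal (f k y) \<partial>N) = ennreal (c k * measure N (A k))"
        by (simp add: emeasure_eq_measure ennreal_mult c0)
    qed
    also have "\<dots> = ennreal (\<Sum>k. c k * measure N (A k))"
      by (rule suminf_ennreal2) (use s c0 in simp_all)
    also have "ennreal (x1 powr \<gamma>) + ennreal (\<Sum>k. c k * measure N (A k)) < \<infinity>" by simp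
    finally show ?thesis .
  qed
  show ?thesis by (rule integrableI_nonneg[OF m]) (use nn in simp_all)
qed

end

locale regularly_varying_entries = regularly_varying_law N \<alpha> G for N \<alpha> G +
  assumes symmetric_law: "distr N borel uminus = N"
    and law_nonzero: "AE x in N. x \<noteq> 0"
begin

lemma entries: "n \<ge> 2 \<Longrightarrow> symmetric_entries N n"
  by unfold_locales (use symmetric_law law_nonzero sets_law in auto)

definition weight_exponent :: real where
  "weight_exponent = max 1 (\<alpha> / 2)"

lemma weight_exponent_ge: "weight_exponent \<ge> 1" "weight_exponent \<ge> \<alpha> / 2"
  by (auto simp: weight_exponent_def)

lemma eventually_const_powr_le:
  assumes "s < t"
  shows "eventually (\<lambda>n. C * real n powr s \<le> real n powr t) sequentially"
proof -
  have "((\<lambda>n. C * real n powr (s - t)) \<longlongrightarrow> C * 0) sequentially"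
    by (intro tendsto_mult tendsto_const tendsto_neg_powr filterlim_real_sequentially) (use assms in auto)
  then have "eventually (\<lambda>n. C * real n powr (s - t) < 1) sequentially"
    by (rule order_tendstoD) simp
  then show ?thesis using eventually_gt_at_top[of 0]
  proof eventually_elim
    case (elim n)
    have "C * real n powr s = (C * real n powr (s - t)) * real n powr t"
      using elim by (simp add: mult.assoc flip: powr_add)
    also have "\<dots> \<le> 1 * real n powr t" using elim by (intro mult_right_mono) auto
    finally show ?case by simp
  qed
qed

text \<open>
  The threshold \<open>b\<close> is a power of \<open>n\<close> with exponent slightly above \<open>max 1 (2 / \<alpha>)\<close>, the exponent of a typical sum of
  \<open>n\<close> squares. Then the Markov term in \<open>dominance_prob_lower\<close> tends to 0, and the tail at \<open>3 sqrt b\<close> has the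
  required order.
\<close>

lemma eventually_dominance_ge:
  assumes \<epsilon>: "\<epsilon> > 0"
  shows "eventually (\<lambda>n. symmetric_entries.dominance_prob N n \<ge> real n powr (- weight_exponent - \<epsilon>)) sequentially"
proof -
  define a where "a = weight_exponent"
  have a: "a \<ge> 1" "a \<ge> \<alpha> / 2" using weight_exponent_ge by (auto simp: a_def)
  \<comment> \<open>The relative slack \<open>z\<close> is spent on the exponent of \<open>b\<close> and on the tail exponent, half of it on \<open>\<theta>\<close>.\<close>
  define z where "z = min 1 (\<epsilon> / (4 * a))"
  have z: "0 < z" "z \<le> 1" "z \<le> \<epsilon> / (4 * a)" using a \<epsilon> by (auto simp: z_def)
  define \<kappa> where "\<kappa> = 2 * a / \<alpha> * (1 + z)"
  define \<gamma> where "\<gamma> = \<alpha> * (1 + z)"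
  define \<theta> where "\<theta> = \<alpha> / (2 * a) / (1 + z / 2)"
  have \<gamma>: "\<gamma> > \<alpha>" using alpha_pos z by (simp add: \<gamma>_def)
  have \<kappa>0: "\<kappa> > 0" using a z alpha_pos by (simp add: \<kappa>_def)
  have \<theta>: "0 < \<theta>" "\<theta> \<le> 1" "2 * \<theta> < \<alpha>" "1 < \<kappa> * \<theta>"
  proof -
    show "0 < \<theta>" using a z alpha_pos by (simp add: \<theta>_def)
    have "\<theta> \<le> (\<alpha> / (2 * a)) / 1" unfolding \<theta>_def
      using z a alpha_pos by (intro divide_left_mono) auto
    also have "\<dots> \<le> 1" using a by (simp add: field_simps)
    finally show "\<theta> \<le> 1" .
    have "1 < 1 * (1 + z / 2)" using z by simp
    also have "\<dots> \<le> a * (1 + z / 2)" using a z by (intro mult_right_mono) auto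
    finally have "1 < a * (1 + z / 2)" .
    then have "\<alpha> / (a * (1 + z / 2)) < \<alpha> / 1"
      using alpha_pos by (intro divide_strict_left_mono) auto
    then show "2 * \<theta> < \<alpha>" by (simp add: \<theta>_def)
    have "\<kappa> * \<theta> = (1 + z) / (1 + z / 2)" using a z alpha_pos by (simp add: \<kappa>_def \<theta>_def)
    moreover have "1 < (1 + z) / (1 + z / 2)" using z by (simp add: pos_less_divide_eq)
    ultimately show "1 < \<kappa> * \<theta>" by simp
  qed
  have ex: "\<kappa> * \<gamma> / 2 < a + \<epsilon>"
  proof -
    have "\<kappa> * \<gamma> / 2 = a * (1 + z)^2" using alpha_pos by (simp add: \<kappa>_def \<gamma>_def power2_eq_square)
    also have "\<dots> = a + a * (2 * z + z * z)" by (simp add: power2_eq_square algebra_simps)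
    also have "\<dots> \<le> a + a * (3 * z)"
      using a z by (intro add_left_mono mult_left_mono) (auto simp: mult_left_le)
    also have "\<dots> \<le> a + a * (3 * (\<epsilon> / (4 * a)))" using a z by (intro add_left_mono mult_left_mono) auto
    also have "\<dots> < a + \<epsilon>" using a \<epsilon> by simp
    finally show ?thesis .
  qed
  obtain C x1 where C: "C > 0" "x1 > 0" "\<And>x. x \<ge> x1 \<Longrightarrow> C * x powr (- \<gamma>) \<le> G x"
    using tail_lower[OF \<gamma>] by auto
  define \<mu> where "\<mu> = (\<integral>y. \<bar>y\<bar> powr (2 * \<theta>) \<partial>N)"
  have int: "integrable N (\<lambda>y. \<bar>y\<bar> powr (2 * \<theta>))" by (rule moments_finite) (use \<theta> in auto)
  have e1: "eventually (\<lambda>n. 3 * real n powr (\<kappa> / 2) \<ge> x1) sequentially"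
  proof -
    have "filterlim (\<lambda>n. 3 * real n powr (\<kappa> / 2)) at_top sequentially"
      using \<kappa>0 by real_asymp
    then show ?thesis by (simp add: filterlim_at_top)
  qed
  have e2: "eventually (\<lambda>n. 2 * \<mu> * real n powr (1 - \<kappa> * \<theta>) \<le> real n powr 0) sequentially"
    by (rule eventually_const_powr_le) (use \<theta> in auto)
  have e3: "eventually (\<lambda>n. 2 / (C * 3 powr (- \<gamma>)) * real n powr (- a - \<epsilon>) \<le> real n powr (- (\<kappa> * \<gamma> / 2))) sequentially"
    by (rule eventually_const_powr_le) (use ex in auto)
  show ?thesis using e1 e2 e3 eventually_ge_at_top[of 2]
  proof eventually_elim
    case (elim n)
    interpret symmetric_entries N n using elim by (intro entries)
    define b where "b = real n powr \<kappa>"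
    have n: "real n > 0" using elim by simp
    have b: "b > 0" using n by (simp add: b_def)
    define q where "q = measure N {y. y^2 \<ge> 9 * b}"
    have q: "q \<ge> C * 3 powr (- \<gamma>) * real n powr (- (\<kappa> * \<gamma> / 2))"
    proof -
      let ?x = "3 * real n powr (\<kappa> / 2)"
      have x0: "?x > 0" using n by simp
      have xx: "?x^2 = 9 * b" using n by (simp add: power_mult_distrib b_def power2_eq_square flip: powr_add)
      have "C * 3 powr (- \<gamma>) * real n powr (- (\<kappa> * \<gamma> / 2)) = C * ?x powr (- \<gamma>)"
        using n by (simp add: powr_mult powr_powr)
      also have "\<dots> \<le> measure N {y. \<bar>y\<bar> > ?x}" using C(3)[of ?x] elim tail_def[OF x0] by simp
      also have "\<dots> \<le> q" unfolding q_def
      proof (rule finite_measure_mono)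
        show "{y. \<bar>y\<bar> > ?x} \<subseteq> {y. y^2 \<ge> 9 * b}"
        proof
          fix y assume "y \<in> {y. \<bar>y\<bar> > ?x}"
          then have "\<bar>?x\<bar> \<le> \<bar>y\<bar>" using x0 by simp
          then have "?x^2 \<le> y^2" by (simp only: abs_le_square_iff)
          then show "y \<in> {y. y^2 \<ge> 9 * b}" unfolding xx by simp
        qed
        have "{y\<in>space borel. y^2 \<ge> 9 * b} \<in> sets (borel::real measure)" by measurable
        then show "{y. y^2 \<ge> 9 * b} \<in> sets N" by (simp add: sets_law)
      qed
      finally show ?thesis .
    qed
    have half: "1 / 2 \<le> 1 - n * \<mu> / b powr \<theta>"
    proof -
      have "n * \<mu> / b powr \<theta> = \<mu> * real n powr (1 - \<kappa> * \<theta>)"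
        using n by (simp add: b_def powr_powr powr_diff)
      then show ?thesis using elim(2) n by simp
    qed
    have q0: "q \<ge> 0" by (simp add: q_def)
    have "real n powr (- a - \<epsilon>) \<le> C * 3 powr (- \<gamma>) * real n powr (- (\<kappa> * \<gamma> / 2)) / 2"
      using elim(3) C(1) by (simp add: field_simps)
    also have "\<dots> \<le> q * (1 / 2)" using q by simp
    also have "\<dots> \<le> q * (1 - n * \<mu> / b powr \<theta>)" using half q0 by (intro mult_left_mono) auto
    also have "\<dots> \<le> dominance_prob"
      using dominance_prob_lower[OF b \<theta>(1,2) int] by (simp add: q_def \<mu>_def)
    finally show ?case by (simp add: a_def)
  qed
qed

text \<open>
  For \<open>\<alpha> \<le> 2\<close> the trivial bound \<open>1 / n\<close> is of the right order. Otherwise take \<open>\<beta>\<close> slightly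
  below \<open>\<alpha> / 2\<close> in \<open>m4_upper\<close>.
\<close>

lemma eventually_m4_le:
  assumes \<epsilon>: "\<epsilon> > 0" and "\<alpha> < 4"
  shows "eventually (\<lambda>n. symmetric_entries.m4 N n \<le> real n powr (- weight_exponent + \<epsilon>)) sequentially"
proof (cases "\<alpha> \<le> 2")
  case True
  then have a: "weight_exponent = 1" by (simp add: weight_exponent_def)
  show ?thesis using eventually_ge_at_top[of 2]
  proof eventually_elim
    case (elim n)
    interpret symmetric_entries N n using elim by (intro entries)
    have "m4 \<le> real n powr (-1)" using m4_le elim by (simp add: powr_minus_divide)
    also have "\<dots> \<le> real n powr (- 1 + \<epsilon>)" using elim \<epsilon> by (intro powr_mono) auto
    finally show ?case by (simp add: a)
  qed
next
  case False
  then have a: "weight_exponent = \<alpha> / 2" by (simp add: weight_exponent_def)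
  define \<beta> where "\<beta> = \<alpha> / 2 - min (\<epsilon> / 2) (\<alpha> / 4)"
  have \<beta>: "0 < \<beta>" "\<beta> \<le> 2" "2 * \<beta> < \<alpha>" "- \<beta> < - (\<alpha> / 2) + \<epsilon>"
    using \<epsilon> assms False by (auto simp: \<beta>_def min_def)
  define \<mu> where "\<mu> = (\<integral>y. \<bar>y\<bar> powr (2 * \<beta>) \<partial>N)"
  define \<rho> where "\<rho> = (\<integral>y. exp (- (y^2)) \<partial>N)"
  interpret S2: symmetric_entries N 2 by (rule entries) simp
  have \<rho>: "0 < \<rho>" "\<rho> < 1" unfolding \<rho>_def by (rule S2.exp_moment_lt_1)+
  \<comment> \<open>With this \<open>c\<close> the Chernoff bound \<open>exp (c n) \<rho> ^ (n - 1)\<close> decays like \<open>exp (- c n)\<close>.\<close>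
  define c where "c = - ln \<rho> / 2"
  have c: "c > 0" using \<rho> by (simp add: c_def)
  have \<rho>c: "\<rho> = exp (- (2 * c))" using \<rho> by (simp add: c_def)
  have int: "integrable N (\<lambda>y. \<bar>y\<bar> powr (2 * \<beta>))" by (rule moments_finite) (use \<beta> in auto)
  have e1: "eventually (\<lambda>n. exp (2 * c - c * real n) \<le> real n powr (- 2) / 2) sequentially"
    using c by real_asymp
  have e2: "eventually (\<lambda>n. 2 * (\<mu> / c powr \<beta>) * real n powr (- \<beta>) \<le> real n powr (- (\<alpha> / 2) + \<epsilon>)) sequentially"
    by (rule eventually_const_powr_le) (use \<beta> in auto)
  show ?thesis using e1 e2 eventually_ge_at_top[of 2]
  proof eventually_elim
    case (elim n)
    interpret symmetric_entries N n using elim by (intro entries)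
    have n: "real n > 0" using elim by simp
    have "exp (c * n) * \<rho> ^ (n - 1) = exp (2 * c - c * real n)"
    proof -
      have "\<rho> ^ (n - 1) = exp (real (n - 1) * (- (2 * c)))" unfolding \<rho>c by (rule exp_of_nat_mult[symmetric])
      then have "exp (c * n) * \<rho> ^ (n - 1) = exp (c * n + real (n - 1) * (- (2 * c)))" by (simp only: exp_add)
      also have "c * n + real (n - 1) * (- (2 * c)) = 2 * c - c * n"
        using elim by (simp add: of_nat_diff algebra_simps)
      finally show ?thesis .
    qed
    moreover have "\<mu> / (c * n) powr \<beta> = (\<mu> / c powr \<beta>) * real n powr (- \<beta>)"
      using n c by (simp add: powr_mult powr_minus field_simps)
    ultimately have "m4 \<le> exp (2 * c - c * real n) + (\<mu> / c powr \<beta>) * real n powr (- \<beta>)"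
      using m4_upper[OF \<beta>(1,2) c int] by (simp add: \<rho>_def \<mu>_def)
    also have "\<dots> \<le> real n powr (- (\<alpha> / 2) + \<epsilon>) / 2 + real n powr (- (\<alpha> / 2) + \<epsilon>) / 2"
    proof (rule add_mono)
      have "real n powr (- 2) \<le> real n powr (- (\<alpha> / 2) + \<epsilon>)"
        using elim \<epsilon> assms(2) by (intro powr_mono) auto
      then show "exp (2 * c - c * real n) \<le> real n powr (- (\<alpha> / 2) + \<epsilon>) / 2" using elim(1) by linarith
      show "(\<mu> / c powr \<beta>) * real n powr (- \<beta>) \<le> real n powr (- (\<alpha> / 2) + \<epsilon>) / 2"
        using elim(2) by (simp add: mult_ac)
    qed
    finally show ?case by (simp add: a)
  qed
qed

end

section \<open>Kurtosis along sequences of samples\<close>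

text \<open>The bound first shows that \<open>K\<close> stays bounded; then \<open>t\<close> can be chosen small.\<close>

lemma tendsto_3_of_relative_bound:
  fixes K a b :: "nat \<Rightarrow> real"
  assumes bound: "eventually (\<lambda>n. \<forall>t. 0 < t \<and> t \<le> 1 \<longrightarrow> \<bar>K n - 3\<bar> \<le> t * K n + a n + b n / t) sequentially"
    and a: "a \<longlonglongrightarrow> 0" and b: "b \<longlonglongrightarrow> 0"
  shows "K \<longlonglongrightarrow> 3"
proof (rule tendstoI)
  fix e :: real assume e: "e > 0"
  define t where "t = min (1 / 2) (e / 12)"
  have t: "0 < t" "t \<le> 1 / 2" "6 * t \<le> e / 2" using e by (auto simp: t_def)
  have "(\<lambda>n. 2 * a n + 2 * b n / t) \<longlonglongrightarrow> 2 * 0 + 2 * 0 / t"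
    using t by (intro tendsto_intros a b) auto
  then have "eventually (\<lambda>n. 2 * a n + 2 * b n / t < e / 2) sequentially"
    by (rule order_tendstoD) (use e in simp)
  then show "eventually (\<lambda>n. dist (K n) 3 < e) sequentially" using bound
  proof eventually_elim
    case (elim n)
    have "\<bar>K n - 3\<bar> \<le> t * K n + a n + b n / t" using elim(2) t by auto
    also have "t * K n \<le> t * (\<bar>K n - 3\<bar> + 3)" using t by (intro mult_left_mono) auto
    also have "\<dots> \<le> \<bar>K n - 3\<bar> / 2 + 3 * t"
      using t mult_right_mono[of t "1/2" "\<bar>K n - 3\<bar>"] by (simp add: algebra_simps)
    finally have "\<bar>K n - 3\<bar> \<le> 6 * t + 2 * a n + 2 * b n / t" by simp
    then show ?case using elim(1) t by (simp add: dist_real_def)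
  qed
qed

context degenerate_kernel
begin

lemma U_m2_eq: "U_m2 p = real p * (real p - 1) / 2 * kernel_m2"
  unfolding U_m2_def by (rule U_stat_second_moment)

lemma kurtosis_close:
  assumes V: "kernel_m2 > 0" and p: "p \<ge> 2" and t: "0 < t" "t \<le> 1"
  shows "\<bar>U_m4 p / (U_m2 p)^2 - 3\<bar> \<le> t * (U_m4 p / (U_m2 p)^2) + 48 / p
     + 1152 * (kernel_m4 / (p^2 * kernel_m2^2) + wedge_m4 / (p * kernel_m2^2) + cycle_m4 / kernel_m2^2) / t"
proof -
  define r where "r = real p"
  define W where "W = r^4 * kernel_m2^2 / 16"
  have r: "r \<ge> 2" using p by (simp add: r_def)
  have W: "W > 0" using r V by (simp add: W_def)
  have v: "(U_m2 p)^2 \<ge> W"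
  proof -
    have "r * (r / 2) / 2 * kernel_m2 \<le> U_m2 p"
      unfolding U_m2_eq r_def[symmetric] using r V by (intro mult_right_mono divide_right_mono mult_left_mono) auto
    then have "(r * (r / 2) / 2 * kernel_m2)^2 \<le> (U_m2 p)^2" using r V by (intro power_mono) auto
    then show ?thesis by (simp add: W_def power_mult_distrib power_divide eval_nat_numeral mult_ac)
  qed
  then have v0: "(U_m2 p)^2 > 0" using W by linarith
  let ?R = "3 * r^3 * kernel_m2^2 + 72 / t * (r^2 * kernel_m4 + r^3 * wedge_m4 + r^4 * cycle_m4)"
  have R0: "?R \<ge> 0" using r t wedge_m4_nonneg kernel_m4_nonneg cycle_m4_nonneg
    by (intro add_nonneg_nonneg mult_nonneg_nonneg) auto
  have "\<bar>U_m4 p - 3 * (U_m2 p)^2\<bar> \<le> t * U_m4 p + ?R"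
    using U_m4_close[OF t, of p] by (simp add: r_def)
  then have "\<bar>U_m4 p - 3 * (U_m2 p)^2\<bar> / (U_m2 p)^2 \<le> (t * U_m4 p + ?R) / (U_m2 p)^2"
    using v0 by (intro divide_right_mono) auto
  also have "\<bar>U_m4 p - 3 * (U_m2 p)^2\<bar> / (U_m2 p)^2 = \<bar>U_m4 p / (U_m2 p)^2 - 3\<bar>"
  proof -
    have "\<bar>U_m4 p / (U_m2 p)^2 - 3\<bar> = \<bar>(U_m4 p - 3 * (U_m2 p)^2) / (U_m2 p)^2\<bar>"
      using v0 by (simp add: diff_divide_distrib)
    then show ?thesis by (simp add: abs_divide)
  qed
  also have "(t * U_m4 p + ?R) / (U_m2 p)^2 = t * (U_m4 p / (U_m2 p)^2) + ?R / (U_m2 p)^2"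
    by (simp add: add_divide_distrib)
  also have "?R / (U_m2 p)^2 \<le> ?R / W" by (intro divide_left_mono R0 v mult_pos_pos v0 W)
  also have "?R / W = 48 / r + 1152 * (kernel_m4 / (r^2 * kernel_m2^2) + wedge_m4 / (r * kernel_m2^2) + cycle_m4 / kernel_m2^2) / t"
  proof -
    have "3 * r^3 * kernel_m2^2 / W = 48 / r"
      using r V by (simp add: W_def field_simps eval_nat_numeral)
    moreover have "r^2 * kernel_m4 / W = 16 * (kernel_m4 / (r^2 * kernel_m2^2))"
      using r V by (simp add: W_def field_simps eval_nat_numeral)
    moreover have "r^3 * wedge_m4 / W = 16 * (wedge_m4 / (r * kernel_m2^2))"
      using r V by (simp add: W_def field_simps eval_nat_numeral)
    moreover have "r^4 * cycle_m4 / W = 16 * (cycle_m4 / kernel_m2^2)"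
      using r V by (simp add: W_def field_simps eval_nat_numeral)
    moreover have "?R / W = 3 * r^3 * kernel_m2^2 / W + 72 / t * (r^2 * kernel_m4 / W + r^3 * wedge_m4 / W + r^4 * cycle_m4 / W)"
      by (simp add: add_divide_distrib mult.commute)
    ultimately show ?thesis by simp
  qed
  finally show ?thesis by (simp add: r_def)
qed

lemma kurtosis_lower:
  assumes V: "kernel_m2 > 0" and p: "p \<ge> 2"
  shows "U_m4 p / (U_m2 p)^2 \<ge> 2 / 3 * (kernel_m4 / (p^2 * kernel_m2^2))"
proof -
  define r where "r = real p"
  have r: "r \<ge> 2" using p by (simp add: r_def)
  have v0: "(U_m2 p)^2 > 0" using r V unfolding U_m2_eq r_def[symmetric] by simp
  have "2 / 3 * (kernel_m4 / (r^2 * kernel_m2^2)) \<le> 2 / 3 * (kernel_m4 / (r * (r - 1) * kernel_m2^2))"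
    using r V kernel_m4_nonneg
    by (intro mult_left_mono divide_left_mono mult_right_mono mult_pos_pos) (auto simp: power2_eq_square algebra_simps)
  also have "\<dots> = (r * (r - 1) / 6 * kernel_m4) / (U_m2 p)^2"
  proof -
    have "2 / 3 * (A / (z * V^2)) = (z / 6 * A) / (z / 2 * V)^2" if "z > 0" "V > 0" for z A V :: real
      using that by (simp add: field_simps power2_eq_square)
    from this[of "r * (r - 1)" kernel_m2 kernel_m4] show ?thesis
      unfolding U_m2_eq r_def[symmetric] using r V by simp
  qed
  also have "\<dots> \<le> U_m4 p / (U_m2 p)^2"
    using U_m4_lower[of p] v0 by (intro divide_right_mono) (auto simp: r_def)
  finally show ?thesis by (simp add: r_def)
qed

end

context symmetric_entries
begin

lemma kernel_m2_pos: "n \<ge> 8 \<Longrightarrow> K.kernel_m2 > 0"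
proof -
  assume "n \<ge> 8"
  then have "(n * m4^2 + 1 / n^2) / 2 \<le> K.kernel_m2" by (intro kernel_m2_lower) simp
  moreover have "0 < (n * m4^2 + 1 / n^2) / 2" using n_pos by (simp add: add_nonneg_pos)
  ultimately show ?thesis by (rule less_le_trans[rotated])
qed

lemma m4_sq_le: "n \<ge> 8 \<Longrightarrow> n * m4^2 \<le> 2 * K.kernel_m2"
  and inverse_n_sq_le: "n \<ge> 8 \<Longrightarrow> 1 / real n^2 \<le> 2 * K.kernel_m2"
proof -
  assume n: "n \<ge> 8"
  have a: "0 \<le> n * m4^2" "0 \<le> 1 / real n^2" by auto
  have l: "(n * m4^2 + 1 / real n^2) / 2 \<le> K.kernel_m2" using kernel_m2_lower n by simp
  have "x \<le> 2 * v" "y \<le> 2 * v" if "0 \<le> x" "0 \<le> y" "(x + y) / 2 \<le> v" for x y v :: real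
    using that by (simp_all add: field_simps)
  from this[OF a l] show "n * m4^2 \<le> 2 * K.kernel_m2" "1 / real n^2 \<le> 2 * K.kernel_m2" by -
qed

lemma m22_sq_le: "n \<ge> 8 \<Longrightarrow> m22^2 \<le> 4 / real n^2 * (1 / real n^2)"
proof -
  have "m22 \<le> 1 / (n * (real n - 1))" by (rule m22_le)
  also have "\<dots> \<le> 1 / (n * (real n / 2))" using n_pos by (intro divide_left_mono mult_left_mono) auto
  finally have "m22^2 \<le> (1 / (n * (real n / 2)))^2" using m22_nonneg by (intro power_mono) auto
  then show ?thesis by (simp add: power2_eq_square)
qed

text \<open>The prefactor in \<open>cycle_m4_le\<close> is of order \<open>m4\<^sup>2 + m22\<^sup>2\<close>, and both squares are \<open>O (V / n)\<close>.\<close>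

lemma cycle_ratio:
  assumes "n \<ge> 8"
  shows "K.cycle_m4 / K.kernel_m2^2 \<le> 212 / n"
proof -
  let ?V = "K.kernel_m2"
  have V: "?V > 0" by (rule kernel_m2_pos[OF assms])
  have m: "m4^2 \<le> 2 * ?V / n" using m4_sq_le[OF assms] n_pos by (simp add: field_simps)
  have "m22^2 \<le> 4 / real n^2 * (1 / real n^2)" by (rule m22_sq_le[OF assms])
  also have "\<dots> \<le> 4 / real n^2 * (2 * ?V)"
    by (intro mult_left_mono inverse_n_sq_le[OF assms]) auto
  also have "\<dots> \<le> 4 / real n * (2 * ?V)"
    using V n_pos by (intro mult_right_mono divide_left_mono) (auto simp: power2_eq_square)
  finally have m2: "m22^2 \<le> 8 * ?V / n" by simp
  have "(m4 - 3 * m22)^2 \<le> m4^2 + 9 * m22^2"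
    using m4_nonneg m22_nonneg by (simp add: power2_diff power_mult_distrib)
  then have "2 * (m4 - 3 * m22)^2 + 8 * m22^2 \<le> 2 * m4^2 + 26 * m22^2" by simp
  also have "\<dots> \<le> 2 * (2 * ?V / n) + 26 * (8 * ?V / n)" using m m2 by linarith
  finally have "2 * (m4 - 3 * m22)^2 + 8 * m22^2 \<le> 212 * ?V / n" by simp
  then have "(2 * (m4 - 3 * m22)^2 + 8 * m22^2) * ?V \<le> 212 * ?V / n * ?V"
    using V by (intro mult_right_mono) auto
  with cycle_m4_le have "K.cycle_m4 \<le> 212 * ?V / n * ?V" by linarith
  then show ?thesis using V by (simp add: divide_le_eq power2_eq_square)
qed

text \<open>
  The main term \<open>n m4\<^sup>3\<close> is at most a multiple of \<open>V powr (3/2) / sqrt n\<close>, as \<open>n m4\<^sup>2 \<le> 2 V\<close>; this is where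
  the condition that \<open>p\<^sup>2 V n\<close> diverges comes from.
\<close>

lemma wedge_ratio:
  assumes "n \<ge> 8" and p: "p > 0"
  shows "K.wedge_m4 / (real p * K.kernel_m2^2) \<le> 288 / p + 2 * sqrt (8 / (real p^2 * K.kernel_m2 * n))"
proof -
  let ?V = "K.kernel_m2"
  have V: "?V > 0" by (rule kernel_m2_pos[OF assms(1)])
  have n: "real n > 0" using n_pos by simp
  \<comment> \<open>Squaring avoids fractional powers of \<open>V\<close>.\<close>
  have sq: "(n * m4^3 / (p * ?V^2))^2 \<le> 8 / (real p^2 * ?V * n)"
  proof -
    have "(n * m4^3)^2 * n = (n * m4^2)^3" by (simp add: eval_nat_numeral)
    also have "\<dots> \<le> (2 * ?V)^3" using m4_sq_le[OF assms(1)] by (intro power_mono) auto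
    finally have "(n * m4^3)^2 \<le> 8 * ?V^3 / n" using n by (simp add: pos_le_divide_eq power_mult_distrib)
    then have "(n * m4^3)^2 / (real p^2 * ?V^4) \<le> 8 * ?V^3 / n / (real p^2 * ?V^4)"
      by (intro divide_right_mono) auto
    also have "\<dots> = 8 / (real p^2 * ?V * n)" using V p n by (simp add: field_simps eval_nat_numeral)
    finally show ?thesis by (simp add: power_divide power_mult_distrib flip: power_mult)
  qed
  then have 1: "n * m4^3 / (p * ?V^2) \<le> sqrt (8 / (real p^2 * ?V * n))" by (rule real_le_rsqrt)
  have "m22^2 \<le> 4 * (1 / real n^2 * (1 / real n^2))" using m22_sq_le[OF assms(1)] by simp
  also have "\<dots> \<le> 4 * ((2 * ?V) * (2 * ?V))"
    by (intro mult_left_mono mult_mono inverse_n_sq_le[OF assms(1)]) (use V in auto)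
  finally have m: "m22^2 \<le> 16 * ?V^2" by (simp add: power2_eq_square)
  have "K.wedge_m4 \<le> 2 * n * m4^3 + 288 * ?V^2" using wedge_m4_le m by linarith
  then have "K.wedge_m4 / (real p * ?V^2) \<le> (2 * n * m4^3 + 288 * ?V^2) / (real p * ?V^2)"
    by (intro divide_right_mono) auto
  also have "\<dots> = 2 * (n * m4^3 / (p * ?V^2)) + 288 / p"
    using V p by (simp add: add_divide_distrib)
  finally show ?thesis using 1 by linarith
qed

end

context regularly_varying_entries
begin

abbreviation row_law_n :: "nat \<Rightarrow> (nat \<Rightarrow> real) measure" where
  "row_law_n n \<equiv> \<Pi>\<^sub>M i\<in>{..<n}. N"

definition kernel_var :: "nat \<Rightarrow> real" where
  "kernel_var n = degenerate_kernel.kernel_m2 (row_law_n n) (corr_kernel n)"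

definition kernel_fourth :: "nat \<Rightarrow> real" where
  "kernel_fourth n = degenerate_kernel.kernel_m4 (row_law_n n) (corr_kernel n)"

definition stat_kurtosis :: "nat \<Rightarrow> nat \<Rightarrow> real" where
  "stat_kurtosis n p = degenerate_kernel.U_m4 (row_law_n n) (corr_kernel n) p
     / (degenerate_kernel.U_m2 (row_law_n n) (corr_kernel n) p)^2"

lemma kurtosis_tendsto_3:
  fixes p :: "nat \<Rightarrow> nat"
  assumes p: "filterlim p at_top sequentially"
    and A: "(\<lambda>n. kernel_fourth n / (real (p n)^2 * kernel_var n^2)) \<longlonglongrightarrow> 0"
    and B: "filterlim (\<lambda>n. real (p n)^2 * kernel_var n * n) at_top sequentially"
  shows "(\<lambda>n. stat_kurtosis n (p n)) \<longlonglongrightarrow> 3"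
proof -
  have pr: "filterlim (\<lambda>n. real (p n)) at_top sequentially"
    by (rule filterlim_compose[OF filterlim_real_sequentially p])
  have inv: "(\<lambda>n. c / real (p n)) \<longlonglongrightarrow> 0" for c
    by (rule tendsto_divide_0[OF tendsto_const]) (rule filterlim_at_top_imp_at_infinity[OF pr])
  have invn: "(\<lambda>n. c / real n) \<longlonglongrightarrow> 0" for c :: real
    by (rule tendsto_divide_0[OF tendsto_const])
       (rule filterlim_at_top_imp_at_infinity[OF filterlim_real_sequentially])
  have sq: "(\<lambda>n. sqrt (8 / (real (p n)^2 * kernel_var n * n))) \<longlonglongrightarrow> 0"
  proof -
    have "(\<lambda>n. sqrt (8 / (real (p n)^2 * kernel_var n * n))) \<longlonglongrightarrow> sqrt 0"
      by (intro tendsto_real_sqrt tendsto_divide_0[OF tendsto_const] filterlim_at_top_imp_at_infinity[OF B])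
    then show ?thesis by simp
  qed
  define b where "b n = 1152 * (kernel_fourth n / (real (p n)^2 * kernel_var n^2)
     + (288 / real (p n) + 2 * sqrt (8 / (real (p n)^2 * kernel_var n * n))) + 212 / real n)" for n
  have "b \<longlonglongrightarrow> 1152 * (0 + (0 + 2 * 0) + 0)"
    unfolding b_def by (intro tendsto_intros A inv invn sq)
  then have b: "b \<longlonglongrightarrow> 0" by simp
  have ev: "eventually (\<lambda>n. n \<ge> 8 \<and> p n \<ge> 2) sequentially"
    using eventually_ge_at_top[of 8] p by (auto simp: filterlim_at_top eventually_conj_iff)
  show ?thesis
  proof (rule tendsto_3_of_relative_bound[OF _ inv b])
    show "eventually (\<lambda>n. \<forall>t. 0 < t \<and> t \<le> 1 \<longrightarrow>
      \<bar>stat_kurtosis n (p n) - 3\<bar> \<le> t * stat_kurtosis n (p n) + 48 / real (p n) + b n / t) sequentially"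
      using ev
    proof eventually_elim
      case (elim n)
      interpret symmetric_entries N n using elim by (intro entries) auto
      have n: "n \<ge> 8" using elim by simp
      show ?case
      proof (intro allI impI)
        fix t :: real assume t: "0 < t \<and> t \<le> 1"
        have "1152 * (K.kernel_m4 / (real (p n)^2 * K.kernel_m2^2) + K.wedge_m4 / (real (p n) * K.kernel_m2^2)
            + K.cycle_m4 / K.kernel_m2^2) \<le> b n"
          unfolding b_def kernel_fourth_def kernel_var_def
          using wedge_ratio[OF n, of "p n"] cycle_ratio[OF n] elim by (intro mult_left_mono add_mono) auto
        then have "1152 * (K.kernel_m4 / (real (p n)^2 * K.kernel_m2^2) + K.wedge_m4 / (real (p n) * K.kernel_m2^2)
            + K.cycle_m4 / K.kernel_m2^2) / t \<le> b n / t" using t by (intro divide_right_mono) auto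
        moreover have "\<bar>stat_kurtosis n (p n) - 3\<bar> \<le> t * stat_kurtosis n (p n) + 48 / real (p n)
          + 1152 * (K.kernel_m4 / (real (p n)^2 * K.kernel_m2^2) + K.wedge_m4 / (real (p n) * K.kernel_m2^2)
            + K.cycle_m4 / K.kernel_m2^2) / t"
          using K.kurtosis_close[OF kernel_m2_pos[OF n], of "p n" t] elim t
          by (simp add: stat_kurtosis_def)
        ultimately show "\<bar>stat_kurtosis n (p n) - 3\<bar> \<le> t * stat_kurtosis n (p n) + 48 / real (p n) + b n / t"
          by linarith
      qed
    qed
  qed
qed

lemma kurtosis_at_top:
  fixes p :: "nat \<Rightarrow> nat"
  assumes p: "filterlim p at_top sequentially"
    and A: "filterlim (\<lambda>n. kernel_fourth n / (real (p n)^2 * kernel_var n^2)) at_top sequentially"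
  shows "filterlim (\<lambda>n. stat_kurtosis n (p n)) at_top sequentially"
proof (rule filterlim_at_top_mono)
  show "filterlim (\<lambda>n. 2 / 3 * (kernel_fourth n / (real (p n)^2 * kernel_var n^2))) at_top sequentially"
    by (rule filterlim_tendsto_pos_mult_at_top[OF tendsto_const _ A]) simp
  have "eventually (\<lambda>n. n \<ge> 8 \<and> p n \<ge> 2) sequentially"
    using eventually_ge_at_top[of 8] p by (auto simp: filterlim_at_top eventually_conj_iff)
  then show "eventually (\<lambda>n. 2 / 3 * (kernel_fourth n / (real (p n)^2 * kernel_var n^2)) \<le> stat_kurtosis n (p n)) sequentially"
  proof eventually_elim
    case (elim n)
    interpret symmetric_entries N n using elim by (intro entries) auto
    show ?case
      using K.kurtosis_lower[OF kernel_m2_pos, of "p n"] elim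
      by (simp add: stat_kurtosis_def kernel_fourth_def kernel_var_def)
  qed
qed

end

section \<open>The two growth regimes\<close>

lemma mult_powr_square: "x > 0 \<Longrightarrow> x * (x powr e)^2 = x powr (1 + 2 * e)" for x e :: real
proof -
  assume x: "x > 0"
  have "x powr (1 + 2 * e) = x powr (1 + (e + e))" by simp
  also have "\<dots> = x powr 1 * (x powr e * x powr e)" by (simp only: powr_add)
  finally show ?thesis using x by (simp add: power2_eq_square)
qed

context regularly_varying_entries
begin

lemma kernel_var_pos: "n \<ge> 8 \<Longrightarrow> kernel_var n > 0"
proof -
  assume n: "n \<ge> 8"
  interpret symmetric_entries N n using n by (intro entries) auto
  show ?thesis unfolding kernel_var_def by (rule kernel_m2_pos[OF n])
qed

lemma kernel_fourth_nonneg: "n \<ge> 8 \<Longrightarrow> kernel_fourth n \<ge> 0"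
proof -
  assume n: "n \<ge> 8"
  interpret symmetric_entries N n using n by (intro entries) auto
  show ?thesis unfolding kernel_fourth_def by (rule K.kernel_m4_nonneg)
qed

lemma kernel_fourth_le_var: "n \<ge> 8 \<Longrightarrow> kernel_fourth n \<le> kernel_var n"
proof -
  assume n: "n \<ge> 8"
  interpret symmetric_entries N n using n by (intro entries) auto
  show ?thesis unfolding kernel_fourth_def kernel_var_def by (rule kernel_m4_le_m2)
qed

lemma kernel_var_ge_inverse: "n \<ge> 8 \<Longrightarrow> kernel_var n \<ge> real n powr (- 2) / 2"
proof -
  assume n: "n \<ge> 8"
  interpret symmetric_entries N n using n by (intro entries) auto
  show ?thesis using inverse_n_sq_le[OF n] n unfolding kernel_var_def by (simp add: powr_minus_divide)
qed

lemma eventually_kernel_var_ge: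
  assumes "\<epsilon> > 0"
  shows "eventually (\<lambda>n. kernel_var n \<ge> real n powr (1 - 2 * weight_exponent - 2 * \<epsilon>) / 8) sequentially"
  using eventually_dominance_ge[OF assms] eventually_ge_at_top[of 8]
proof eventually_elim
  case (elim n)
  interpret symmetric_entries N n using elim by (intro entries) auto
  have n: "n \<ge> 8" using elim by simp
  let ?x = "real n powr (- weight_exponent - \<epsilon>)"
  have "real n powr (1 - 2 * weight_exponent - 2 * \<epsilon>) = real n * ?x^2"
    using n by (subst mult_powr_square) (auto simp: algebra_simps)
  also have "\<dots> \<le> real n * (2 * m4)^2"
    using elim(1) m4_lower by (intro mult_left_mono power_mono) auto
  also have "\<dots> = 4 * (n * m4^2)" by (simp add: power_mult_distrib)
  also have "\<dots> \<le> 4 * (2 * K.kernel_m2)" using m4_sq_le[OF n] by simp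
  finally show ?case by (simp add: kernel_var_def)
qed

lemma eventually_kernel_var_le:
  assumes "\<epsilon> > 0" "\<alpha> < 4"
  shows "eventually (\<lambda>n. kernel_var n \<le> real n powr (1 - 2 * weight_exponent + 2 * \<epsilon>) + 6 * real n powr (- 2)) sequentially"
  using eventually_m4_le[OF assms] eventually_ge_at_top[of 8]
proof eventually_elim
  case (elim n)
  interpret symmetric_entries N n using elim by (intro entries) auto
  have n: "n \<ge> 8" using elim by simp
  let ?x = "real n powr (- weight_exponent + \<epsilon>)"
  have "real n * m4^2 \<le> real n * ?x^2" using elim(1) m4_nonneg by (intro mult_left_mono power_mono) auto
  also have "real n * ?x^2 = real n powr (1 - 2 * weight_exponent + 2 * \<epsilon>)"
    using n by (subst mult_powr_square) (auto simp: algebra_simps)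
  finally show ?case using kernel_m2_upper n unfolding kernel_var_def
    by (simp add: powr_minus_divide)
qed

lemma eventually_kernel_fourth_ge:
  assumes "\<epsilon> > 0"
  shows "eventually (\<lambda>n. kernel_fourth n \<ge> real n powr (1 - 2 * weight_exponent - 2 * \<epsilon>) / 16) sequentially"
  using eventually_dominance_ge[OF assms] eventually_ge_at_top[of 8]
proof eventually_elim
  case (elim n)
  interpret symmetric_entries N n using elim by (intro entries) auto
  have n: "n \<ge> 8" using elim by simp
  let ?x = "real n powr (- weight_exponent - \<epsilon>)"
  have "real n powr (1 - 2 * weight_exponent - 2 * \<epsilon>) = real n * ?x^2"
    using n by (subst mult_powr_square) (auto simp: algebra_simps)
  also have "\<dots> \<le> real n * dominance_prob^2"
    using elim(1) by (intro mult_left_mono power_mono) auto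
  finally show ?case using kernel_m4_lower[OF n] by (simp add: kernel_fourth_def)
qed

lemma eventually_kernel_fourth_le:
  assumes "\<epsilon> > 0" "\<alpha> < 4"
  shows "eventually (\<lambda>n. kernel_fourth n \<le> 241 * real n powr (1 - 2 * weight_exponent + 2 * \<epsilon>)) sequentially"
  using eventually_m4_le[OF assms] eventually_ge_at_top[of 8]
proof eventually_elim
  case (elim n)
  interpret symmetric_entries N n using elim by (intro entries) auto
  have n: "n \<ge> 8" using elim by simp
  let ?x = "real n powr (- weight_exponent + \<epsilon>)"
  have "real n * m4^2 \<le> real n * ?x^2" using elim(1) m4_nonneg by (intro mult_left_mono power_mono) auto
  also have "real n * ?x^2 = real n powr (1 - 2 * weight_exponent + 2 * \<epsilon>)"
    using n by (subst mult_powr_square) (auto simp: algebra_simps)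
  finally show ?case using kernel_m4_le_moment unfolding kernel_fourth_def by linarith
qed

lemma eventually_p_ge:
  fixes p :: "nat \<Rightarrow> nat"
  assumes "filterlim (\<lambda>n. real (p n) / real n powr \<delta>) at_top sequentially"
  shows "eventually (\<lambda>n. real (p n)^2 \<ge> real n powr (2 * \<delta>)) sequentially"
proof -
  have "eventually (\<lambda>n. real (p n) / real n powr \<delta> \<ge> 1) sequentially"
    using assms by (simp add: filterlim_at_top)
  then show ?thesis using eventually_gt_at_top[of 0]
  proof eventually_elim
    case (elim n)
    then have "real n powr \<delta> \<le> real (p n)" by (simp add: field_simps)
    then have "(real n powr \<delta>)^2 \<le> real (p n)^2" by (intro power_mono) auto
    then show ?case by (simp add: power2_eq_square flip: powr_add)
  qed
qed

lemma eventually_p_le: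
  fixes p :: "nat \<Rightarrow> nat"
  assumes "(\<lambda>n. real (p n) / real n powr \<delta>) \<longlonglongrightarrow> 0"
  shows "eventually (\<lambda>n. real (p n)^2 \<le> real n powr (2 * \<delta>)) sequentially"
proof -
  have "eventually (\<lambda>n. real (p n) / real n powr \<delta> < 1) sequentially"
    using assms by (rule order_tendstoD) simp
  then show ?thesis using eventually_gt_at_top[of 0]
  proof eventually_elim
    case (elim n)
    then have "real (p n) \<le> real n powr \<delta>" by (simp add: field_simps)
    then have "real (p n)^2 \<le> (real n powr \<delta>)^2" by (intro power_mono) auto
    then show ?case by (simp add: power2_eq_square flip: powr_add)
  qed
qed

lemma powr_at_top: "e > 0 \<Longrightarrow> c > 0 \<Longrightarrow> filterlim (\<lambda>n. real n powr e / c) at_top sequentially" for c e :: real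
  by real_asymp

text \<open>
  For \<open>\<alpha> < 3\<close> the crude bound \<open>A \<le> V\<close> suffices, since \<open>p\<^sup>2 V\<close> diverges. For \<open>\<alpha> > 3\<close> one has \<open>V\<close> of order
  \<open>1 / n\<^sup>2\<close> and needs the bound of \<open>A\<close> by \<open>n m4\<^sup>2\<close>.
\<close>

lemma kurtosis_limit_large_p:
  fixes p :: "nat \<Rightarrow> nat"
  assumes \<alpha>: "\<alpha> < 4" "\<alpha> \<noteq> 3" and p: "filterlim p at_top sequentially"
    and \<delta>: "\<delta> > delta_star \<alpha>"
    and pd: "filterlim (\<lambda>n. real (p n) / real n powr \<delta>) at_top sequentially"
  shows "(\<lambda>n. stat_kurtosis n (p n)) \<longlonglongrightarrow> 3"
proof (cases "\<alpha> < 3")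
  case True
  define \<epsilon> where "\<epsilon> = (2 * \<delta> + 1 - 2 * weight_exponent) / 4"
  have d: "2 * \<delta> > 2 * weight_exponent - 1"
    using \<delta> True by (auto simp: delta_star_def weight_exponent_def max_def split: if_splits)
  then have \<epsilon>: "\<epsilon> > 0" by (simp add: \<epsilon>_def)
  have ev: "eventually (\<lambda>n. real n powr (2 * \<epsilon>) / 8 \<le> real (p n)^2 * kernel_var n) sequentially"
    using eventually_p_ge[OF pd] eventually_kernel_var_ge[OF \<epsilon>]
  proof eventually_elim
    case (elim n)
    have "real n powr (2 * \<epsilon>) / 8 = real n powr (2 * \<delta>) * (real n powr (1 - 2 * weight_exponent - 2 * \<epsilon>) / 8)"
      by (simp add: \<epsilon>_def flip: powr_add) (simp add: field_simps)
    also have "\<dots> \<le> real (p n)^2 * kernel_var n" using elim by (intro mult_mono) auto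
    finally show ?case .
  qed
  have top: "filterlim (\<lambda>n. real (p n)^2 * kernel_var n) at_top sequentially"
    by (rule filterlim_at_top_mono[OF powr_at_top ev]) (use \<epsilon> in auto)
  show ?thesis
  proof (rule kurtosis_tendsto_3[OF p])
    show "filterlim (\<lambda>n. real (p n)^2 * kernel_var n * n) at_top sequentially"
      by (rule filterlim_at_top_mult_at_top[OF top filterlim_real_sequentially])
    show "(\<lambda>n. kernel_fourth n / (real (p n)^2 * kernel_var n^2)) \<longlonglongrightarrow> 0"
    proof (rule tendsto_sandwich[where f="\<lambda>_. 0"])
      show "(\<lambda>n. 1 / (real (p n)^2 * kernel_var n)) \<longlonglongrightarrow> 0"
        by (rule tendsto_divide_0[OF tendsto_const filterlim_at_top_imp_at_infinity[OF top]])
      show "eventually (\<lambda>n. 0 \<le> kernel_fourth n / (real (p n)^2 * kernel_var n^2)) sequentially"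
        using eventually_ge_at_top[of 8] by eventually_elim (auto simp: kernel_fourth_nonneg)
      show "eventually (\<lambda>n. kernel_fourth n / (real (p n)^2 * kernel_var n^2) \<le> 1 / (real (p n)^2 * kernel_var n)) sequentially"
        using eventually_ge_at_top[of 8]
      proof eventually_elim
        case (elim n)
        have "kernel_fourth n / (real (p n)^2 * kernel_var n^2) \<le> kernel_var n / (real (p n)^2 * kernel_var n^2)"
          using kernel_fourth_le_var[OF elim] by (intro divide_right_mono) auto
        then show ?case using kernel_var_pos[OF elim] by (simp add: power2_eq_square)
      qed
    qed auto
  qed
next
  case False
  then have \<alpha>3: "\<alpha> > 3" using \<alpha> by simp
  then have a: "weight_exponent = \<alpha> / 2" by (simp add: weight_exponent_def)
  define \<epsilon> where "\<epsilon> = (2 * \<delta> - (5 - \<alpha>)) / 4"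
  have d: "2 * \<delta> > 5 - \<alpha>" using \<delta> \<alpha>3 by (simp add: delta_star_def)
  then have \<epsilon>: "\<epsilon> > 0" by (simp add: \<epsilon>_def)
  show ?thesis
  proof (rule kurtosis_tendsto_3[OF p])
    show "filterlim (\<lambda>n. real (p n)^2 * kernel_var n * n) at_top sequentially"
    proof (rule filterlim_at_top_mono)
      show "filterlim (\<lambda>n. real n powr (2 * \<delta> - 1) / 2) at_top sequentially"
        by (rule powr_at_top) (use d \<alpha> in auto)
      show "eventually (\<lambda>n. real n powr (2 * \<delta> - 1) / 2 \<le> real (p n)^2 * kernel_var n * n) sequentially"
        using eventually_p_ge[OF pd] eventually_ge_at_top[of 8]
      proof eventually_elim
        case (elim n)
        have "real n powr (2 * \<delta> - 1) = real n powr (2 * \<delta> + - 2 + 1)" by simp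
        also have "\<dots> = real n powr (2 * \<delta>) * real n powr (- 2) * real n powr 1" by (simp only: powr_add)
        finally have "real n powr (2 * \<delta> - 1) / 2 = real n powr (2 * \<delta>) * (real n powr (- 2) / 2) * real n powr 1"
          by simp
        also have "\<dots> \<le> real (p n)^2 * kernel_var n * real n powr 1"
          using elim kernel_var_ge_inverse[OF elim(2)] by (intro mult_mono) (auto simp: kernel_var_pos less_imp_le)
        finally show ?case by simp
      qed
    qed
    show "(\<lambda>n. kernel_fourth n / (real (p n)^2 * kernel_var n^2)) \<longlonglongrightarrow> 0"
    proof (rule tendsto_sandwich[where f="\<lambda>_. 0"])
      show "(\<lambda>n. 964 * real n powr (- (2 * \<epsilon>))) \<longlonglongrightarrow> 0"
        using \<epsilon> by real_asymp
      show "eventually (\<lambda>n. 0 \<le> kernel_fourth n / (real (p n)^2 * kernel_var n^2)) sequentially"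
        using eventually_ge_at_top[of 8] by eventually_elim (auto simp: kernel_fourth_nonneg)
      show "eventually (\<lambda>n. kernel_fourth n / (real (p n)^2 * kernel_var n^2) \<le> 964 * real n powr (- (2 * \<epsilon>))) sequentially"
        using eventually_p_ge[OF pd] eventually_kernel_fourth_le[OF \<epsilon> \<alpha>(1)] eventually_ge_at_top[of 8]
      proof eventually_elim
        case (elim n)
        have n: "real n > 0" using elim by simp
        have v: "(real n powr (- 2) / 2)^2 \<le> kernel_var n^2"
          by (intro power_mono kernel_var_ge_inverse[OF elim(3)]) auto
        have "kernel_fourth n / (real (p n)^2 * kernel_var n^2) \<le>
          (241 * real n powr (1 - 2 * weight_exponent + 2 * \<epsilon>)) / (real n powr (2 * \<delta>) * (real n powr (- 2) / 2)^2)"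
          using elim v n by (intro frac_le mult_mono mult_pos_pos) auto
        also have "\<dots> = 964 * (real n powr (1 - 2 * weight_exponent + 2 * \<epsilon>) / (real n powr (2 * \<delta>) * real n powr (- 4)))"
        proof -
          have e: "(real n powr (- 2) / 2)^2 = real n powr (- 4) / 4"
            by (simp add: power2_eq_square flip: powr_add)
          show ?thesis unfolding e by simp
        qed
        also have "real n powr (1 - 2 * weight_exponent + 2 * \<epsilon>) / (real n powr (2 * \<delta>) * real n powr (- 4))
          = real n powr (1 - 2 * weight_exponent + 2 * \<epsilon> - (2 * \<delta> + - 4))"
          using n by (simp only: powr_add powr_diff)
        also have "1 - 2 * weight_exponent + 2 * \<epsilon> - (2 * \<delta> + - 4) = - (2 * \<epsilon>)"
          by (simp add: a \<epsilon>_def field_simps)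
        finally show ?case .
      qed
    qed auto
  qed
qed

text \<open>Here \<open>s\<close> is the exponent of \<open>V\<close>, so that twice \<open>delta_star \<alpha>\<close> equals \<open>1 - 2 a - 2 s\<close>.\<close>

lemma kurtosis_limit_small_p:
  fixes p :: "nat \<Rightarrow> nat"
  assumes \<alpha>: "\<alpha> < 4" "\<alpha> \<noteq> 3" and p: "filterlim p at_top sequentially"
    and \<delta>: "\<delta> < delta_star \<alpha>"
    and pd: "(\<lambda>n. real (p n) / real n powr \<delta>) \<longlonglongrightarrow> 0"
  shows "filterlim (\<lambda>n. stat_kurtosis n (p n)) at_top sequentially"
proof -
  let ?a = "weight_exponent"
  define s where "s = (if \<alpha> < 3 then 1 - 2 * ?a else - 2)"
  define \<epsilon> where "\<epsilon> = min ((1 - 2 * ?a - 2 * \<delta> - 2 * s) / 12) (\<bar>3 - \<alpha>\<bar> / 2)"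
  have gap: "1 - 2 * ?a - 2 * \<delta> - 2 * s > 0"
    using \<delta> \<alpha> by (auto simp: delta_star_def weight_exponent_def s_def max_def split: if_splits)
  have \<epsilon>: "\<epsilon> > 0" using gap \<alpha> by (simp add: \<epsilon>_def)
  have "\<epsilon> \<le> (1 - 2 * ?a - 2 * \<delta> - 2 * s) / 12" "\<epsilon> \<le> \<bar>3 - \<alpha>\<bar> / 2"
    unfolding \<epsilon>_def by (rule min.cobounded1, rule min.cobounded2)
  then have \<epsilon>1: "12 * \<epsilon> \<le> 1 - 2 * ?a - 2 * \<delta> - 2 * s" and \<epsilon>2: "2 * \<epsilon> \<le> \<bar>3 - \<alpha>\<bar>"
    by auto
  have s1: "1 - 2 * ?a + 2 * \<epsilon> \<le> s + 2 * \<epsilon>" "1 - 2 * ?a + 2 * \<epsilon> \<le> s \<or> \<alpha> < 3" "- 2 \<le> s"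
    using \<epsilon>2 \<alpha> by (auto simp: s_def weight_exponent_def max_def)
  have V: "eventually (\<lambda>n. kernel_var n \<le> 7 * real n powr (s + 2 * \<epsilon>)) sequentially"
    using eventually_kernel_var_le[OF \<epsilon> \<alpha>(1)] eventually_ge_at_top[of 8]
  proof eventually_elim
    case (elim n)
    have "real n powr (1 - 2 * ?a + 2 * \<epsilon>) \<le> real n powr (s + 2 * \<epsilon>)" using elim s1 by (intro powr_mono) auto
    moreover have "real n powr (- 2) \<le> real n powr (s + 2 * \<epsilon>)" using elim s1 \<epsilon> by (intro powr_mono) auto
    ultimately show ?case using elim by linarith
  qed
  show ?thesis
  proof (rule kurtosis_at_top[OF p], rule filterlim_at_top_mono)
    show "filterlim (\<lambda>n. real n powr \<epsilon> / 784) at_top sequentially" by (rule powr_at_top) (use \<epsilon> in auto)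
    have "eventually (\<lambda>n. p n \<ge> 1) sequentially" using p by (simp add: filterlim_at_top)
    then show "eventually (\<lambda>n. real n powr \<epsilon> / 784 \<le> kernel_fourth n / (real (p n)^2 * kernel_var n^2)) sequentially"
      using V eventually_p_le[OF pd] eventually_kernel_fourth_ge[OF \<epsilon>] eventually_ge_at_top[of 8]
    proof eventually_elim
      case (elim n)
      have n: "real n \<ge> 1" using elim by simp
      have pos: "0 < real (p n)^2 * kernel_var n^2" using elim kernel_var_pos[OF elim(5)] by simp
      have "real n powr \<epsilon> / 784 \<le> real n powr (1 - 2 * ?a - 2 * \<epsilon> - (2 * \<delta> + (s + 2 * \<epsilon>) + (s + 2 * \<epsilon>))) / 784"
        using n \<epsilon> \<epsilon>1 by (intro divide_right_mono powr_mono) auto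
      also have "\<dots> = (real n powr (1 - 2 * ?a - 2 * \<epsilon>) / 16) / (real n powr (2 * \<delta>) * (7 * real n powr (s + 2 * \<epsilon>))^2)"
        by (simp only: powr_add powr_diff power2_eq_square) simp
      also have "\<dots> \<le> kernel_fourth n / (real (p n)^2 * kernel_var n^2)"
        using elim pos kernel_fourth_nonneg[OF elim(5)] kernel_var_pos[OF elim(5)]
        by (intro frac_le mult_mono power_mono) auto
      finally show ?case .
    qed
  qed
qed

end

section \<open>From the data matrix to the U-statistic\<close>

text \<open>
  Independence of all entries splits into independence between rows and within a row. So the array of
  rows is a sample from the product law of a row.
\<close>

lemma (in prob_space) law_of_matrix:
  fixes Z :: "nat \<Rightarrow> nat \<Rightarrow> 'a \<Rightarrow> real"
  assumes ind: "indep_vars (\<lambda>_. borel) (\<lambda>(i, j). Z i j) ({..<p} \<times> {..<n})"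
    and law: "\<And>i j. i < p \<Longrightarrow> j < n \<Longrightarrow> distr M borel (Z i j) = N"
    and pos: "p > 0" "n > 0"
  defines "array \<equiv> \<lambda>\<omega>. \<lambda>i\<in>{..<p}. \<lambda>j\<in>{..<n}. Z i j \<omega>"
  shows "array \<in> measurable M (\<Pi>\<^sub>M i\<in>{..<p}. \<Pi>\<^sub>M j\<in>{..<n}. N)"
    and "distr M (\<Pi>\<^sub>M i\<in>{..<p}. \<Pi>\<^sub>M j\<in>{..<n}. N) array = (\<Pi>\<^sub>M i\<in>{..<p}. \<Pi>\<^sub>M j\<in>{..<n}. N)"
proof -
  let ?B = "\<Pi>\<^sub>M j\<in>{..<n}. borel :: real measure"
  let ?row = "\<lambda>i \<omega>. \<lambda>j\<in>{..<n}. Z i j \<omega>"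
  have rv: "random_variable borel (Z i j)" if "i < p" "j < n" for i j
    using ind that unfolding indep_vars_def by auto
  have "distr M borel (Z 0 0) = N" using law pos by blast
  then have sN: "sets N = sets borel" by (metis sets_distr)
  have sB: "sets ?B = sets (\<Pi>\<^sub>M j\<in>{..<n}. N)" by (intro sets_PiM_cong) (auto simp: sN)
  have sP: "sets (\<Pi>\<^sub>M i\<in>{..<p}. ?B) = sets (\<Pi>\<^sub>M i\<in>{..<p}. \<Pi>\<^sub>M j\<in>{..<n}. N)"
    by (intro sets_PiM_cong refl sB)
  have row_rv: "random_variable ?B (?row i)" if "i < p" for i
    using that rv by (intro measurable_restrict) auto
  have row_law: "distr M ?B (?row i) = (\<Pi>\<^sub>M j\<in>{..<n}. N)" if i: "i < p" for i
  proof -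
    let ?K = "{i} \<times> {..<n}"
    let ?cell = "\<lambda>ij. (case ij of (i, j) \<Rightarrow> Z i j)"
    have cell_rv: "random_variable borel (?cell ij)" if "ij \<in> ?K" for ij using that i rv by auto
    have "indep_vars (\<lambda>_. borel) ?cell ?K"
      by (rule indep_vars_subset[OF ind]) (use i in auto)
    then have "distr M (PiM ?K (\<lambda>_. borel)) (\<lambda>\<omega>. \<lambda>ij\<in>?K. ?cell ij \<omega>) = PiM ?K (\<lambda>ij. distr M borel (?cell ij))"
      using pos cell_rv by (subst (asm) indep_vars_iff_distr_eq_PiM') auto
    also have "\<dots> = PiM ?K (\<lambda>_. N)" using i law by (intro PiM_cong) auto
    finally have K: "distr M (PiM ?K (\<lambda>_. borel)) (\<lambda>\<omega>. \<lambda>ij\<in>?K. ?cell ij \<omega>) = PiM ?K (\<lambda>_. N)" .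
    let ?g = "\<lambda>f. \<lambda>j\<in>{..<n}. f (i, j)"
    have g: "?g \<in> measurable (PiM ?K (\<lambda>_. borel)) ?B"
      by (intro measurable_restrict measurable_component_singleton) auto
    have r: "(\<lambda>\<omega>. \<lambda>ij\<in>?K. ?cell ij \<omega>) \<in> measurable M (PiM ?K (\<lambda>_. borel))"
      by (rule measurable_restrict) (rule cell_rv)
    have "distr M ?B (?row i) = distr M ?B (?g \<circ> (\<lambda>\<omega>. \<lambda>ij\<in>?K. ?cell ij \<omega>))"
      by (rule distr_cong) (auto simp: restrict_def fun_eq_iff)
    also have "\<dots> = distr (PiM ?K (\<lambda>_. N)) ?B ?g"
      unfolding K[symmetric] by (rule distr_distr[OF g r, symmetric])
    also have "\<dots> = distr (PiM ?K (\<lambda>_. N)) (\<Pi>\<^sub>M j\<in>{..<n}. N) ?g"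
      by (rule distr_cong) (auto simp: sB)
    also have "\<dots> = (\<Pi>\<^sub>M j\<in>{..<n}. N)"
    proof (rule distr_PiM_reindex)
      show "prob_space N" using law[of 0 0] pos rv[of 0 0] prob_space_distr by metis
    qed (auto simp: inj_on_def)
    finally show ?thesis .
  qed
  have rows_ind: "indep_vars (\<lambda>_. ?B) ?row {..<p}"
  proof -
    let ?K = "\<lambda>i. {i} \<times> {..<n}"
    have 1: "indep_vars (\<lambda>i. PiM (?K i) (\<lambda>_. borel)) (\<lambda>i \<omega>. restrict (\<lambda>ij. (case ij of (i, j) \<Rightarrow> Z i j) \<omega>) (?K i)) {..<p}"
      by (rule indep_vars_restrict[OF ind]) (auto simp: disjoint_family_on_def)
    have 2: "(\<lambda>f. \<lambda>j\<in>{..<n}. f (i, j)) \<in> measurable (PiM (?K i) (\<lambda>_. borel)) ?B" for i :: nat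
      by (intro measurable_restrict measurable_component_singleton) auto
    from indep_vars_compose2[OF 1 2]
    have 3: "indep_vars (\<lambda>_. ?B) (\<lambda>i \<omega>. \<lambda>j\<in>{..<n}. restrict (\<lambda>ij. (case ij of (i, j) \<Rightarrow> Z i j) \<omega>) (?K i) (i, j)) {..<p}" .
    have "(\<lambda>j\<in>{..<n}. restrict (\<lambda>ij. (case ij of (i, j) \<Rightarrow> Z i j) \<omega>) (?K i) (i, j)) = ?row i \<omega>" for i \<omega>
      by (rule ext) (simp add: restrict_def)
    with 3 show ?thesis by simp
  qed
  have "distr M (\<Pi>\<^sub>M i\<in>{..<p}. ?B) array = (\<Pi>\<^sub>M i\<in>{..<p}. distr M ?B (?row i))"
    unfolding array_def using rows_ind pos row_rv by (subst (asm) indep_vars_iff_distr_eq_PiM') auto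
  also have "\<dots> = (\<Pi>\<^sub>M i\<in>{..<p}. \<Pi>\<^sub>M j\<in>{..<n}. N)" using row_law by (intro PiM_cong) auto
  finally have 1: "distr M (\<Pi>\<^sub>M i\<in>{..<p}. ?B) array = (\<Pi>\<^sub>M i\<in>{..<p}. \<Pi>\<^sub>M j\<in>{..<n}. N)" .
  have "array \<in> measurable M (\<Pi>\<^sub>M i\<in>{..<p}. ?B)"
    unfolding array_def by (rule measurable_restrict) (use row_rv in auto)
  then show "array \<in> measurable M (\<Pi>\<^sub>M i\<in>{..<p}. \<Pi>\<^sub>M j\<in>{..<n}. N)"
    by (simp add: measurable_cong_sets[OF refl sP])
  have "distr M (\<Pi>\<^sub>M i\<in>{..<p}. \<Pi>\<^sub>M j\<in>{..<n}. N) array = distr M (\<Pi>\<^sub>M i\<in>{..<p}. ?B) array"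
    by (rule distr_cong) (use sP in auto)
  then show "distr M (\<Pi>\<^sub>M i\<in>{..<p}. \<Pi>\<^sub>M j\<in>{..<n}. N) array = (\<Pi>\<^sub>M i\<in>{..<p}. \<Pi>\<^sub>M j\<in>{..<n}. N)"
    unfolding 1 .
qed

lemma tr_R_sq_eq:
  "tr_R_sq p n X \<omega> = (\<Sum>i<p. \<Sum>k<p. (overlap n (\<lambda>j. X i j \<omega>) (\<lambda>j. X k j \<omega>))^2)"
proof -
  define Y where "Y = self_normalized p n (\<lambda>i j. X i j \<omega>)"
  have Yd: "dim_row Y = p" "dim_col Y = n" by (simp_all add: Y_def self_normalized_def)
  have R: "sample_correlation p n (\<lambda>i j. X i j \<omega>) = Y * transpose_mat Y"
    by (simp add: sample_correlation_def Y_def)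
  have Rij: "(Y * transpose_mat Y) $$ (i, k) = overlap n (\<lambda>j. X i j \<omega>) (\<lambda>j. X k j \<omega>)" if "i < p" "k < p" for i k
    using that by (simp add: Yd scalar_prod_def overlap_def Y_def self_normalized_def direction_def
        atLeast0LessThan)
  have carrier: "Y * transpose_mat Y \<in> carrier_mat p p" using Yd by (intro carrier_matI) auto
  have "tr_R_sq p n X \<omega> = mat_tr ((Y * transpose_mat Y) * (Y * transpose_mat Y))"
    using carrier by (simp add: tr_R_sq_def R numeral_2_eq_2)
  also have "\<dots> = (\<Sum>i<p. \<Sum>k<p. (Y * transpose_mat Y) $$ (i, k) * (Y * transpose_mat Y) $$ (k, i))"
  proof -
    have "(A * A) $$ (x, x) = (\<Sum>k<p. A $$ (x, k) * A $$ (k, x))"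
      if "A \<in> carrier_mat p p" "x < p" for A :: "real mat" and x
      using that by (simp add: scalar_prod_def atLeast0LessThan)
    then show ?thesis unfolding mat_tr_def using carrier Yd by simp
  qed
  also have "\<dots> = (\<Sum>i<p. \<Sum>k<p. (overlap n (\<lambda>j. X i j \<omega>) (\<lambda>j. X k j \<omega>))^2)"
    by (intro sum.cong refl) (simp add: Rij power2_eq_square overlap_def mult.commute)
  finally show ?thesis .
qed

context symmetric_entries
begin

lemma U_stat_corr_kernel:
  assumes "\<And>i. i < p \<Longrightarrow> mass (x i) = 1"
  shows "(\<Sum>i<p. \<Sum>k<p. (overlap n (x i) (x k))^2) = p + p * (real p - 1) / n + 2 * K.U_stat p x"
  using assms
proof (induction p)
  case (Suc p)
  have m: "mass (x i) = 1" if "i \<le> p" for i using Suc.prems that by auto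
  have sym: "(\<Sum>i<p. (overlap n (x p) (x i))^2) = (\<Sum>i<p. (overlap n (x i) (x p))^2)"
    by (simp add: overlap_def mult.commute)
  have pp: "(overlap n (x p) (x p))^2 = 1" by (simp add: overlap_self m)
  have h: "(overlap n (x i) (x p))^2 = corr_kernel n (x i) (x p) + 1 / n" if "i < p" for i
    using that by (simp add: corr_kernel_def m)
  have "(\<Sum>i<Suc p. \<Sum>k<Suc p. (overlap n (x i) (x k))^2) =
     (\<Sum>i<p. \<Sum>k<p. (overlap n (x i) (x k))^2) + 2 * (\<Sum>i<p. (overlap n (x i) (x p))^2) + 1"
    by (simp add: sum.distrib sym pp)
  also have "(\<Sum>i<p. (overlap n (x i) (x p))^2) = K.increment p x (x p) + p / n"
    by (simp add: K.increment_def h sum.distrib)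
  also have "(\<Sum>i<p. \<Sum>k<p. (overlap n (x i) (x k))^2) = p + p * (real p - 1) / n + 2 * K.U_stat p x"
    using Suc by simp
  also have "p + p * (real p - 1) / n + 2 * K.U_stat p x + 2 * (K.increment p x (x p) + p / n) + 1
      = Suc p + Suc p * (real (Suc p) - 1) / n + 2 * K.U_stat (Suc p) x"
    using n_pos by (simp add: K.U_stat_Suc field_simps)
  finally show ?case .
qed (simp add: K.U_stat_def)

lemma AE_sample_mass: "AE x in K.sample p. \<forall>i<p. mass (x i) = 1"
proof -
  have "AE x in K.sample p. mass (x i) = 1" if "i < p" for i
    using AE_PiM_component[of "{..<p}" "\<lambda>_. row_law" i "\<lambda>y. mass y = 1"] that AE_mass prob_space_row_law by auto
  then have "AE x in K.sample p. \<forall>i\<in>{..<p}. mass (x i) = 1"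
    by (intro AE_finite_allI) auto
  then show ?thesis by eventually_elim auto
qed

text \<open>
  Kurtosis is invariant under affine maps, and almost surely \<open>tr R\<^sup>2\<close> is an affine function
  of the U-statistic of the rows.
\<close>

lemma kurtosis_tr_R_sq:
  fixes M :: "'a measure" and X :: "nat \<Rightarrow> nat \<Rightarrow> 'a \<Rightarrow> real"
  assumes M: "prob_space M"
    and ind: "prob_space.indep_vars M (\<lambda>_. borel) (\<lambda>(i, j). X i j) ({..<p} \<times> {..<n})"
    and law: "\<And>i j. i < p \<Longrightarrow> j < n \<Longrightarrow> distr M borel (X i j) = N"
    and p: "p > 0"
  shows "kurtosis M (tr_R_sq p n X) = K.U_m4 p / (K.U_m2 p)^2"
proof -
  interpret M: prob_space M by (rule M)
  define array where "array \<omega> = (\<lambda>i\<in>{..<p}. \<lambda>j\<in>{..<n}. X i j \<omega>)" for \<omega>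
  have n0: "n > 0" using two_le_n by simp
  have am: "array \<in> measurable M (K.sample p)" and ad: "distr M (K.sample p) array = K.sample p"
    using M.law_of_matrix[OF ind law p n0] unfolding array_def[abs_def] by auto
  define c where "c = p + p * (real p - 1) / n"
  have ov: "overlap n (\<lambda>j. X i j \<omega>) (\<lambda>j. X k j \<omega>) = overlap n (array \<omega> i) (array \<omega> k)"
    if "i < p" "k < p" for i k \<omega>
    using that by (simp add: overlap_def direction_def array_def)
  have "AE \<omega> in M. \<forall>i<p. mass (array \<omega> i) = 1"
  proof -
    have "AE x in distr M (K.sample p) array. \<forall>i<p. mass (x i) = 1" unfolding ad by (rule AE_sample_mass)
    then show ?thesis by (rule AE_distrD[OF am])
  qed
  then have T: "AE \<omega> in M. tr_R_sq p n X \<omega> = c + 2 * K.U_stat p (array \<omega>)"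
  proof eventually_elim
    case (elim \<omega>)
    have "tr_R_sq p n X \<omega> = (\<Sum>i<p. \<Sum>k<p. (overlap n (array \<omega> i) (array \<omega> k))^2)"
      unfolding tr_R_sq_eq by (intro sum.cong refl) (simp add: ov)
    also have "\<dots> = c + 2 * K.U_stat p (array \<omega>)"
      unfolding c_def by (rule U_stat_corr_kernel) (use elim in auto)
    finally show ?case .
  qed
  have Um: "(\<lambda>\<omega>. K.U_stat p (array \<omega>)) \<in> borel_measurable M"
    by (rule measurable_compose[OF am K.U_stat_sample_measurable])
  have Ui: "integrable M (\<lambda>\<omega>. K.U_stat p (array \<omega>))"
    by (rule M.integrable_bounded[OF Um]) (rule K.U_stat_bound)
  have E: "(\<integral>\<omega>. f (K.U_stat p (array \<omega>)) \<partial>M) = (\<integral>x. f (K.U_stat p x) \<partial>K.sample p)"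
    if "f \<in> borel_measurable borel" for f :: "real \<Rightarrow> real"
    using integral_distr[OF am, of "\<lambda>x. f (K.U_stat p x)"] that K.U_stat_sample_measurable
    unfolding ad by (simp add: measurable_compose[OF K.U_stat_sample_measurable])
  have tm: "tr_R_sq p n X \<in> borel_measurable M"
  proof -
    have "(\<lambda>\<omega>. dir (array \<omega> i) t) \<in> borel_measurable M" if "i < p" "t < n" for i t
      using that by (intro measurable_compose[OF am] measurable_compose[OF K.measurable_sample_component] dir_measurable)
    then have "(\<lambda>\<omega>. \<Sum>i<p. \<Sum>k<p. (overlap n (array \<omega> i) (array \<omega> k))^2) \<in> borel_measurable M"
      unfolding overlap_def
      by (intro borel_measurable_sum borel_measurable_power borel_measurable_times) auto
    moreover have "tr_R_sq p n X = (\<lambda>\<omega>. \<Sum>i<p. \<Sum>k<p. (overlap n (array \<omega> i) (array \<omega> k))^2)"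
      by (intro ext) (simp only: tr_R_sq_eq, intro sum.cong refl, simp add: ov)
    ultimately show ?thesis by simp
  qed
  have cong: "(\<integral>\<omega>. f (tr_R_sq p n X \<omega>) \<partial>M) = (\<integral>\<omega>. f (c + 2 * K.U_stat p (array \<omega>)) \<partial>M)"
    if [measurable]: "f \<in> borel_measurable borel" for f :: "real \<Rightarrow> real"
  proof (rule integral_cong_AE)
    show "(\<lambda>\<omega>. f (tr_R_sq p n X \<omega>)) \<in> borel_measurable M" using tm by measurable
    show "(\<lambda>\<omega>. f (c + 2 * K.U_stat p (array \<omega>))) \<in> borel_measurable M" using Um by measurable
    show "AE \<omega> in M. f (tr_R_sq p n X \<omega>) = f (c + 2 * K.U_stat p (array \<omega>))"
      using T by eventually_elim simp
  qed
  have mean: "(\<integral>\<omega>. tr_R_sq p n X \<omega> \<partial>M) = c"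
    using cong[of "\<lambda>x. x"] E[of "\<lambda>x. x"] K.U_stat_mean[of p] Ui by (simp add: M.prob_space)
  have "M.variance (tr_R_sq p n X) = 4 * K.U_m2 p"
    using cong[of "\<lambda>x. (x - c)^2"] E[of "\<lambda>x. x^2"] by (simp add: mean power_mult_distrib K.U_m2_def)
  moreover have "M.expectation (\<lambda>\<omega>. (tr_R_sq p n X \<omega> - M.expectation (tr_R_sq p n X))^4) = 16 * K.U_m4 p"
    using cong[of "\<lambda>x. (x - c)^4"] E[of "\<lambda>x. x^4"] by (simp add: mean power_mult_distrib K.U_m4_def)
  ultimately show ?thesis by (simp add: kurtosis_def power_mult_distrib)
qed

end

theorem theorem2p7:
  fixes M :: "'a measure"
    and \<xi> :: "'a \<Rightarrow> real"
    and X :: "nat \<Rightarrow> nat \<Rightarrow> nat \<Rightarrow> 'a \<Rightarrow> real"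
    and p :: "nat \<Rightarrow> nat"
    and \<alpha> :: real
    and L :: "real \<Rightarrow> real"
  assumes "prob_space M"
    and "\<xi> \<in> borel_measurable M"
    and "nondegenerate_rv M \<xi>"
    and "symmetric_rv M \<xi>"
    and "measure M {\<omega> \<in> space M. \<xi> \<omega> = 0} = 0"
    and "integrable M (\<lambda>\<omega>. (\<xi> \<omega>)\<^sup>2) \<Longrightarrow> integral\<^sup>L M (\<lambda>\<omega>. (\<xi> \<omega>)\<^sup>2) = 1"
    and "\<And>n. iid_copies M \<xi> (\<lambda>(i, j). X n i j) ({..<p n} \<times> {..<n})"
    and "\<alpha> \<in> {0<..<3} \<union> {3<..<4}"
    and "slowly_varying L"
    and "\<And>x. x > 0 \<Longrightarrow> measure M {\<omega> \<in> space M. \<bar>\<xi> \<omega>\<bar> > x} = x powr (- \<alpha>) * L x"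
    and "filterlim p at_top sequentially"
  shows "((\<exists>\<delta>>delta_star \<alpha>. filterlim (\<lambda>n. real (p n) / real n powr \<delta>) at_top sequentially) \<longrightarrow>
           (\<lambda>n. kurtosis M (tr_R_sq (p n) n (X n))) \<longlonglongrightarrow> 3) \<and>
         ((\<exists>\<delta><delta_star \<alpha>. (\<lambda>n. real (p n) / real n powr \<delta>) \<longlonglongrightarrow> 0) \<longrightarrow>
           filterlim (\<lambda>n. kurtosis M (tr_R_sq (p n) n (X n))) at_top sequentially)"
proof -
  interpret M: prob_space M by (rule assms(1))
  define N where "N = distr M borel \<xi>"
  define G where "G x = x powr (- \<alpha>) * L x" for x
  have \<xi> [measurable]: "\<xi> \<in> borel_measurable M" by (rule assms(2))
  have \<alpha>: "0 < \<alpha>" "\<alpha> < 4" "\<alpha> \<noteq> 3" using assms(8) by auto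
  have L1: "eventually (\<lambda>x. L x > 0) at_top" and L2: "((\<lambda>x. L (2 * x) / L x) \<longlongrightarrow> 1) at_top"
    using assms(9) by (auto simp: slowly_varying_def eventually_at_top_linorder)
  interpret R: regularly_varying_entries N \<alpha> G
  proof (intro regularly_varying_entries.intro regularly_varying_law.intro
      regularly_varying_law_axioms.intro regularly_varying_entries_axioms.intro)
    show "prob_space N" unfolding N_def by (rule M.prob_space_distr) simp
    show "sets N = sets borel" by (simp add: N_def)
    show "\<alpha> > 0" by (rule \<alpha>)
    show "measure N {y. \<bar>y\<bar> > x} = G x" if "x > 0" for x
    proof -
      have "{y\<in>space borel. \<bar>y\<bar> > x} \<in> sets (borel::real measure)" by measurable
      then have "measure N {y. \<bar>y\<bar> > x} = measure M (\<xi> -` {y. \<bar>y\<bar> > x} \<inter> space M)"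
        unfolding N_def by (intro measure_distr) auto
      also have "\<xi> -` {y. \<bar>y\<bar> > x} \<inter> space M = {\<omega> \<in> space M. \<bar>\<xi> \<omega>\<bar> > x}" by auto
      finally show ?thesis using assms(10)[OF that] by (simp add: G_def)
    qed
    show "eventually (\<lambda>x. G x > 0) at_top"
      using L1 eventually_gt_at_top[of 0] by eventually_elim (simp add: G_def)
    show "((\<lambda>x. G (2 * x) / G x) \<longlongrightarrow> 2 powr (- \<alpha>)) at_top"
    proof (rule Lim_transform_eventually)
      show "((\<lambda>x. 2 powr (- \<alpha>) * (L (2 * x) / L x)) \<longlongrightarrow> 2 powr (- \<alpha>)) at_top"
        using tendsto_mult[OF tendsto_const L2, of "2 powr (- \<alpha>)"] by simp
      show "eventually (\<lambda>x. 2 powr (- \<alpha>) * (L (2 * x) / L x) = G (2 * x) / G x) at_top"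
        using eventually_gt_at_top[of 0] by eventually_elim (simp add: G_def powr_mult)
    qed
    show "distr N borel uminus = N"
    proof -
      have "distr N borel uminus = distr M borel (\<lambda>\<omega>. - \<xi> \<omega>)"
        unfolding N_def by (subst distr_distr) (auto simp: comp_def)
      then show ?thesis using assms(4) by (simp add: N_def symmetric_rv_def)
    qed
    show "AE x in N. x \<noteq> 0"
    proof -
      have "{\<omega> \<in> space M. \<xi> \<omega> = 0} \<in> sets M" by measurable
      then have "AE \<omega> in M. \<xi> \<omega> \<noteq> 0"
        using M.prob_Collect_eq_0[of "\<lambda>\<omega>. \<xi> \<omega> = 0"] assms(5) by blast
      then show ?thesis unfolding N_def by (subst AE_distr_iff) auto
    qed
  qed
  have "eventually (\<lambda>n. p n \<ge> 1) sequentially" using assms(11) by (simp add: filterlim_at_top)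
  then have "eventually (\<lambda>n. n \<ge> 2 \<and> p n \<ge> 1) sequentially"
    using eventually_ge_at_top[of 2] by (intro eventually_conj)
  then have kurt: "eventually (\<lambda>n. R.stat_kurtosis n (p n) = kurtosis M (tr_R_sq (p n) n (X n))) sequentially"
  proof eventually_elim
    case (elim n)
    interpret symmetric_entries N n using elim by (intro R.entries) auto
    have "iid_copies M \<xi> (\<lambda>(i, j). X n i j) ({..<p n} \<times> {..<n})" by (rule assms(7))
    then have "prob_space.indep_vars M (\<lambda>_. borel) (\<lambda>(i, j). X n i j) ({..<p n} \<times> {..<n})"
      and "\<And>i j. i < p n \<Longrightarrow> j < n \<Longrightarrow> distr M borel (X n i j) = N"
      by (auto simp: iid_copies_def N_def)
    from kurtosis_tr_R_sq[OF assms(1) this] elim(1) show ?case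
      by (simp add: R.stat_kurtosis_def)
  qed
  show ?thesis
  proof (intro conjI impI; elim exE conjE)
    fix \<delta> assume "\<delta> > delta_star \<alpha>" "filterlim (\<lambda>n. real (p n) / real n powr \<delta>) at_top sequentially"
    from R.kurtosis_limit_large_p[OF \<alpha>(2,3) assms(11) this]
    show "(\<lambda>n. kurtosis M (tr_R_sq (p n) n (X n))) \<longlonglongrightarrow> 3"
      by (rule Lim_transform_eventually) (rule kurt)
  next
    fix \<delta> assume "\<delta> < delta_star \<alpha>" "(\<lambda>n. real (p n) / real n powr \<delta>) \<longlonglongrightarrow> 0"
    from R.kurtosis_limit_small_p[OF \<alpha>(2,3) assms(11) this]
    show "filterlim (\<lambda>n. kurtosis M (tr_R_sq (p n) n (X n))) at_top sequentially"
      using filterlim_cong[OF refl refl kurt] by simp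
  qed
qed

end
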